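(* Let $\xi_0,\xi_1,\dots$ be nondegenerate i.i.d. complex random variables with $\mathbb{P}(\xi_0=0)=0$ and $\mathbb{E}\log(1+|\xi_0|)<\infty$, and let $K_n(z)=\sum_{k=0}^n\xi_kz^k$ be the Kac polynomials. Let $0\le N_n\le n$ be integers, $D_n=n-N_n$, and assume $D_n\to\infty$ as $n\to\infty$. Let $\mu^K_{D_n}$ be the counting measure of zeros of the $N_n$-th derivative $K_n^{(N_n)}$. Then: (1) If $N_n/n\to0$, then $\frac{1}{D_n}\mu^K_{D_n}$ converges in probability to the uniform probability measure on the unit circle. (2) If $N_n/n\to a\in(0,1)$, then $\frac{1}{D_n}\mu^K_{D_n}$ converges in probability to the rotationally invariant measure $\mu_a^K$ on $\mathbb{C}$ determined by $$\mu_a^K(\mathbb{D}_r)=\begin{cases}\dfrac{ar}{(1-a)(1-r)}, & 0<r<1-a,\\[2mm] 1, & r\ge 1-a.\end{cases}$$ (3) If $N_n/n\to1$, then $\frac{1}{D_n}\mu^K_{D_n}\to\delta_0$ in probability. Moreover, with $R_n=n/D_n$, the measure $\frac{1}{D_n}\mathcal{S}_{R_n}(\mu^K_{D_n})$ (which is the normalized zero counting measure of $\tilde K_n(z):=K_n^{(N_n)}(z/R_n)$) converges in probability to the rotationally invariant measure $\tilde\mu^K$ with $\tilde\mu^K(\mathbb{D}_r)=r$ for $r<1$ and $\tilde\mu^K(\mathbb{D}_r)=1$ for $r\ge1$; equivalently $\tilde\mu^K$ has density $\frac{1}{2\pi|z|}\mathbf{1}_{|z|\le1}$ with respect to Lebesgue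 measure.
   Context: For a polynomial $f$, $\mu_f=\sum_{z:\,f(z)=0}\delta_z$ is the counting measure of its zeros (with multiplicity). $\mathbb{D}_r$ is the open disk of radius $r$ centered at $0$. For $h>0$ and a measure $\nu$ on $\mathbb{C}$, $(\mathcal{S}_h\nu)(B)=\nu(B/h)$ for Borel $B$. A sequence of random measures $\nu_n$ converges in probability to a deterministic measure $\nu$ if $\int\phi\,d\nu_n\to\int\phi\,d\nu$ in probability for every smooth compactly supported test function $\phi$ on $\mathbb{C}$. *)

theory Defs
  imports "HOL-Probability.Probability" "HOL-Computational_Algebra.Polynomial"
begin

definition dir_deriv :: "complex \<Rightarrow> (complex \<Rightarrow> real) \<Rightarrow> complex \<Rightarrow> real" where
  "dir_deriv v f z = (THE d. ((\<lambda>t::real. f (z + of_real t * v)) has_real_derivative d) (at 0))"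

fun iter_partial :: "complex list \<Rightarrow> (complex \<Rightarrow> real) \<Rightarrow> complex \<Rightarrow> real" where
  "iter_partial [] f = f"
| "iter_partial (v # vs) f = dir_deriv v (iter_partial vs f)"

definition smooth_fun :: "(complex \<Rightarrow> real) \<Rightarrow> bool" where
  "smooth_fun f \<longleftrightarrow> (\<forall>vs. set vs \<subseteq> {1, \<i>} \<longrightarrow>
      continuous_on UNIV (iter_partial vs f) \<and>
      (\<forall>v\<in>{1, \<i>}. \<forall>z. (\<lambda>t::real. iter_partial vs f (z + of_real t * v)) differentiable (at 0)))"

definition test_fun :: "(complex \<Rightarrow> real) \<Rightarrow> bool" where
  "test_fun f \<longleftrightarrow> smooth_fun f \<and> compact (closure {z. f z \<noteq> 0})"

definition zero_integral :: "complex poly \<Rightarrow> (complex \<Rightarrow> real) \<Rightarrow> real" where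
  "zero_integral p \<phi> = (\<Sum>z\<in>{z. poly p z = 0}. real (order z p) * \<phi> z)"

definition kac_poly :: "(nat \<Rightarrow> 'a \<Rightarrow> complex) \<Rightarrow> nat \<Rightarrow> 'a \<Rightarrow> complex poly" where
  "kac_poly \<xi> n \<omega> = (\<Sum>k\<le>n. monom (\<xi> k \<omega>) k)"

text \<open>Convergence in probability of real random quantities X n to a constant c
  (with outer probability, so no measurability issue can trivialise it).\<close>
definition conv_in_prob :: "'a measure \<Rightarrow> (nat \<Rightarrow> 'a \<Rightarrow> real) \<Rightarrow> real \<Rightarrow> bool" where
  "conv_in_prob M X c \<longleftrightarrow> (\<forall>\<epsilon>>0. \<forall>\<delta>>0. eventually (\<lambda>n. \<exists>A\<in>sets M.
      {\<omega>\<in>space M. \<bar>X n \<omega> - c\<bar> > \<epsilon>} \<subseteq> A \<and> measure M A < \<delta>) sequentially)"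

text \<open>Random measures nu_n converge in probability to nu: tested against all test functions.
  The random measure is given by its integration functional.\<close>
definition measures_conv_in_prob ::
  "'a measure \<Rightarrow> (nat \<Rightarrow> 'a \<Rightarrow> (complex \<Rightarrow> real) \<Rightarrow> real) \<Rightarrow> complex measure \<Rightarrow> bool" where
  "measures_conv_in_prob M I \<nu> \<longleftrightarrow>
     (\<forall>\<phi>. test_fun \<phi> \<longrightarrow> conv_in_prob M (\<lambda>n \<omega>. I n \<omega> \<phi>) (integral\<^sup>L \<nu> \<phi>))"

definition rot_invariant :: "complex measure \<Rightarrow> bool" where
  "rot_invariant \<nu> \<longleftrightarrow> sets \<nu> = sets borel \<and> (\<forall>\<theta>. distr \<nu> borel (\<lambda>z. cis \<theta> * z) = \<nu>)"

definition unif_circle :: "complex measure" where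
  "unif_circle = distr (uniform_measure lborel {0..2*pi}) borel cis"

end

theory Submission
  imports Defs "HOL-Complex_Analysis.Complex_Analysis" "HOL-Real_Asymp.Real_Asymp"
    "HOL-Computational_Algebra.Computational_Algebra"
begin

text \<open>
  The zeros of a polynomial of degree \<open>D\<close> are recovered from its potential: by Green's formula
  \<open>\<Sum> \<phi>(z\<^sub>j) = (1/2\<pi>) \<integral> ln |p| \<Delta>\<phi>\<close>, so it suffices that \<open>(1/D) ln |p|\<close> converges to the limiting
  potential \<open>U\<close> in \<open>L\<^sup>1\<close> on compact sets. Since \<open>ln |p|\<close> is subharmonic, this follows from an upper bound
  \<open>U + \<epsilon>\<close> on discs and a lower bound \<open>U - \<epsilon>\<close> at a single point of each disc of a fine net.

  After division by \<open>N!\<close> the derivative is \<open>\<Sum> C(N+k,k) \<xi>\<^sub>N\<^sub>+\<^sub>k z\<^sup>k\<close>. Because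
  \<open>C(N+k,k) r\<^sup>k (1-r)\<^sup>N \<le> 1\<close>, the potential is at most \<open>-(N/D) ln (1-r)\<close> for \<open>r\<close> up to the critical radius
  \<open>D/n\<close> and continues as \<open>ln r + const\<close> beyond it; the logarithmic moment controls the coefficients.
  Beyond the critical radius the leading coefficient alone forces the lower bound, through the maximum
  principle; so does the constant coefficient inside the unit circle when \<open>N/n \<rightarrow> 0\<close>. In the
  other inner regimes many neighbouring terms have nearly the maximal modulus, and the sum cannot
  concentrate near \<open>0\<close>: this is seen on characteristic functions and uses that \<open>\<xi>\<^sub>0\<close> is nondegenerate.

  The limiting measures are identified by comparing them, via their rotation invariance, with the zeros of
  \<open>z\<^sup>m - w\<^sup>m\<close> for \<open>m \<rightarrow> \<infinity>\<close>.
\<close>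

section \<open>Green's formula in the plane\<close>

text \<open>The hypotheses treat large and small coefficients very differently. The logarithmic
  moment bounds all \<open>D + 1\<close> coefficients simultaneously by
  \<open>exp (\<epsilon> * D)\<close>, whereas \<open>\<xi> 0 \<noteq> 0\<close> almost surely
  bounds only one chosen coefficient at a time from below. This is why the lower bound is asked for
  at some point of each disc, which may depend on the outcome: a bound on the leading or the
  constant coefficient controls the maximum over a circle, and hence over a short arc, but not by
  itself the value at a prescribed point. Where anticoncentration takes over, the free choice of the
  point allows an argument that is a rational multiple of \<pi>.

  The net is fixed before \<open>n\<close> grows, so each \<open>n\<close> involves finitely many
  events, and each needs only probability tending to one, without a rate. Hence the small ball
  estimate can be qualitative: the number \<open>L\<close> of nearly equal weights is fixed while
  \<open>n\<close> tends to infinity, and the resulting bound is small once \<open>L\<close> is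
  large.

  Green's formula is derived from one-dimensional integration by parts and Fubini, with slopes of
  lines through the origin in place of polar angles.\<close>

lemma lborel_complex_eq:
  "(lborel :: complex measure) = distr (lborel \<Otimes>\<^sub>M lborel) borel (\<lambda>(x, y). Complex x y)"
proof (rule lborel_eqI)
  fix l u :: complex
  assume le: "\<And>b. b \<in> Basis \<Longrightarrow> l \<bullet> b \<le> u \<bullet> b"
  have le': "Re l \<le> Re u" "Im l \<le> Im u"
    using le[of 1] le[of \<i>] by (auto simp: Basis_complex_def inner_complex_def)
  have m: "(\<lambda>(x, y). Complex x y) \<in> borel_measurable (lborel \<Otimes>\<^sub>M lborel)"
    unfolding Complex_eq by measurable
  have "(\<lambda>(x, y). Complex x y) -` box l u \<inter> space (lborel \<Otimes>\<^sub>M lborel) = box (Re l) (Re u) \<times> box (Im l) (Im u)"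
    by (auto simp: box_def Basis_complex_def inner_complex_def space_pair_measure)
  then have "emeasure (distr (lborel \<Otimes>\<^sub>M lborel) borel (\<lambda>(x, y). Complex x y)) (box l u) =
      emeasure (lborel \<Otimes>\<^sub>M lborel) (box (Re l) (Re u) \<times> box (Im l) (Im u))"
    by (subst emeasure_distr[OF m]) auto
  also have "\<dots> = emeasure lborel (box (Re l) (Re u)) * emeasure lborel (box (Im l) (Im u))"
    by (rule lborel.emeasure_pair_measure_Times) auto
  also have "\<dots> = ennreal ((Re u - Re l) * (Im u - Im l))"
    using le' by (simp add: ennreal_mult')
  also have "\<dots> = (\<Prod>b\<in>Basis. (u - l) \<bullet> b)"
    by (simp add: Basis_complex_def inner_complex_def)
  finally show "emeasure (distr (lborel \<Otimes>\<^sub>M lborel) borel (\<lambda>(x, y). Complex x y)) (box l u) =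
      (\<Prod>b\<in>Basis. (u - l) \<bullet> b)" .
qed simp

lemma measurable_Complex [measurable]:
  "(\<lambda>(x, y). Complex x y) \<in> borel_measurable (lborel \<Otimes>\<^sub>M lborel)"
  unfolding Complex_eq by measurable

lemma complex_fubini:
  fixes f :: "complex \<Rightarrow> real"
  assumes f: "integrable lborel f"
  shows "integral\<^sup>L lborel f = (\<integral>y. (\<integral>x. f (Complex x y) \<partial>lborel) \<partial>lborel)"
    and "integral\<^sup>L lborel f = (\<integral>x. (\<integral>y. f (Complex x y) \<partial>lborel) \<partial>lborel)"
proof -
  have fm: "f \<in> borel_measurable borel" using f by auto
  have i: "integrable (lborel \<Otimes>\<^sub>M lborel) (\<lambda>(x, y). f (Complex x y))"
    using f unfolding lborel_complex_eq
    by (subst (asm) integrable_distr_eq) (auto simp: case_prod_beta' fm)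
  have "integral\<^sup>L lborel f = integral\<^sup>L (lborel \<Otimes>\<^sub>M lborel) (\<lambda>(x, y). f (Complex x y))"
    unfolding lborel_complex_eq by (subst integral_distr) (auto simp: case_prod_beta' fm)
  then show "integral\<^sup>L lborel f = (\<integral>y. (\<integral>x. f (Complex x y) \<partial>lborel) \<partial>lborel)"
    "integral\<^sup>L lborel f = (\<integral>x. (\<integral>y. f (Complex x y) \<partial>lborel) \<partial>lborel)"
    using lborel_pair.integral_snd[OF i] lborel_pair.integral_fst[OF i] by simp_all
qed

lemma complex_nn_fubini:
  assumes [measurable]: "f \<in> borel_measurable borel"
  shows "(\<integral>\<^sup>+z. f z \<partial>lborel) = (\<integral>\<^sup>+y. (\<integral>\<^sup>+x. f (Complex x y) \<partial>lborel) \<partial>lborel)"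
proof -
  have "(\<integral>\<^sup>+z. f z \<partial>lborel) = (\<integral>\<^sup>+p. f (case p of (x,y) \<Rightarrow> Complex x y) \<partial>(lborel \<Otimes>\<^sub>M lborel))"
    unfolding lborel_complex_eq by (subst nn_integral_distr) auto
  also have "\<dots> = (\<integral>\<^sup>+y. (\<integral>\<^sup>+x. f (Complex x y) \<partial>lborel) \<partial>lborel)"
    by (subst lborel_pair.nn_integral_snd[symmetric]) auto
  finally show ?thesis .
qed

section \<open>Integrability of the logarithmic kernel\<close>

lemma nn_integral_inverse_sqrt_finite:
  assumes "R > 0"
  shows "(\<integral>\<^sup>+x. ennreal (indicator {-R..R} x * \<bar>x\<bar> powr (-1/2)) \<partial>lborel) < \<infinity>"
proof -
  have "((\<lambda>x. x powr (-1/2)) has_integral (R powr (1/2) / (1/2))) {0..R}"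
    using has_integral_powr_from_0[of "-1/2" R] assms by simp
  then have "(\<integral>\<^sup>+x. ennreal (indicator {0..R} x * x powr (-1/2)) \<partial>lborel) = ennreal (R powr (1/2) / (1/2))"
    by (intro nn_integral_has_integral_lebesgue) auto
  then have fin: "(\<integral>\<^sup>+x. ennreal (indicator {0..R} x * x powr (-1/2)) \<partial>lborel) < \<infinity>"
    by simp
  have "(\<integral>\<^sup>+x. ennreal (indicator {0..R} x * x powr (-1/2)) \<partial>lborel) =
     (\<integral>\<^sup>+x. ennreal (indicator {0..R} (-x) * (-x) powr (-1/2)) \<partial>lborel)"
    by (subst nn_integral_real_affine[where c="-1" and t=0]) auto
  with fin have fin2: "(\<integral>\<^sup>+x. ennreal (indicator {0..R} (-x) * (-x) powr (-1/2)) \<partial>lborel) < \<infinity>"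
    by simp
  have "(\<integral>\<^sup>+x. ennreal (indicator {-R..R} x * \<bar>x\<bar> powr (-1/2)) \<partial>lborel) \<le>
     (\<integral>\<^sup>+x. ennreal (indicator {0..R} x * x powr (-1/2)) + ennreal (indicator {0..R} (-x) * (-x) powr (-1/2)) \<partial>lborel)"
    by (intro nn_integral_mono) (auto simp: indicator_def abs_if)
  also have "\<dots> < \<infinity>"
    using fin fin2 by (subst nn_integral_add) auto
  finally show ?thesis .
qed

text \<open>Since \<open>norm z\<close> is at least
  \<open>sqrt (\<bar>x\<bar> * \<bar>y\<bar>)\<close>, the function \<open>1 / norm z\<close> is at
  most the product of \<open>\<bar>x\<bar> powr (-1/2)\<close> and
  \<open>\<bar>y\<bar> powr (-1/2)\<close>, each integrable near 0. The singularities of the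
  potential and of its gradient are dominated by this one.\<close>

lemma integrable_inverse_norm_cball:
  assumes "R > 0"
  shows "integrable lborel (\<lambda>z::complex. indicator (cball 0 R) z / norm z)"
proof (rule integrableI_bounded)
  show "(\<lambda>z::complex. indicator (cball 0 R) z / norm z) \<in> borel_measurable lborel"
    by (intro borel_measurable_divide borel_measurable_indicator borel_measurable_norm) auto
  let ?g = "\<lambda>x::real. indicator {-R..R} x * \<bar>x\<bar> powr (-1/2)"
  have "(\<integral>\<^sup>+z. ennreal (norm (indicator (cball 0 R) z / norm (z::complex))) \<partial>lborel) =
     (\<integral>\<^sup>+y. (\<integral>\<^sup>+x. ennreal (indicator (cball 0 R) (Complex x y) / norm (Complex x y)) \<partial>lborel) \<partial>lborel)"
    by (subst complex_nn_fubini)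
       (auto intro!: measurable_compose[OF _ measurable_ennreal] borel_measurable_norm borel_measurable_divide borel_measurable_indicator)
  also have "\<dots> \<le> (\<integral>\<^sup>+y. (\<integral>\<^sup>+x. ennreal (?g x) * ennreal (?g y) \<partial>lborel) \<partial>lborel)"
  proof (intro nn_integral_mono_AE)
    have AEy: "AE y in lborel. y \<noteq> (0::real)" by (rule AE_lborel_singleton)
    then show "AE y in lborel. (\<integral>\<^sup>+x. ennreal (indicator (cball 0 R) (Complex x y) / norm (Complex x y)) \<partial>lborel)
       \<le> (\<integral>\<^sup>+x. ennreal (?g x) * ennreal (?g y) \<partial>lborel)"
    proof eventually_elim
      fix y :: real assume y: "y \<noteq> 0"
      show "(\<integral>\<^sup>+x. ennreal (indicator (cball 0 R) (Complex x y) / norm (Complex x y)) \<partial>lborel)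
       \<le> (\<integral>\<^sup>+x. ennreal (?g x) * ennreal (?g y) \<partial>lborel)"
      proof (intro nn_integral_mono_AE)
        show "AE x in lborel. ennreal (indicator (cball 0 R) (Complex x y) / norm (Complex x y))
           \<le> ennreal (?g x) * ennreal (?g y)"
          using AEy
        proof eventually_elim
          fix x :: real assume x: "x \<noteq> 0"
          show "ennreal (indicator (cball 0 R) (Complex x y) / norm (Complex x y)) \<le> ennreal (?g x) * ennreal (?g y)"
          proof (cases "Complex x y \<in> cball 0 R")
            case True
            have "\<bar>x\<bar> \<le> norm (Complex x y)" "\<bar>y\<bar> \<le> norm (Complex x y)"
              using abs_Re_le_cmod[of "Complex x y"] abs_Im_le_cmod[of "Complex x y"] by auto
            then have xy: "x \<in> {-R..R}" "y \<in> {-R..R}" and le: "\<bar>x\<bar> * \<bar>y\<bar> \<le> norm (Complex x y) ^ 2"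
              using True by (auto simp: power2_eq_square intro!: mult_mono)
            have "sqrt (\<bar>x\<bar> * \<bar>y\<bar>) \<le> norm (Complex x y)"
              using le by (simp add: real_le_lsqrt)
            then have "1 / norm (Complex x y) \<le> 1 / sqrt (\<bar>x\<bar> * \<bar>y\<bar>)"
              using x y by (intro divide_left_mono) (auto intro!: mult_pos_pos simp: complex_eq_iff)
            also have "\<dots> = \<bar>x\<bar> powr (-1/2) * \<bar>y\<bar> powr (-1/2)"
              using x y by (simp add: powr_minus powr_half_sqrt real_sqrt_mult field_simps)
            finally show ?thesis
              using xy True by (simp add: ennreal_mult'[symmetric] )
          qed auto
        qed
      qed
    qed
  qed
  also have "\<dots> = (\<integral>\<^sup>+y. ennreal (?g y) * (\<integral>\<^sup>+x. ennreal (?g x) \<partial>lborel) \<partial>lborel)"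
    by (intro nn_integral_cong, subst nn_integral_multc) (auto simp: mult.commute)
  also have "\<dots> = (\<integral>\<^sup>+x. ennreal (?g x) \<partial>lborel) * (\<integral>\<^sup>+x. ennreal (?g x) \<partial>lborel)"
    by (subst nn_integral_multc) auto
  also have "\<dots> < \<infinity>"
    using nn_integral_inverse_sqrt_finite[OF assms] by (simp add: ennreal_mult_less_top)
  finally show "(\<integral>\<^sup>+z. ennreal (norm (indicator (cball 0 R) z / norm (z::complex))) \<partial>lborel) < \<infinity>" .
qed

lemma integral_deriv_compact_support:
  fixes G g :: "real \<Rightarrow> real"
  assumes d: "\<And>x. (G has_real_derivative g x) (at x)" and c: "continuous_on UNIV g"
    and z: "\<And>x. \<bar>x\<bar> > R \<Longrightarrow> G x = 0" "\<And>x. \<bar>x\<bar> > R \<Longrightarrow> g x = 0"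
  shows "integrable lborel g" "integral\<^sup>L lborel g = 0"
proof -
  let ?a = "- \<bar>R\<bar> - 1" and ?b = "\<bar>R\<bar> + 1"
  have *: "has_bochner_integral lborel (\<lambda>x. indicator {?a..?b} x *\<^sub>R g x) (G ?b - G ?a)"
    by (rule has_bochner_integral_FTC_Icc)
       (auto intro!: continuous_on_subset[OF c] simp flip: has_real_derivative_iff_has_vector_derivative
          intro: DERIV_subset d has_field_derivative_at_within)
  have "(\<lambda>x. indicator {?a..?b} x *\<^sub>R g x) = g"
    using z(2) by (force simp: indicator_def fun_eq_iff)
  moreover have "G ?b - G ?a = 0" using z(1)[of ?a] z(1)[of ?b] by auto
  ultimately have "has_bochner_integral lborel g 0" using * by simp
  then show "integrable lborel g" "integral\<^sup>L lborel g = 0"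
    by (auto simp: has_bochner_integral_iff)
qed

text \<open>On the line at height \<open>c \<noteq> 0\<close> the function
  \<open>ln (norm z)\<close>, here \<open>ln (t\<^sup>2 + c\<^sup>2) / 2\<close>, is smooth, so
  integration by parts meets no singularity and, by compact support, leaves no boundary
  terms.\<close>

lemma ln_parts:
  fixes u u' :: "real \<Rightarrow> real"
  assumes c: "c \<noteq> 0" and d: "\<And>t. (u has_real_derivative u' t) (at t)" and cont: "continuous_on UNIV u'"
    and z: "\<And>t. \<bar>t\<bar> > R \<Longrightarrow> u t = 0" "\<And>t. \<bar>t\<bar> > R \<Longrightarrow> u' t = 0"
  shows "(\<integral>t. ln (t\<^sup>2 + c\<^sup>2) / 2 * u' t \<partial>lborel) = - (\<integral>t. t * u t / (t\<^sup>2 + c\<^sup>2) \<partial>lborel)"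
proof -
  let ?h = "\<lambda>t. ln (t\<^sup>2 + c\<^sup>2) / 2 * u' t" and ?k = "\<lambda>t. t * u t / (t\<^sup>2 + c\<^sup>2)"
  have pos: "t\<^sup>2 + c\<^sup>2 > 0" for t using c by (simp add: sum_power2_gt_zero_iff)
  have "continuous_on UNIV u" using d DERIV_isCont by (auto simp: continuous_on_eq_continuous_at)
  then have ch: "continuous_on UNIV ?h" "continuous_on UNIV ?k"
    using cont pos by (auto intro!: continuous_intros simp: less_imp_neq[THEN not_sym])
  have dd: "((\<lambda>t. ln (t\<^sup>2 + c\<^sup>2) / 2 * u t) has_real_derivative ?h t + ?k t) (at t)" for t
  proof -
    have "((\<lambda>t. ln (t\<^sup>2 + c\<^sup>2) / 2) has_real_derivative t / (t\<^sup>2 + c\<^sup>2)) (at t)"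
      using pos[of t] less_imp_neq[OF pos[of t]] by (auto intro!: derivative_eq_intros simp: divide_simps)
    from DERIV_mult[OF this d[of t]] show ?thesis by (simp add: algebra_simps)
  qed
  have int: "integrable lborel g" if "continuous_on UNIV g" "\<And>x. \<bar>x\<bar> > R \<Longrightarrow> g x = 0" for g :: "real \<Rightarrow> real"
  proof -
    have "integrable lborel (\<lambda>x. indicator {-R..R} x *\<^sub>R g x)"
      by (rule borel_integrable_compact) (auto intro: continuous_on_subset[OF that(1)])
    moreover have "(\<lambda>x. indicator {-R..R} x *\<^sub>R g x) = g"
      using that(2) by (force simp: indicator_def fun_eq_iff)
    ultimately show ?thesis by simp
  qed
  have "integral\<^sup>L lborel (\<lambda>t. ?h t + ?k t) = 0"
    by (rule integral_deriv_compact_support(2)[OF dd, of R]) (use z ch in \<open>auto intro!: continuous_intros\<close>)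
  moreover have "integrable lborel ?h" "integrable lborel ?k"
    using int[OF ch(1)] int[OF ch(2)] z by auto
  ultimately show ?thesis by simp
qed

context
  fixes R :: real
  assumes R_pos: "R > 0"
begin

lemma bounded_of_cont_supp:
  assumes "continuous_on UNIV g" "\<And>z. norm z > R \<Longrightarrow> g z = (0::real)"
  shows "\<exists>C>0. \<forall>z::complex. \<bar>g z\<bar> \<le> C"
proof -
  have "compact (g ` cball 0 R)"
    by (intro compact_continuous_image continuous_on_subset[OF assms(1)]) auto
  then obtain B where B: "B > 0" "\<forall>y\<in>g ` cball 0 R. norm y \<le> B"
    using compact_imp_bounded bounded_pos by metis
  have "\<bar>g z\<bar> \<le> B" for z
  proof (cases "norm z > R")
    case False then show ?thesis using B by auto
  qed (use assms B in auto)
  then show ?thesis using B by auto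
qed

lemma integrable_bounded_by_inverse_norm:
  fixes g :: "complex \<Rightarrow> real"
  assumes [measurable]: "g \<in> borel_measurable borel"
    and C: "C \<ge> 0"
    and "\<And>z. norm z > R \<Longrightarrow> g z = 0" "\<And>z. z \<noteq> 0 \<Longrightarrow> norm z \<le> R \<Longrightarrow> \<bar>g z\<bar> \<le> C / norm z"
  shows "integrable lborel (g :: complex \<Rightarrow> real)"
proof (rule Bochner_Integration.integrable_bound)
  show "integrable lborel (\<lambda>z::complex. C * (indicator (cball 0 R) z / norm z))"
    by (intro integrable_mult_right integrable_inverse_norm_cball R_pos)
  have "AE z in lborel. z \<noteq> (0::complex)" by (rule AE_lborel_singleton)
  then show "AE z in lborel. norm (g z) \<le> norm (C * (indicator (cball 0 R) z / norm z))"
  proof eventually_elim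
    fix z :: complex assume "z \<noteq> 0"
    then show "norm (g z) \<le> norm (C * (indicator (cball 0 R) z / norm z))"
      using assms(3)[of z] assms(4)[of z] C by (cases "norm z > R") (auto simp: indicator_def)
  qed
qed simp

text \<open>The two summands serve the two signs of the logarithm:
  \<open>ln x \<le> x \<le> r\<^sup>2 / x\<close> for large modulus and
  \<open>- ln x \<le> 1 / x\<close> for small modulus. The crude form is chosen to match the
  integrable majorant \<open>1 / norm z\<close>.\<close>

lemma ln_norm_le:
  assumes "z \<noteq> 0" "norm z \<le> r"
  shows "\<bar>ln (norm z)\<bar> \<le> (1 + r\<^sup>2) / norm (z::complex)"
proof -
  have "ln (norm z) \<le> norm z" using assms ln_bound[of "norm z"] by simp
  also have "\<dots> \<le> r\<^sup>2 / norm z" using assms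
    by (auto simp: pos_le_divide_eq power2_eq_square intro!: mult_mono intro: order_trans[OF norm_ge_zero])
  finally have 1: "ln (norm z) \<le> r\<^sup>2 / norm z" .
  have "- ln (norm z) = ln (1 / norm z)" using assms by (simp add: ln_div)
  also have "\<dots> \<le> 1 / norm z" using assms ln_bound[of "1/norm z"] by simp
  finally show ?thesis using 1 by (auto simp: abs_le_iff add_divide_distrib intro: order_trans)
qed

lemma integrable_ln_mult:
  fixes g :: "complex \<Rightarrow> real"
  assumes "continuous_on UNIV g" "\<And>z. norm z > R \<Longrightarrow> g z = 0"
  shows "integrable lborel (\<lambda>z. ln (norm z) * g z)"
proof -
  obtain C where C: "C > 0" "\<And>z. \<bar>g z\<bar> \<le> C" using bounded_of_cont_supp[OF assms] by auto
  have [measurable]: "g \<in> borel_measurable borel" using assms(1) by (rule borel_measurable_continuous_onI)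
  show ?thesis
  proof (rule integrable_bounded_by_inverse_norm)
    fix z :: complex assume z: "z \<noteq> 0" "norm z \<le> R"
    have "\<bar>ln (norm z) * g z\<bar> \<le> ((1 + R\<^sup>2) / norm z) * C"
      unfolding abs_mult by (intro mult_mono ln_norm_le z C) auto
    then show "\<bar>ln (norm z) * g z\<bar> \<le> ((1 + R\<^sup>2) * C) / norm z" by simp
  qed (use assms C in auto)
qed

lemma integrable_radial_quotient:
  fixes g :: "complex \<Rightarrow> real"
  assumes "continuous_on UNIV g" "\<And>z. norm z > R \<Longrightarrow> g z = 0"
  shows "integrable lborel (\<lambda>z. Re z * g z / (norm z)\<^sup>2)" "integrable lborel (\<lambda>z. Im z * g z / (norm z)\<^sup>2)"
proof -
  obtain C where C: "C > 0" "\<And>z. \<bar>g z\<bar> \<le> C" using bounded_of_cont_supp[OF assms] by auto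
  have [measurable]: "g \<in> borel_measurable borel" using assms(1) by (rule borel_measurable_continuous_onI)
  have *: "\<bar>a * g z / (norm z)\<^sup>2\<bar> \<le> C / norm z" if "\<bar>a\<bar> \<le> norm z" "z \<noteq> 0" for a z
  proof -
    have "\<bar>a * g z\<bar> \<le> norm z * C" unfolding abs_mult using that C by (intro mult_mono) auto
    then show ?thesis using that by (simp add: field_simps power2_eq_square)
  qed
  show "integrable lborel (\<lambda>z. Re z * g z / (norm z)\<^sup>2)"
    by (rule integrable_bounded_by_inverse_norm[where C=C]) (use assms C(1) *[OF abs_Re_le_cmod] in auto)
  show "integrable lborel (\<lambda>z. Im z * g z / (norm z)\<^sup>2)"
    by (rule integrable_bounded_by_inverse_norm[where C=C]) (use assms C(1) *[OF abs_Im_le_cmod] in auto)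
qed

lemma integrable_cont_supp:
  fixes g :: "complex \<Rightarrow> real"
  assumes c: "continuous_on UNIV g" and g: "\<And>z. norm z > R \<Longrightarrow> g z = 0"
  shows "integrable lborel g"
proof -
  have "integrable lborel (\<lambda>z. indicator (cball 0 R) z *\<^sub>R g z)"
    by (rule borel_integrable_compact) (auto intro: continuous_on_subset[OF c])
  moreover have "(\<lambda>z. indicator (cball 0 R) z *\<^sub>R g z) = g"
    using g by (force simp: indicator_def fun_eq_iff)
  ultimately show ?thesis by simp
qed

lemma integrable_ln_shift_mult:
  fixes g :: "complex \<Rightarrow> real"
  assumes c: "continuous_on UNIV g" and g: "\<And>z. norm z > R \<Longrightarrow> g z = 0"
  shows "integrable lborel (\<lambda>z. ln (norm (z - w)) * g z)"
proof -
  obtain C where C: "C > 0" "\<And>z. \<bar>g z\<bar> \<le> C" using bounded_of_cont_supp[OF assms] by auto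
  have [measurable]: "g \<in> borel_measurable borel" using c by (rule borel_measurable_continuous_onI)
  define r where "r = R + norm w"
  have r: "r > 0" using R_pos by (simp add: r_def add_pos_nonneg)
  have "integrable lborel (\<lambda>z. (1 + r\<^sup>2) * C * (indicator (cball 0 r) z / norm (z::complex)))"
    by (intro integrable_mult_right integrable_inverse_norm_cball r)
  then have i: "integrable lborel (\<lambda>z. ln (norm z) * g (w + z))"
  proof (rule Bochner_Integration.integrable_bound)
    have "AE z in lborel. z \<noteq> (0::complex)" by (rule AE_lborel_singleton)
    then show "AE z in lborel. norm (ln (norm z) * g (w + z)) \<le> norm ((1 + r\<^sup>2) * C * (indicator (cball 0 r) z / norm z))"
    proof eventually_elim
      fix z :: complex assume z: "z \<noteq> 0"
      show "norm (ln (norm z) * g (w + z)) \<le> norm ((1 + r\<^sup>2) * C * (indicator (cball 0 r) z / norm z))"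
      proof (cases "norm z \<le> r")
        case True
        have "\<bar>ln (norm z) * g (w + z)\<bar> \<le> ((1 + r\<^sup>2) / norm z) * C"
          unfolding abs_mult by (intro mult_mono ln_norm_le z C True) auto
        then show ?thesis using True C(1) by (simp add: abs_mult)
      next
        case False
        then have "norm (w + z) > R"
          using norm_triangle_ineq2[of z "-w"] by (auto simp: r_def add.commute)
        then show ?thesis by (simp add: g)
      qed
    qed
  qed simp
  have d: "distr lborel borel ((+) w) = lborel" by (rule lborel_distr_plus)
  have "integrable (distr lborel borel ((+) w)) (\<lambda>z. ln (norm (z - w)) * g z)"
    using i by (subst integrable_distr_eq) simp_all
  then show ?thesis unfolding d .
qed

end

text \<open>The partial derivatives are parameters, so that the locale can be instantiated both by
  iterated directional derivatives of a test function and by the explicit derivatives of a radial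
  function. Only continuous partial derivatives are assumed; the total differentiability needed
  along oblique lines is derived from them.\<close>

locale C2_compact =
  fixes f fx fy fxx fyy :: "complex \<Rightarrow> real" and R :: real
  assumes deriv_x: "\<And>z. ((\<lambda>t. f (z + of_real t)) has_real_derivative fx z) (at 0)"
    and deriv_y: "\<And>z. ((\<lambda>t. f (z + of_real t * \<i>)) has_real_derivative fy z) (at 0)"
    and deriv_xx: "\<And>z. ((\<lambda>t. fx (z + of_real t)) has_real_derivative fxx z) (at 0)"
    and deriv_yy: "\<And>z. ((\<lambda>t. fy (z + of_real t * \<i>)) has_real_derivative fyy z) (at 0)"
    and cont_f: "continuous_on UNIV f"
    and cont_x: "continuous_on UNIV fx" and cont_y: "continuous_on UNIV fy"
    and cont_xx: "continuous_on UNIV fxx" and cont_yy: "continuous_on UNIV fyy"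
    and supp: "\<And>z. norm z > R \<Longrightarrow> f z = 0"
    and R_pos: "R > 0"
begin

definition lap :: "complex \<Rightarrow> real" where "lap z = fxx z + fyy z"

lemma deriv_vanishes:
  fixes g :: "complex \<Rightarrow> real"
  assumes d: "((\<lambda>t. g (z + of_real t * v)) has_real_derivative D) (at 0)"
    and g: "\<And>z. norm z > R \<Longrightarrow> g z = 0" and z: "norm z > R"
  shows "D = (0::real)"
proof -
  have "\<forall>\<^sub>F t in nhds (0::real). norm (z + of_real t * v) > R"
  proof -
    have "open {t::real. R < norm (z + of_real t * v)}"
      by (intro open_Collect_less continuous_intros)
    then show ?thesis using z by (subst eventually_nhds) (auto intro!: exI[of _ "{t::real. R < norm (z + of_real t * v)}"])
  qed
  then have ev: "\<forall>\<^sub>F t in nhds (0::real). g (z + of_real t * v) = 0"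
    by eventually_elim (rule g)
  then have "((\<lambda>t::real. 0) has_real_derivative D) (at 0)"
    using d by (subst (asm) DERIV_cong_ev[OF refl ev refl])
  then show "D = 0" using DERIV_unique[OF _ DERIV_const] by blast
qed

lemma supp_x: "norm z > R \<Longrightarrow> fx z = 0"
  using deriv_vanishes[of f z 1] deriv_x supp by auto

lemma supp_y: "norm z > R \<Longrightarrow> fy z = 0"
  using deriv_vanishes[of f z \<i>] deriv_y supp by auto

lemma supp_xx: "norm z > R \<Longrightarrow> fxx z = 0"
  using deriv_vanishes[of fx z 1] deriv_xx supp_x by auto

lemma supp_yy: "norm z > R \<Longrightarrow> fyy z = 0"
  using deriv_vanishes[of fy z \<i>] deriv_yy supp_y by auto

lemma supp_lap: "norm z > R \<Longrightarrow> lap z = 0"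
  by (simp add: lap_def supp_xx supp_yy)

lemma cont_lap: "continuous_on UNIV lap"
  unfolding lap_def by (intro continuous_intros cont_xx cont_yy)

lemma measurable_derivs [measurable]:
  "f \<in> borel_measurable borel" "fx \<in> borel_measurable borel" "fy \<in> borel_measurable borel"
  "fxx \<in> borel_measurable borel" "fyy \<in> borel_measurable borel" "lap \<in> borel_measurable borel"
  using cont_f cont_x cont_y cont_xx cont_yy cont_lap by (auto intro: borel_measurable_continuous_onI)

lemma Complex_shift: "Complex (x + t) y = Complex x y + of_real t"
  "Complex x (y + t) = Complex x y + of_real t * \<i>"
  by (auto simp: complex_eq_iff)

lemma deriv_shift:
  fixes g :: "real \<Rightarrow> real"
  shows "((\<lambda>t. g (x + t)) has_real_derivative D) (at 0) \<Longrightarrow> (g has_real_derivative D) (at x)"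
  using DERIV_shift[of g D 0 x] by (simp add: add.commute)

lemma partial_x: "((\<lambda>x. f (Complex x y)) has_real_derivative fx (Complex x y)) (at x)"
  "((\<lambda>x. fx (Complex x y)) has_real_derivative fxx (Complex x y)) (at x)"
  by (rule deriv_shift, simp add: Complex_shift deriv_x deriv_xx)+

lemma partial_y: "((\<lambda>y. f (Complex x y)) has_real_derivative fy (Complex x y)) (at y)"
  "((\<lambda>y. fy (Complex x y)) has_real_derivative fyy (Complex x y)) (at y)"
  by (rule deriv_shift, simp add: Complex_shift deriv_y deriv_yy)+

lemma norm_Complex_gt: "\<bar>x\<bar> > R \<Longrightarrow> norm (Complex x y) > R" "\<bar>y\<bar> > R \<Longrightarrow> norm (Complex x y) > R"
  using abs_Re_le_cmod[of "Complex x y"] abs_Im_le_cmod[of "Complex x y"] by auto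

lemma cont_Complex [continuous_intros]:
  "continuous_on S a \<Longrightarrow> continuous_on S b \<Longrightarrow> continuous_on S (\<lambda>t. Complex (a t) (b t))"
  unfolding Complex_eq by (intro continuous_intros)

lemma ln_norm_Complex: "ln (norm (Complex x y)) = ln (x\<^sup>2 + y\<^sup>2) / 2"
  by (cases "x = 0 \<and> y = 0") (auto simp: complex_norm ln_sqrt sum_power2_gt_zero_iff)

lemma parts_x:
  assumes "y \<noteq> 0"
  shows "(\<integral>x. ln (norm (Complex x y)) * fxx (Complex x y) \<partial>lborel) =
         - (\<integral>x. x * fx (Complex x y) / (norm (Complex x y))\<^sup>2 \<partial>lborel)"
  using ln_parts[of y "\<lambda>x. fx (Complex x y)" "\<lambda>x. fxx (Complex x y)" R, OF assms partial_x(2)]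
  by (simp add: ln_norm_Complex cmod_power2 continuous_on_compose2[OF cont_xx] cont_Complex
      supp_x supp_xx norm_Complex_gt(1))

lemma parts_y:
  assumes "x \<noteq> 0"
  shows "(\<integral>y. ln (norm (Complex x y)) * fyy (Complex x y) \<partial>lborel) =
         - (\<integral>y. y * fy (Complex x y) / (norm (Complex x y))\<^sup>2 \<partial>lborel)"
  using ln_parts[of x "\<lambda>y. fy (Complex x y)" "\<lambda>y. fyy (Complex x y)" R, OF assms partial_y(2)]
  by (simp add: ln_norm_Complex cmod_power2 continuous_on_compose2[OF cont_yy] cont_Complex
      supp_y supp_yy norm_Complex_gt(2) add.commute)

text \<open>Among the lines parallel to an axis only one passes through the singularity, so
  one-dimensional integration by parts applies on almost all of them. The right-hand side is the
  radial derivative of \<open>f\<close> divided by the modulus; second derivatives have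
  disappeared.\<close>

lemma integral_ln_lap_eq_radial_derivative:
  "(\<integral>z. ln (norm z) * lap z \<partial>lborel) = - (\<integral>z. (Re z * fx z + Im z * fy z) / (norm z)\<^sup>2 \<partial>lborel)"
proof -
  have ix: "integrable lborel (\<lambda>z. ln (norm z) * fxx z)" and iy: "integrable lborel (\<lambda>z. ln (norm z) * fyy z)"
    by (auto intro!: integrable_ln_mult R_pos cont_xx cont_yy supp_xx supp_yy)
  have kx: "integrable lborel (\<lambda>z. Re z * fx z / (norm z)\<^sup>2)" and ky: "integrable lborel (\<lambda>z. Im z * fy z / (norm z)\<^sup>2)"
    by (auto intro!: integrable_radial_quotient R_pos cont_x cont_y supp_x supp_y)
  have x: "(\<integral>z. ln (norm z) * fxx z \<partial>lborel) = - (\<integral>z. Re z * fx z / (norm z)\<^sup>2 \<partial>lborel)"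
  proof -
    have "(\<integral>z. ln (norm z) * fxx z \<partial>lborel) =
        (\<integral>y. - (\<integral>x. x * fx (Complex x y) / (norm (Complex x y))\<^sup>2 \<partial>lborel) \<partial>lborel)"
    proof (subst complex_fubini(1)[OF ix], rule integral_cong_AE)
      have "AE y in lborel. y \<noteq> (0::real)" by (rule AE_lborel_singleton)
      then show "AE y in lborel. (\<integral>x. ln (norm (Complex x y)) * fxx (Complex x y) \<partial>lborel) =
         - (\<integral>x. x * fx (Complex x y) / (norm (Complex x y))\<^sup>2 \<partial>lborel)"
        by eventually_elim (rule parts_x)
    qed (unfold Complex_eq, measurable)
    also have "\<dots> = - (\<integral>z. Re z * fx z / (norm z)\<^sup>2 \<partial>lborel)"
      by (subst complex_fubini(1)[OF kx]) simp
    finally show ?thesis .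
  qed
  have y: "(\<integral>z. ln (norm z) * fyy z \<partial>lborel) = - (\<integral>z. Im z * fy z / (norm z)\<^sup>2 \<partial>lborel)"
  proof -
    have "(\<integral>z. ln (norm z) * fyy z \<partial>lborel) =
        (\<integral>x. - (\<integral>y. y * fy (Complex x y) / (norm (Complex x y))\<^sup>2 \<partial>lborel) \<partial>lborel)"
    proof (subst complex_fubini(2)[OF iy], rule integral_cong_AE)
      have "AE y in lborel. y \<noteq> (0::real)" by (rule AE_lborel_singleton)
      then show "AE x in lborel. (\<integral>y. ln (norm (Complex x y)) * fyy (Complex x y) \<partial>lborel) =
         - (\<integral>y. y * fy (Complex x y) / (norm (Complex x y))\<^sup>2 \<partial>lborel)"
        by eventually_elim (rule parts_y)
    qed (unfold Complex_eq, measurable)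
    also have "\<dots> = - (\<integral>z. Im z * fy z / (norm z)\<^sup>2 \<partial>lborel)"
      by (subst complex_fubini(2)[OF ky]) simp
    finally show ?thesis .
  qed
  have "(\<integral>z. ln (norm z) * lap z \<partial>lborel) = (\<integral>z. ln (norm z) * fxx z + ln (norm z) * fyy z \<partial>lborel)"
    by (simp add: lap_def algebra_simps)
  also have "\<dots> = - ((\<integral>z. Re z * fx z / (norm z)\<^sup>2 \<partial>lborel) + (\<integral>z. Im z * fy z / (norm z)\<^sup>2 \<partial>lborel))"
    using ix iy x y by simp
  also have "\<dots> = - (\<integral>z. Re z * fx z / (norm z)\<^sup>2 + Im z * fy z / (norm z)\<^sup>2 \<partial>lborel)"
    using kx ky by simp
  finally show ?thesis by (simp add: add_divide_distrib)
qed


text \<open>The chain rule along an oblique line needs total differentiability of \<open>f\<close>,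
  which follows from the existence of both partial derivatives together with the continuity of the
  one in \<open>y\<close>.\<close>

lemma deriv_ray: "((\<lambda>y. f (Complex (y * s) y)) has_real_derivative
    s * fx (Complex (y * s) y) + fy (Complex (y * s) y)) (at y)"
proof -
  have "((\<lambda>(x, y). f (Complex x y)) has_derivative (\<lambda>(tx, ty). fx (Complex (y * s) y) * tx +
        blinfun_mult_right (fy (Complex (y * s) y)) ty))
      (at (y * s, y) within UNIV \<times> UNIV)"
  proof (rule has_derivative_partialsI)
    show "((\<lambda>x. f (Complex x y)) has_derivative (\<lambda>tx. fx (Complex (y * s) y) * tx)) (at (y * s))"
      using partial_x(1)[of y "y * s"] by (simp add: has_field_derivative_def)
    show "((\<lambda>y. f (Complex x y)) has_derivative blinfun_apply (blinfun_mult_right (fy (Complex x y)))) (at y)" for x y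
      using partial_y(1)[of x y] by (simp add: has_field_derivative_def)
    have "continuous_on UNIV (\<lambda>(x, y). blinfun_mult_right (fy (Complex x y)))"
      unfolding case_prod_beta'
      by (intro bounded_linear.continuous_on[OF bounded_linear_blinfun_mult_right]
          continuous_on_compose2[OF cont_y] continuous_intros) auto
    then show "continuous (at (y * s, y) within UNIV \<times> UNIV) (\<lambda>(x, y). blinfun_mult_right (fy (Complex x y)))"
      by (simp add: continuous_on_eq_continuous_at)
  qed auto
  then have D: "((\<lambda>(x, y). f (Complex x y)) has_derivative (\<lambda>(tx, ty). fx (Complex (y * s) y) * tx +
        fy (Complex (y * s) y) * ty)) (at (y * s, y))" by simp
  have "((\<lambda>y. (y * s, y)) has_derivative (\<lambda>t. (t * s, t))) (at y)"
    by (auto intro!: derivative_eq_intros)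
  from has_derivative_compose[OF this D]
  have "((\<lambda>y. f (Complex (y * s) y)) has_derivative (\<lambda>t. fx (Complex (y * s) y) * (t * s) + fy (Complex (y * s) y) * t)) (at y)"
    by simp
  then show ?thesis unfolding has_field_derivative_def
    by (rule has_derivative_eq_rhs) (auto simp: fun_eq_iff algebra_simps)
qed

text \<open>The line \<open>x = y * s\<close> consists of two rays from the origin to the outside of
  the support. The sign orients both outwards, so each contributes \<open>0 - f 0\<close>.\<close>

lemma integral_sgn_deriv_ray:
  "(\<integral>y. sgn y * (s * fx (Complex (y * s) y) + fy (Complex (y * s) y)) \<partial>lborel) = - 2 * f 0"
proof -
  let ?d = "\<lambda>y. s * fx (Complex (y * s) y) + fy (Complex (y * s) y)"
  let ?F = "\<lambda>y. f (Complex (y * s) y)"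
  have c: "continuous_on A ?d" for A
    by (intro continuous_intros continuous_on_compose2[OF cont_x] continuous_on_compose2[OF cont_y]) auto
  have z: "?F y = 0 \<and> ?d y = 0" if "\<bar>y\<bar> > R" for y
    using norm_Complex_gt(2)[OF that, of "y * s"] by (simp add: supp supp_x supp_y)
  have 1: "has_bochner_integral lborel (\<lambda>y. indicator {0..R+1} y *\<^sub>R ?d y) (?F (R+1) - ?F 0)"
    by (rule has_bochner_integral_FTC_Icc)
       (use R_pos in \<open>auto intro!: c simp flip: has_real_derivative_iff_has_vector_derivative
          intro: has_field_derivative_at_within deriv_ray\<close>)
  have 2: "has_bochner_integral lborel (\<lambda>y. indicator {-(R+1)..0} y *\<^sub>R ?d y) (?F 0 - ?F (-(R+1)))"
    by (rule has_bochner_integral_FTC_Icc)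
       (use R_pos in \<open>auto intro!: c simp flip: has_real_derivative_iff_has_vector_derivative
          intro: has_field_derivative_at_within deriv_ray\<close>)
  have 3: "has_bochner_integral lborel (\<lambda>y. indicator {0..R+1} y *\<^sub>R ?d y - indicator {-(R+1)..0} y *\<^sub>R ?d y) (- 2 * f 0)"
  proof -
    have F0: "?F (R+1) = 0" "?F (-(R+1)) = 0" "?F 0 = f 0"
      using z[of "R+1"] z[of "-(R+1)"] R_pos by (auto simp: Complex_eq)
    show ?thesis using has_bochner_integral_diff[OF 1 2] unfolding F0 by simp
  qed
  have m: "(\<lambda>y. sgn y * ?d y) \<in> borel_measurable lborel"
    using borel_measurable_continuous_onI[OF c] by (auto intro!: borel_measurable_times borel_measurable_sgn)
  have "(\<integral>y. sgn y * ?d y \<partial>lborel) = (\<integral>y. indicator {0..R+1} y *\<^sub>R ?d y - indicator {-(R+1)..0} y *\<^sub>R ?d y \<partial>lborel)"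
  proof (rule integral_cong_AE)
    show "(\<lambda>y. sgn y * ?d y) \<in> borel_measurable lborel" by (rule m)
    show "(\<lambda>y. indicator {0..R+1} y *\<^sub>R ?d y - indicator {-(R+1)..0} y *\<^sub>R ?d y) \<in> borel_measurable lborel"
      using 3 by (simp add: has_bochner_integral_iff)
    have "AE y in lborel. y \<noteq> (0::real)" by (rule AE_lborel_singleton)
    then show "AE y in lborel. sgn y * ?d y = indicator {0..R+1} y *\<^sub>R ?d y - indicator {-(R+1)..0} y *\<^sub>R ?d y"
    proof eventually_elim
      fix y :: real assume "y \<noteq> 0"
      then show "sgn y * ?d y = indicator {0..R+1} y *\<^sub>R ?d y - indicator {-(R+1)..0} y *\<^sub>R ?d y"
        using z[of y] R_pos by (cases "\<bar>y\<bar> > R") (auto simp: indicator_def sgn_if)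
    qed
  qed
  also have "\<dots> = - 2 * f 0" using 3 by (simp add: has_bochner_integral_iff)
  finally show ?thesis .
qed

text \<open>Lines through the origin replace polar coordinates: the substitution
  \<open>x = y * s\<close> at fixed \<open>y\<close> has Jacobian \<open>\<bar>y\<bar>\<close> and
  turns the radial derivative into the derivative along the line of parameter \<open>s\<close>, with
  weight \<open>1 / (1 + s\<^sup>2)\<close>. Each line contributes \<open>- 2 * f 0\<close>, and the
  weights integrate to \<pi>.\<close>

lemma green_origin: "(\<integral>z. ln (norm z) * lap z \<partial>lborel) = 2 * pi * f 0"
proof -
  define G where "G z = (Re z * fx z + Im z * fy z) / (norm z)\<^sup>2" for z
  have Gi: "integrable lborel G"
    using integrable_radial_quotient(1)[OF R_pos cont_x supp_x] integrable_radial_quotient(2)[OF R_pos cont_y supp_y]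
    unfolding G_def add_divide_distrib by simp
  have Gm [measurable]: "G \<in> borel_measurable borel" using Gi by auto
  have AE0: "AE y in lborel. y \<noteq> (0::real)" by (rule AE_lborel_singleton)
  define q where "q s y = \<bar>y\<bar> * G (Complex (y * s) y)" for s y
  have qm: "(\<lambda>(s, y). q s y) \<in> borel_measurable (lborel \<Otimes>\<^sub>M lborel)"
    unfolding q_def Complex_eq by measurable
  \<comment> \<open>Exchanging the integrations over \<open>s\<close> and \<open>y\<close> requires
    absolute integrability of \<open>q\<close>; undoing the substitution for each
    \<open>y \<noteq> 0\<close> reduces it to that of \<open>G\<close>.\<close>
  have "(\<integral>\<^sup>+p. ennreal (norm (case p of (s, y) \<Rightarrow> q s y)) \<partial>(lborel \<Otimes>\<^sub>M lborel)) =
        (\<integral>\<^sup>+y. (\<integral>\<^sup>+s. ennreal (norm (q s y)) \<partial>lborel) \<partial>lborel)"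
    using qm by (subst lborel_pair.nn_integral_snd[symmetric]) (auto simp: case_prod_beta')
  also have "\<dots> = (\<integral>\<^sup>+y. (\<integral>\<^sup>+x. ennreal (norm (G (Complex x y))) \<partial>lborel) \<partial>lborel)"
  proof (rule nn_integral_cong_AE)
    show "AE y in lborel. (\<integral>\<^sup>+s. ennreal (norm (q s y)) \<partial>lborel) = (\<integral>\<^sup>+x. ennreal (norm (G (Complex x y))) \<partial>lborel)"
      using AE0
    proof eventually_elim
      fix y :: real assume y: "y \<noteq> 0"
      have "(\<lambda>x. ennreal (norm (G (Complex x y)))) \<in> borel_measurable borel"
        unfolding Complex_eq by measurable
      from nn_integral_real_affine[OF this y, of 0]
      have "(\<integral>\<^sup>+x. ennreal (norm (G (Complex x y))) \<partial>lborel) = \<bar>y\<bar> * (\<integral>\<^sup>+s. ennreal (norm (G (Complex (y * s) y))) \<partial>lborel)"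
        by simp
      also have "\<dots> = (\<integral>\<^sup>+s. ennreal (norm (q s y)) \<partial>lborel)"
        unfolding Complex_eq
        by (subst nn_integral_cmult[symmetric], measurable)
           (auto intro!: nn_integral_cong simp: q_def ennreal_mult abs_mult Complex_eq)
      finally show "(\<integral>\<^sup>+s. ennreal (norm (q s y)) \<partial>lborel) = (\<integral>\<^sup>+x. ennreal (norm (G (Complex x y))) \<partial>lborel)" ..
    qed
  qed
  also have "\<dots> = (\<integral>\<^sup>+z. ennreal (norm (G z)) \<partial>lborel)"
    by (subst complex_nn_fubini) auto
  also have "\<dots> < \<infinity>" using Gi by (simp add: integrable_iff_bounded)
  finally have qi: "integrable (lborel \<Otimes>\<^sub>M lborel) (\<lambda>(s, y). q s y)"
    using qm by (intro integrableI_bounded) auto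
  have q_eq: "q s y = sgn y * (s * fx (Complex (y * s) y) + fy (Complex (y * s) y)) * (1 / (1 + s\<^sup>2))" if "y \<noteq> 0" for s y
  proof -
    have "(norm (Complex (y * s) y))\<^sup>2 = y\<^sup>2 * (1 + s\<^sup>2)"
      by (simp add: cmod_power2 power_mult_distrib algebra_simps)
    moreover have "1 + s\<^sup>2 > 0" by (simp add: add_pos_nonneg)
    ultimately show ?thesis unfolding q_def G_def using that
      by (simp add: divide_simps power2_eq_square sgn_if) (auto simp: abs_if algebra_simps)
  qed
  have "(\<integral>z. G z \<partial>lborel) = (\<integral>y. (\<integral>x. G (Complex x y) \<partial>lborel) \<partial>lborel)"
    by (rule complex_fubini(1)[OF Gi])
  also have "\<dots> = (\<integral>y. (\<integral>s. q s y \<partial>lborel) \<partial>lborel)"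
  proof (rule integral_cong_AE)
    show "AE y in lborel. (\<integral>x. G (Complex x y) \<partial>lborel) = (\<integral>s. q s y \<partial>lborel)"
      using AE0
    proof eventually_elim
      fix y :: real assume y: "y \<noteq> 0"
      show "(\<integral>x. G (Complex x y) \<partial>lborel) = (\<integral>s. q s y \<partial>lborel)"
        using lborel_integral_real_affine[OF y, of "\<lambda>x. G (Complex x y)" 0] by (simp add: q_def)
    qed
  qed (unfold q_def Complex_eq, measurable)
  also have "\<dots> = (\<integral>s. (\<integral>y. q s y \<partial>lborel) \<partial>lborel)"
    by (rule lborel_pair.Fubini_integral[OF qi])
  also have "\<dots> = (\<integral>s. (- 2 * f 0) * inverse (1 + s\<^sup>2) \<partial>lborel)"
  proof (rule Bochner_Integration.integral_cong[OF refl])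
    fix s :: real
    have "(\<integral>y. q s y \<partial>lborel) = (\<integral>y. sgn y * (s * fx (Complex (y * s) y) + fy (Complex (y * s) y)) * (1 / (1 + s\<^sup>2)) \<partial>lborel)"
    proof (rule integral_cong_AE)
      show "AE y in lborel. q s y = sgn y * (s * fx (Complex (y * s) y) + fy (Complex (y * s) y)) * (1 / (1 + s\<^sup>2))"
        using AE0 by eventually_elim (rule q_eq)
    qed (unfold q_def Complex_eq, measurable)
    also have "\<dots> = (- 2 * f 0) * (1 / (1 + s\<^sup>2))"
      by (simp only: integral_mult_left_zero integral_sgn_deriv_ray)
    finally show "(\<integral>y. q s y \<partial>lborel) = (- 2 * f 0) * inverse (1 + s\<^sup>2)" by (simp add: field_simps)
  qed
  also have "\<dots> = (- 2 * f 0) * pi"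
    using LBINT_inverse_1_plus_square
    by (simp add: interval_lebesgue_integral_def set_lebesgue_integral_def)
  finally show ?thesis
    using integral_ln_lap_eq_radial_derivative unfolding G_def[symmetric] by simp
qed

lemma shift: "C2_compact (\<lambda>z. f (z + w)) (\<lambda>z. fx (z + w)) (\<lambda>z. fy (z + w)) (\<lambda>z. fxx (z + w)) (\<lambda>z. fyy (z + w)) (R + norm w)"
proof
  fix z
  show "((\<lambda>t. f (z + of_real t + w)) has_real_derivative fx (z + w)) (at 0)"
    using deriv_x[of "z + w"] by (simp add: algebra_simps)
  show "((\<lambda>t. f (z + of_real t * \<i> + w)) has_real_derivative fy (z + w)) (at 0)"
    using deriv_y[of "z + w"] by (simp add: algebra_simps)
  show "((\<lambda>t. fx (z + of_real t + w)) has_real_derivative fxx (z + w)) (at 0)"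
    using deriv_xx[of "z + w"] by (simp add: algebra_simps)
  show "((\<lambda>t. fy (z + of_real t * \<i> + w)) has_real_derivative fyy (z + w)) (at 0)"
    using deriv_yy[of "z + w"] by (simp add: algebra_simps)
next
  fix z :: complex assume "norm z > R + norm w"
  then show "f (z + w) = 0" using norm_triangle_ineq2[of z "-w"] by (intro supp) auto
qed (use R_pos in \<open>auto intro!: continuous_intros continuous_on_compose2[OF cont_f] continuous_on_compose2[OF cont_x]
   continuous_on_compose2[OF cont_y] continuous_on_compose2[OF cont_xx] continuous_on_compose2[OF cont_yy] add_pos_nonneg\<close>)

text \<open>A translation moves the singularity to the origin. In the language of distributions: the
  Laplacian of \<open>ln (norm (z - w))\<close> is \<open>2 * pi\<close> times the point mass at
  \<open>w\<close>.\<close>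

lemma green:
  shows "integrable lborel (\<lambda>z. ln (norm (z - w)) * lap z)"
    and "(\<integral>z. ln (norm (z - w)) * lap z \<partial>lborel) = 2 * pi * f w"
proof -
  interpret S: C2_compact "\<lambda>z. f (z + w)" "\<lambda>z. fx (z + w)" "\<lambda>z. fy (z + w)" "\<lambda>z. fxx (z + w)" "\<lambda>z. fyy (z + w)" "R + norm w"
    by (rule shift)
  have L: "S.lap z = lap (w + z)" for z by (simp add: S.lap_def lap_def add.commute)
  have d: "distr lborel borel ((+) w) = lborel" by (rule lborel_distr_plus)
  have "integrable (distr lborel borel ((+) w)) (\<lambda>z. ln (norm (z - w)) * lap z)"
    using integrable_ln_mult[OF S.R_pos S.cont_lap S.supp_lap]
    by (subst integrable_distr_eq) (simp_all add: L)
  then show "integrable lborel (\<lambda>z. ln (norm (z - w)) * lap z)" unfolding d .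
  have "(\<integral>z. ln (norm (z - w)) * lap z \<partial>distr lborel borel ((+) w)) = 2 * pi * f w"
    using S.green_origin by (subst integral_distr) (simp_all add: L)
  then show "(\<integral>z. ln (norm (z - w)) * lap z \<partial>lborel) = 2 * pi * f w" unfolding d .
qed

lemma integral_lap: "(\<integral>z. lap z \<partial>lborel) = 0"
proof -
  note ix = integrable_cont_supp[OF R_pos cont_xx supp_xx] and iy = integrable_cont_supp[OF R_pos cont_yy supp_yy]
  have "(\<integral>x. fxx (Complex x y) \<partial>lborel) = 0" for y
    by (rule integral_deriv_compact_support(2)[OF partial_x(2), of _ R])
       (auto intro!: continuous_on_compose2[OF cont_xx] continuous_intros supp_x supp_xx norm_Complex_gt(1))
  moreover have "(\<integral>y. fyy (Complex x y) \<partial>lborel) = 0" for x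
    by (rule integral_deriv_compact_support(2)[OF partial_y(2), of _ R])
       (auto intro!: continuous_on_compose2[OF cont_yy] continuous_intros supp_y supp_yy norm_Complex_gt(2))
  ultimately show ?thesis
    using ix iy complex_fubini(1)[OF ix] complex_fubini(2)[OF iy] by (simp add: lap_def)
qed

end

section \<open>The sub-mean-value inequality\<close>

lemma has_real_derivative_glue:
  fixes f g h :: "real \<Rightarrow> real"
  assumes "(g has_real_derivative D) (at c)" "(h has_real_derivative D) (at c)"
    and "\<And>x. x \<le> c \<Longrightarrow> f x = g x" "\<And>x. x \<ge> c \<Longrightarrow> f x = h x"
  shows "(f has_real_derivative D) (at c)"
proof -
  have g: "((\<lambda>y. (g y - g c) / (y - c)) \<longlongrightarrow> D) (at_left c)"
    and h: "((\<lambda>y. (h y - h c) / (y - c)) \<longlongrightarrow> D) (at_right c)"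
    using assms(1,2) by (auto simp: has_field_derivative_iff filterlim_at_split)
  have "((\<lambda>y. (f y - f c) / (y - c)) \<longlongrightarrow> D) (at_left c)"
    using g by (rule Lim_transform_eventually) (auto simp: eventually_at_filter assms(3))
  moreover have "((\<lambda>y. (f y - f c) / (y - c)) \<longlongrightarrow> D) (at_right c)"
    using h by (rule Lim_transform_eventually) (auto simp: eventually_at_filter assms(4))
  ultimately show ?thesis by (auto simp: has_field_derivative_iff filterlim_at_split)
qed

text \<open>Radial functions are written through the squared modulus, which is smooth at the origin
  too. The Laplacian then is \<open>4 * (h1 u + u * h2 u)\<close> at
  \<open>u = (norm z)\<^sup>2\<close>.\<close>

lemma C2_compact_radial:
  fixes h h1 h2 :: "real \<Rightarrow> real"
  assumes h: "\<And>u. (h has_real_derivative h1 u) (at u)" "\<And>u. (h1 has_real_derivative h2 u) (at u)"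
    and c: "continuous_on UNIV h2" and z: "\<And>u. u > r\<^sup>2 \<Longrightarrow> h u = 0" and r: "r > 0"
  shows "C2_compact (\<lambda>z. h ((norm z)\<^sup>2)) (\<lambda>z. 2 * Re z * h1 ((norm z)\<^sup>2)) (\<lambda>z. 2 * Im z * h1 ((norm z)\<^sup>2))
     (\<lambda>z. 2 * h1 ((norm z)\<^sup>2) + 4 * (Re z)\<^sup>2 * h2 ((norm z)\<^sup>2))
     (\<lambda>z. 2 * h1 ((norm z)\<^sup>2) + 4 * (Im z)\<^sup>2 * h2 ((norm z)\<^sup>2)) r"
proof -
  have ch: "continuous_on UNIV h" "continuous_on UNIV h1"
    by (auto simp: continuous_on_eq_continuous_at intro: DERIV_isCont[OF h(1)] DERIV_isCont[OF h(2)])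
  have nx: "(norm (z + of_real t))\<^sup>2 = (Re z + t)\<^sup>2 + (Im z)\<^sup>2" for z t by (simp add: cmod_power2)
  have ny: "(norm (z + of_real t * \<i>))\<^sup>2 = (Re z)\<^sup>2 + (Im z + t)\<^sup>2" for z t by (simp add: cmod_power2)
  have dx: "((\<lambda>t. (a + t)\<^sup>2 + b) has_real_derivative 2 * a) (at 0)" for a b :: real
    by (auto intro!: derivative_eq_intros)
  have dy: "((\<lambda>t. b + (a + t)\<^sup>2) has_real_derivative 2 * a) (at 0)" for a b :: real
    by (auto intro!: derivative_eq_intros)
  have cx: "((\<lambda>t. k ((a + t)\<^sup>2 + b)) has_real_derivative k1 (a\<^sup>2 + b) * (2 * a)) (at 0)"
    and cy: "((\<lambda>t. k (b + (a + t)\<^sup>2)) has_real_derivative k1 (b + a\<^sup>2) * (2 * a)) (at 0)"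
    if "\<And>u. (k has_real_derivative k1 u) (at u)" for k k1 :: "real \<Rightarrow> real" and a b
    using DERIV_chain2[OF that dx] DERIV_chain2[OF that dy] by simp_all
  have ex: "((\<lambda>t. 2 * (a + t) * h1 ((a + t)\<^sup>2 + b)) has_real_derivative 2 * h1 (a\<^sup>2 + b) + 4 * a\<^sup>2 * h2 (a\<^sup>2 + b)) (at 0)"
    and ey: "((\<lambda>t. 2 * (a + t) * h1 (b + (a + t)\<^sup>2)) has_real_derivative 2 * h1 (b + a\<^sup>2) + 4 * a\<^sup>2 * h2 (b + a\<^sup>2)) (at 0)"
    for a b
  proof -
    have l: "((\<lambda>t. 2 * (a + t)) has_real_derivative 2) (at 0)" by (auto intro!: derivative_eq_intros)
    show "((\<lambda>t. 2 * (a + t) * h1 ((a + t)\<^sup>2 + b)) has_real_derivative 2 * h1 (a\<^sup>2 + b) + 4 * a\<^sup>2 * h2 (a\<^sup>2 + b)) (at 0)"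
      using DERIV_mult[OF l cx[OF h(2), of a b]] by (simp add: power2_eq_square algebra_simps)
    show "((\<lambda>t. 2 * (a + t) * h1 (b + (a + t)\<^sup>2)) has_real_derivative 2 * h1 (b + a\<^sup>2) + 4 * a\<^sup>2 * h2 (b + a\<^sup>2)) (at 0)"
      using DERIV_mult[OF l cy[OF h(2), where a=a and b=b]] by (simp add: power2_eq_square algebra_simps)
  qed
  show ?thesis
  proof
    fix z :: complex
    show "((\<lambda>t. h ((norm (z + of_real t))\<^sup>2)) has_real_derivative 2 * Re z * h1 ((norm z)\<^sup>2)) (at 0)"
      using cx[OF h(1), of "Re z" "(Im z)\<^sup>2"] unfolding nx by (simp add: cmod_power2 mult_ac)
    show "((\<lambda>t. h ((norm (z + of_real t * \<i>))\<^sup>2)) has_real_derivative 2 * Im z * h1 ((norm z)\<^sup>2)) (at 0)"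
      using cy[OF h(1), of "(Re z)\<^sup>2" "Im z"] unfolding ny by (simp add: cmod_power2 mult_ac)
    show "((\<lambda>t. 2 * Re (z + of_real t) * h1 ((norm (z + of_real t))\<^sup>2)) has_real_derivative
        2 * h1 ((norm z)\<^sup>2) + 4 * (Re z)\<^sup>2 * h2 ((norm z)\<^sup>2)) (at 0)"
      using ex[of "Re z" "(Im z)\<^sup>2"] unfolding nx by (simp add: cmod_power2)
    show "((\<lambda>t. 2 * Im (z + of_real t * \<i>) * h1 ((norm (z + of_real t * \<i>))\<^sup>2)) has_real_derivative
        2 * h1 ((norm z)\<^sup>2) + 4 * (Im z)\<^sup>2 * h2 ((norm z)\<^sup>2)) (at 0)"
      using ey[of "Im z" "(Re z)\<^sup>2"] unfolding ny by (simp add: cmod_power2)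
  next
    fix z :: complex assume "norm z > r"
    then show "h ((norm z)\<^sup>2) = 0" using r by (intro z power_strict_mono) auto
  qed (use r in \<open>auto intro!: continuous_intros continuous_on_compose2[OF ch(1)] continuous_on_compose2[OF ch(2)]
        continuous_on_compose2[OF c]\<close>)
qed

text \<open>The potential of the density \<open>bump\<close> below, as a function of the squared modulus: it is twice continuously
  differentiable and agrees with \<open>ln\<close> outside the unit disc.\<close>

definition reg_ln :: "real \<Rightarrow> real" where
  "reg_ln v = (if v \<le> 1 then 2 * v - v\<^sup>2 / 2 - 3 / 2 else ln v)"

definition reg_ln1 :: "real \<Rightarrow> real" where
  "reg_ln1 v = (if v \<le> 1 then 2 - v else 1 / v)"

definition reg_ln2 :: "real \<Rightarrow> real" where
  "reg_ln2 v = (if v \<le> 1 then - 1 else - 1 / v\<^sup>2)"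

text \<open>The quadratic branch is the second-order Taylor polynomial of \<open>ln\<close> at 1.
  Hence the value and the first derivative agree at the junction, and in
  \<open>reg_ln1_deriv\<close> the second derivative does as well.\<close>

lemma reg_ln_deriv: "(reg_ln has_real_derivative reg_ln1 v) (at v)"
proof -
  have p: "((\<lambda>v. 2 * v - v\<^sup>2 / 2 - 3 / 2) has_real_derivative 2 - v) (at v)" for v :: real
    by (auto intro!: derivative_eq_intros)
  have q: "(ln has_real_derivative 1 / v) (at v)" if "v > 0" for v :: real
    using that by (auto intro!: derivative_eq_intros)
  consider "v < 1" | "v = 1" | "v > 1" by linarith
  then show ?thesis
  proof cases
    case 1
    show ?thesis unfolding reg_ln1_def using 1
      by (auto intro!: has_field_derivative_transform_within_open[OF p[of v], where S="{..<1}"] simp: reg_ln_def)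
  next
    case 2
    show ?thesis unfolding 2
      by (rule has_real_derivative_glue[of "\<lambda>v. 2 * v - v\<^sup>2 / 2 - 3 / 2" _ _ ln])
         (use p[of 1] q[of 1] in \<open>auto simp: reg_ln_def reg_ln1_def\<close>)
  next
    case 3
    show ?thesis unfolding reg_ln1_def using 3
      by (auto intro!: has_field_derivative_transform_within_open[OF q, where S="{1<..}"] simp: reg_ln_def)
  qed
qed

lemma reg_ln1_deriv: "(reg_ln1 has_real_derivative reg_ln2 v) (at v)"
proof -
  have p: "((\<lambda>v. 2 - v) has_real_derivative -1) (at v)" for v :: real
    by (auto intro!: derivative_eq_intros)
  have q: "((\<lambda>v. 1 / v) has_real_derivative - (1 / v\<^sup>2)) (at v)" if "v > 0" for v :: real
    using that by (auto intro!: derivative_eq_intros simp: power2_eq_square)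
  consider "v < 1" | "v = 1" | "v > 1" by linarith
  then show ?thesis
  proof cases
    case 1
    show ?thesis unfolding reg_ln2_def using 1
      by (auto intro!: has_field_derivative_transform_within_open[OF p[of v], where S="{..<1}"] simp: reg_ln1_def)
  next
    case 2
    show ?thesis unfolding 2
      by (rule has_real_derivative_glue[of "\<lambda>v. 2 - v" _ _ "\<lambda>v. 1 / v"])
         (use p[of 1] q[of 1] in \<open>auto simp: reg_ln1_def reg_ln2_def\<close>)
  next
    case 3
    show ?thesis unfolding reg_ln2_def using 3
      by (auto intro!: has_field_derivative_transform_within_open[OF q, where S="{1<..}"] simp: reg_ln1_def)
  qed
qed

lemma reg_ln2_cont: "continuous_on UNIV reg_ln2"
proof -
  have eq: "reg_ln2 = (\<lambda>v. - 1 / (max 1 v)\<^sup>2)"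
    by (auto simp: reg_ln2_def fun_eq_iff max_def)
  show ?thesis unfolding eq by (intro continuous_intros) auto
qed

text \<open>Up to the factor 4 this is the Laplacian of \<open>reg_ln ((norm z)\<^sup>2)\<close> at
  \<open>v = (norm z)\<^sup>2\<close>. It vanishes for \<open>v > 1\<close> because the logarithm of
  the modulus is harmonic away from the origin.\<close>

lemma reg_ln_laplace: "reg_ln1 v + v * reg_ln2 v = 2 * max 0 (1 - v)"
  by (auto simp: reg_ln1_def reg_ln2_def power2_eq_square)

text \<open>The difference vanishes at 1 and has derivative \<open>- (1 - x)\<^sup>2 / x\<close> on
  the quadratic branch.\<close>

lemma ln_le_reg_ln:
  assumes "v > 0" shows "ln v \<le> reg_ln v"
proof (cases "v \<le> 1")
  case True
  have "(\<lambda>v. reg_ln v - ln v) 1 \<le> (\<lambda>v. reg_ln v - ln v) v"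
  proof (rule DERIV_nonpos_imp_nonincreasing[OF True])
    fix x assume x: "v \<le> x" "x \<le> 1"
    then have x0: "x > 0" using assms by simp
    have "((\<lambda>v. reg_ln v - ln v) has_real_derivative reg_ln1 x - 1 / x) (at x)"
      using x0 by (auto intro!: derivative_eq_intros reg_ln_deriv)
    moreover have "reg_ln1 x - 1 / x \<le> 0"
    proof -
      have "0 \<le> (1 - x)\<^sup>2" by simp
      then show ?thesis using x x0 by (simp add: reg_ln1_def field_simps power2_eq_square)
    qed
    ultimately show "\<exists>y. ((\<lambda>v. reg_ln v - ln v) has_real_derivative y) (at x) \<and> y \<le> 0" by blast
  qed
  then show ?thesis by (simp add: reg_ln_def)
qed (simp add: reg_ln_def)

text \<open>With \<open>u\<close> a squared modulus, \<open>reg_ln (u / a) + ln a\<close> is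
  proportional to the logarithmic potential of a mass smeared over the disc of squared radius
  \<open>a\<close>. Smearing over a larger disc raises the potential, with equality outside that
  disc.\<close>

lemma reg_ln_scale_mono:
  assumes "0 < b" "b \<le> a" "u \<ge> 0"
  shows "reg_ln (u / b) + ln b \<le> reg_ln (u / a) + ln a"
proof -
  consider "u \<ge> a" | "b < u" "u < a" | "u \<le> b" using assms by linarith
  then show ?thesis
  proof cases
    case 1
    have "reg_ln (u / c) + ln c = ln u" if "c = a \<or> c = b" for c
    proof -
      have c: "c > 0" "u \<ge> c" using that assms 1 by auto
      then have "reg_ln (u / c) = ln (u / c)" by (auto simp: reg_ln_def)
      then show ?thesis using c by (simp add: ln_div)
    qed
    then show ?thesis by simp
  next
    case 2
    have "reg_ln (u / b) + ln b = ln u" using 2 assms by (simp add: reg_ln_def ln_div)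
    moreover have "ln u - ln a \<le> reg_ln (u / a)" using ln_le_reg_ln[of "u/a"] 2 assms by (simp add: ln_div)
    ultimately show ?thesis by simp
  next
    case 3
    define s where "s = b / a"
    define v where "v = u / b"
    have s: "0 < s" "s \<le> 1" using assms by (auto simp: s_def)
    have v: "0 \<le> v" "v \<le> 1" using assms 3 by (auto simp: v_def)
    have ua: "u / a = v * s" using assms by (simp add: s_def v_def)
    have vs: "v * s \<le> 1" using s v by (simp add: mult_le_one)
    have "ln s \<le> reg_ln s" using ln_le_reg_ln s by simp
    then have 1: "ln b - ln a \<le> 2 * s - s\<^sup>2 / 2 - 3 / 2" using s assms by (simp add: reg_ln_def s_def ln_div)
    \<comment> \<open>With \<open>ln s\<close> replaced by the quadratic that majorises it, the
      claim becomes polynomial in \<open>s\<close> and \<open>v\<close>; this factorisation exhibits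
      its sign on the unit square.\<close>
    have "0 \<le> (1 - s) * ((1 - v)\<^sup>2 + (1 - s) * (1 - v\<^sup>2) / 2)"
      using s v by (intro mult_nonneg_nonneg add_nonneg_nonneg) (auto simp: power_le_one)
    also have "\<dots> = 3/2 - 2 * s + s\<^sup>2 / 2 + (2 * (v * s) - (v * s)\<^sup>2 / 2) - (2 * v - v\<^sup>2 / 2)"
      by (simp add: power2_eq_square field_simps)
    finally show ?thesis using 1 v vs unfolding ua v_def[symmetric] by (simp add: reg_ln_def)
  qed
qed

text \<open>A quarter of the Laplacian of \<open>reg_ln ((norm z)\<^sup>2 / r\<^sup>2)\<close>. It
  replaces the uniform density on a disc in the sub-mean-value inequality: being continuous, it has
  a potential that is twice continuously differentiable, so that Green's formula applies. The factor
  \<open>2 / r\<^sup>2\<close> makes its total mass the same for all \<open>r\<close>.\<close>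

definition bump :: "real \<Rightarrow> complex \<Rightarrow> real" where
  "bump r z = 2 / r\<^sup>2 * max 0 (1 - (norm z)\<^sup>2 / r\<^sup>2)"

definition bump_mass :: real where "bump_mass = (\<integral>z. bump 1 z \<partial>lborel)"

lemma bump_cont: "r > 0 \<Longrightarrow> continuous_on UNIV (bump r)"
  unfolding bump_def by (intro continuous_intros) auto

lemma bump_nonneg: "bump r z \<ge> 0" by (simp add: bump_def)

lemma bump_supp: "r > 0 \<Longrightarrow> norm z > r \<Longrightarrow> bump r z = 0"
  using power_strict_mono[of r "norm z" 2] by (simp add: bump_def max_def)

text \<open>\<open>h\<close> is a quarter of the difference of the two regularised logarithms.
  Beyond the larger radius both equal \<open>ln u\<close>, so \<open>h\<close> has compact support,
  and its Laplacian is \<open>bump r z - bump t z\<close>. The first claim holds because a Laplacian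
  has integral 0; the second because Green's formula at \<open>w\<close> evaluates the difference to
  \<open>2 * pi * h ((norm w)\<^sup>2)\<close>, which is nonnegative by
  \<open>reg_ln_scale_mono\<close>.\<close>

lemma bump_comparison:
  assumes "0 < t" "t \<le> r"
  shows "(\<integral>z. bump t z \<partial>lborel) = (\<integral>z. bump r z \<partial>lborel)"
    and "(\<integral>z. ln (norm (z - w)) * bump t z \<partial>lborel) \<le> (\<integral>z. ln (norm (z - w)) * bump r z \<partial>lborel)"
proof -
  have r: "r > 0" using assms by simp
  define h where "h u = (reg_ln (u / r\<^sup>2) + ln (r\<^sup>2) - (reg_ln (u / t\<^sup>2) + ln (t\<^sup>2))) / 4" for u
  define h1 where "h1 u = (reg_ln1 (u / r\<^sup>2) / r\<^sup>2 - reg_ln1 (u / t\<^sup>2) / t\<^sup>2) / 4" for u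
  define h2 where "h2 u = (reg_ln2 (u / r\<^sup>2) / r\<^sup>2 / r\<^sup>2 - reg_ln2 (u / t\<^sup>2) / t\<^sup>2 / t\<^sup>2) / 4" for u
  have sc: "((\<lambda>u. k (u / c)) has_real_derivative k1 (u / c) / c) (at u)"
    if "\<And>u. (k has_real_derivative k1 u) (at u)" for k k1 :: "real \<Rightarrow> real" and u c
  proof -
    have "((\<lambda>u. u / c) has_real_derivative 1 / c) (at u)" by (rule DERIV_cdivide) auto
    from DERIV_chain2[OF that this] show ?thesis by simp
  qed
  have dh: "(h has_real_derivative h1 u) (at u)" for u
    unfolding h_def h1_def
    by (rule DERIV_cdivide) (auto intro!: derivative_eq_intros sc[OF reg_ln_deriv])
  have dh1: "(h1 has_real_derivative h2 u) (at u)" for u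
    unfolding h1_def h2_def
    by (intro DERIV_cdivide DERIV_diff sc[OF reg_ln1_deriv])
  have ch2: "continuous_on UNIV h2"
    unfolding h2_def using assms
    by (auto intro!: continuous_intros continuous_on_compose2[OF reg_ln2_cont])
  have hz: "h u = 0" if "u > r\<^sup>2" for u
  proof -
    have "t\<^sup>2 \<le> r\<^sup>2" using assms by (simp add: power_mono)
    then have "u > t\<^sup>2" using that by simp
    moreover have "t\<^sup>2 > 0" "r\<^sup>2 > 0" using assms by auto
    moreover from this have "u > 0" using \<open>u > t\<^sup>2\<close> by linarith
    ultimately show ?thesis using that by (simp add: h_def reg_ln_def ln_div)
  qed
  interpret B: C2_compact "\<lambda>z. h ((norm z)\<^sup>2)" "\<lambda>z. 2 * Re z * h1 ((norm z)\<^sup>2)" "\<lambda>z. 2 * Im z * h1 ((norm z)\<^sup>2)"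
     "\<lambda>z. 2 * h1 ((norm z)\<^sup>2) + 4 * (Re z)\<^sup>2 * h2 ((norm z)\<^sup>2)"
     "\<lambda>z. 2 * h1 ((norm z)\<^sup>2) + 4 * (Im z)\<^sup>2 * h2 ((norm z)\<^sup>2)" r
    by (rule C2_compact_radial[OF dh dh1 ch2 hz r])
  have lap: "B.lap z = bump r z - bump t z" for z
  proof -
    have "B.lap z = 4 * h1 ((norm z)\<^sup>2) + 4 * (norm z)\<^sup>2 * h2 ((norm z)\<^sup>2)"
      unfolding B.lap_def by (simp add: cmod_power2 algebra_simps)
    also have "\<dots> = (reg_ln1 ((norm z)\<^sup>2 / r\<^sup>2) + (norm z)\<^sup>2 / r\<^sup>2 * reg_ln2 ((norm z)\<^sup>2 / r\<^sup>2)) / r\<^sup>2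
       - (reg_ln1 ((norm z)\<^sup>2 / t\<^sup>2) + (norm z)\<^sup>2 / t\<^sup>2 * reg_ln2 ((norm z)\<^sup>2 / t\<^sup>2)) / t\<^sup>2"
      by (simp add: h1_def h2_def add_divide_distrib diff_divide_distrib algebra_simps)
    finally show ?thesis unfolding reg_ln_laplace by (simp add: bump_def)
  qed
  have t_supp: "norm z > r \<Longrightarrow> bump t z = 0" for z using bump_supp[of t z] assms by auto
  have i: "integrable lborel (bump r)" "integrable lborel (bump t)"
    using integrable_cont_supp[OF r bump_cont[OF r] bump_supp[OF r]]
      integrable_cont_supp[OF r bump_cont[OF assms(1)] t_supp] by auto
  have j: "integrable lborel (\<lambda>z. ln (norm (z - w)) * bump r z)" "integrable lborel (\<lambda>z. ln (norm (z - w)) * bump t z)"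
    using integrable_ln_shift_mult[OF r bump_cont[OF r] bump_supp[OF r]]
      integrable_ln_shift_mult[OF r bump_cont[OF assms(1)] t_supp] by auto
  have "(\<integral>z. bump r z - bump t z \<partial>lborel) = 0" using B.integral_lap unfolding lap .
  then show "(\<integral>z. bump t z \<partial>lborel) = (\<integral>z. bump r z \<partial>lborel)" using i by simp
  have "h ((norm w)\<^sup>2) \<ge> 0"
    using reg_ln_scale_mono[of "t\<^sup>2" "r\<^sup>2" "(norm w)\<^sup>2"] assms by (simp add: h_def power_mono)
  then have "0 \<le> (\<integral>z. ln (norm (z - w)) * (bump r z - bump t z) \<partial>lborel)"
    using B.green(2)[of w] unfolding lap by simp
  then show "(\<integral>z. ln (norm (z - w)) * bump t z \<partial>lborel) \<le> (\<integral>z. ln (norm (z - w)) * bump r z \<partial>lborel)"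
    using j by (simp add: right_diff_distrib)
qed

lemma integrable_bump: "r > 0 \<Longrightarrow> integrable lborel (bump r)"
  using integrable_cont_supp[of r "bump r"] bump_cont bump_supp by blast

lemma integral_bump: "r > 0 \<Longrightarrow> (\<integral>z. bump r z \<partial>lborel) = bump_mass"
  unfolding bump_mass_def using bump_comparison(1)[of 1 r] bump_comparison(1)[of r 1] by (cases "r \<le> 1") auto

lemma bump_mass_nonneg: "bump_mass \<ge> 0"
  unfolding bump_mass_def by (intro integral_nonneg_AE) (simp add: bump_nonneg)

text \<open>The average over radius \<open>r\<close> dominates the average over any smaller radius
  \<open>t\<close>. On the support of \<open>bump t\<close> the integrand is at least
  \<open>ln (norm w - t)\<close>, and \<open>t\<close> tends to 0.\<close>

lemma submean_ln:
  assumes r: "r > 0" and w: "w \<noteq> 0"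
  shows "bump_mass * ln (norm w) \<le> (\<integral>z. ln (norm (z - w)) * bump r z \<partial>lborel)"
proof (rule tendsto_upperbound)
  show "((\<lambda>t. bump_mass * ln (norm w - t)) \<longlongrightarrow> bump_mass * ln (norm w)) (at_right 0)"
    using w by (auto intro!: tendsto_eq_intros)
  have "\<forall>\<^sub>F t in at_right (0::real). t \<in> {0<..<min r (norm w)}"
    using r w by (intro eventually_at_right_real) auto
  then show "\<forall>\<^sub>F t in at_right 0. bump_mass * ln (norm w - t) \<le> (\<integral>z. ln (norm (z - w)) * bump r z \<partial>lborel)"
  proof eventually_elim
    fix t :: real assume "t \<in> {0<..<min r (norm w)}"
    then have t: "0 < t" "t \<le> r" "t < norm w" by auto
    have "bump_mass * ln (norm w - t) = (\<integral>z. ln (norm w - t) * bump t z \<partial>lborel)"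
      using integral_bump[OF t(1)] by simp
    also have "\<dots> \<le> (\<integral>z. ln (norm (z - w)) * bump t z \<partial>lborel)"
    proof (rule integral_mono)
      show "integrable lborel (\<lambda>z. ln (norm w - t) * bump t z)"
        using integrable_bump t by auto
      show "integrable lborel (\<lambda>z. ln (norm (z - w)) * bump t z)"
        using integrable_ln_shift_mult[OF t(1) bump_cont[OF t(1)] bump_supp[OF t(1)]] by blast
      fix z :: complex
      show "ln (norm w - t) * bump t z \<le> ln (norm (z - w)) * bump t z"
      proof (cases "norm z > t")
        case False
        then have "norm w - t \<le> norm (z - w)" using norm_triangle_ineq2[of w z] by (simp add: norm_minus_commute)
        then show ?thesis using t by (intro mult_right_mono bump_nonneg) (use t ln_mono[of "norm w - t" "norm (z - w)"] in auto)
      qed (use bump_supp t in auto)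
    qed
    also have "\<dots> \<le> (\<integral>z. ln (norm (z - w)) * bump r z \<partial>lborel)"
      by (rule bump_comparison(2)[OF t(1,2)])
    finally show "bump_mass * ln (norm w - t) \<le> (\<integral>z. ln (norm (z - w)) * bump r z \<partial>lborel)" .
  qed
qed simp

section \<open>Zeros and logarithmic potentials\<close>

lemma integral_translate_complex:
  fixes g :: "complex \<Rightarrow> real"
  assumes [measurable]: "g \<in> borel_measurable borel"
  shows "(\<integral>z. g (z + a) \<partial>lborel) = (\<integral>z. g z \<partial>lborel)"
    and "integrable lborel (\<lambda>z. g (z + a)) \<longleftrightarrow> integrable lborel g"
proof -
  have d: "distr lborel borel ((+) a) = (lborel :: complex measure)" by (rule lborel_distr_plus)
  have "(\<integral>z. g z \<partial>distr lborel borel ((+) a)) = (\<integral>z. g (a + z) \<partial>lborel)"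
    by (subst integral_distr) simp_all
  then show "(\<integral>z. g (z + a) \<partial>lborel) = (\<integral>z. g z \<partial>lborel)" unfolding d by (simp add: add.commute)
  have "integrable (distr lborel borel ((+) a)) g \<longleftrightarrow> integrable lborel (\<lambda>z. g (a + z))"
    by (subst integrable_distr_eq) simp_all
  then show "integrable lborel (\<lambda>z. g (z + a)) \<longleftrightarrow> integrable lborel g" unfolding d by (simp add: add.commute)
qed

lemma ln_norm_poly:
  fixes p :: "complex poly"
  assumes "poly p z \<noteq> 0"
  shows "ln (norm (poly p z)) =
    ln (norm (lead_coeff p)) + (\<Sum>w | poly p w = 0. real (order w p) * ln (norm (z - w)))"
proof -
  have p0: "p \<noteq> 0" using assms by auto
  then have fin: "finite {w. poly p w = 0}" by (simp add: poly_roots_finite)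
  have "poly p z = poly (smult (lead_coeff p) (\<Prod>w | poly p w = 0. [:- w, 1:] ^ order w p)) z"
    by (simp only: complex_poly_decompose)
  also have "\<dots> = lead_coeff p * (\<Prod>w | poly p w = 0. (z - w) ^ order w p)"
    by (simp add: poly_prod)
  finally have eq: "poly p z = lead_coeff p * (\<Prod>w | poly p w = 0. (z - w) ^ order w p)" .
  have nz: "w \<in> {w. poly p w = 0} \<Longrightarrow> z - w \<noteq> 0" for w using assms by auto
  have "ln (norm (poly p z)) = ln (norm (lead_coeff p)) + ln (\<Prod>w | poly p w = 0. norm (z - w) ^ order w p)"
    unfolding eq norm_mult prod_norm[symmetric] norm_power using p0 nz fin
    by (subst ln_mult) (auto intro!: prod_pos)
  also have "ln (\<Prod>w | poly p w = 0. norm (z - w) ^ order w p) = (\<Sum>w | poly p w = 0. real (order w p) * ln (norm (z - w)))"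
    using fin nz by (subst ln_prod) (auto intro!: sum.cong simp: ln_realpow)
  finally show ?thesis .
qed

lemma AE_poly_nonzero:
  assumes "p \<noteq> 0"
  shows "AE z in lborel. poly p (z::complex) \<noteq> 0"
proof -
  have "countable {z. poly p z = 0}" using poly_roots_finite[OF assms] by (rule countable_finite)
  then have "{z. poly p z = 0} \<in> null_sets lborel" by (rule countable_imp_null_set_lborel)
  then show ?thesis by (rule AE_not_in[THEN AE_mp]) auto
qed

lemma
  fixes g :: "complex \<Rightarrow> real"
  assumes R: "R > 0" and c: "continuous_on UNIV g" and g: "\<And>z. norm z > R \<Longrightarrow> g z = 0" and p: "p \<noteq> 0"
  shows integrable_ln_poly: "integrable lborel (\<lambda>z. ln (norm (poly p z)) * g z)"
    and integral_ln_poly: "(\<integral>z. ln (norm (poly p z)) * g z \<partial>lborel) = ln (norm (lead_coeff p)) * (\<integral>z. g z \<partial>lborel) +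
       (\<Sum>w | poly p w = 0. real (order w p) * (\<integral>z. ln (norm (z - w)) * g z \<partial>lborel))"
proof -
  have [measurable]: "g \<in> borel_measurable borel" using c by (rule borel_measurable_continuous_onI)
  have [measurable]: "poly p \<in> borel_measurable borel"
    by (intro borel_measurable_continuous_onI continuous_intros)
  let ?h = "\<lambda>z. ln (norm (lead_coeff p)) * g z + (\<Sum>w | poly p w = 0. real (order w p) * (ln (norm (z - w)) * g z))"
  have i: "integrable lborel (\<lambda>z. ln (norm (z - w)) * g z)" for w
    using integrable_ln_shift_mult[OF R c g] by blast
  have ig: "integrable lborel g" using integrable_cont_supp[OF R c g] by blast
  have ih: "integrable lborel ?h" using i ig by auto
  have AE: "AE z in lborel. ?h z = ln (norm (poly p z)) * g z"
    using AE_poly_nonzero[OF p] by eventually_elim (simp add: ln_norm_poly sum_distrib_right sum_distrib_left algebra_simps)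
  show "integrable lborel (\<lambda>z. ln (norm (poly p z)) * g z)"
    by (rule integrable_cong_AE_imp[OF ih]) (use AE in auto)
  have "(\<integral>z. ln (norm (poly p z)) * g z \<partial>lborel) = (\<integral>z. ?h z \<partial>lborel)"
    by (rule integral_cong_AE) (use AE ih in auto)
  also have "\<dots> = ln (norm (lead_coeff p)) * (\<integral>z. g z \<partial>lborel) +
       (\<Sum>w | poly p w = 0. real (order w p) * (\<integral>z. ln (norm (z - w)) * g z \<partial>lborel))"
    using i ig by (subst Bochner_Integration.integral_add) (auto intro!: integrable_sum)
  finally show "(\<integral>z. ln (norm (poly p z)) * g z \<partial>lborel) = ln (norm (lead_coeff p)) * (\<integral>z. g z \<partial>lborel) +
       (\<Sum>w | poly p w = 0. real (order w p) * (\<integral>z. ln (norm (z - w)) * g z \<partial>lborel))" .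
qed

text \<open>The inequality is additive over the zeros, and the leading coefficient contributes an
  equality.\<close>

lemma
  assumes r: "r > 0" and p: "poly p a \<noteq> 0"
  shows integrable_ln_poly_bump: "integrable lborel (\<lambda>z. ln (norm (poly p z)) * bump r (z - a))"
    and submean_poly: "bump_mass * ln (norm (poly p a)) \<le> (\<integral>z. ln (norm (poly p z)) * bump r (z - a) \<partial>lborel)"
proof -
  have p0: "p \<noteq> 0" using p by auto
  have c: "continuous_on UNIV (\<lambda>z. bump r (z - a))"
    by (intro continuous_on_compose2[OF bump_cont[OF r]] continuous_intros) auto
  have [measurable]: "bump r \<in> borel_measurable borel" using bump_cont[OF r] by (rule borel_measurable_continuous_onI)
  have ra: "r + norm a > 0" using r by (simp add: add_pos_nonneg)
  have s: "bump r (z - a) = 0" if "norm z > r + norm a" for z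
    using that norm_triangle_ineq2[of z a] by (intro bump_supp[OF r]) linarith
  show "integrable lborel (\<lambda>z. ln (norm (poly p z)) * bump r (z - a))"
    by (rule integrable_ln_poly[OF ra c s p0])
  have t1: "(\<integral>z. bump r (z - a) \<partial>lborel) = bump_mass"
    using integral_translate_complex(1)[of "bump r" "-a"] integral_bump[OF r] by simp
  have t2: "bump_mass * ln (norm (a - w)) \<le> (\<integral>z. ln (norm (z - w)) * bump r (z - a) \<partial>lborel)" if "poly p w = 0" for w
  proof -
    have "bump_mass * ln (norm (w - a)) \<le> (\<integral>z. ln (norm (z - (w - a))) * bump r z \<partial>lborel)"
      using that p by (intro submean_ln r) auto
    also have "\<dots> = (\<integral>z. ln (norm (z - w)) * bump r (z - a) \<partial>lborel)"
      using integral_translate_complex(1)[of "\<lambda>z. ln (norm (z - (w - a))) * bump r z" "-a"] by simp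
    finally show ?thesis by (simp add: norm_minus_commute)
  qed
  have "bump_mass * ln (norm (poly p a)) = ln (norm (lead_coeff p)) * bump_mass +
      (\<Sum>w | poly p w = 0. real (order w p) * (bump_mass * ln (norm (a - w))))"
    by (subst ln_norm_poly[OF p]) (simp add: algebra_simps sum_distrib_left)
  also have "\<dots> \<le> ln (norm (lead_coeff p)) * bump_mass +
      (\<Sum>w | poly p w = 0. real (order w p) * (\<integral>z. ln (norm (z - w)) * bump r (z - a) \<partial>lborel))"
    by (intro add_left_mono sum_mono mult_left_mono t2) auto
  also have "\<dots> = (\<integral>z. ln (norm (poly p z)) * bump r (z - a) \<partial>lborel)"
    by (subst integral_ln_poly[OF ra c s p0]) (simp_all add: t1)
  finally show "bump_mass * ln (norm (poly p a)) \<le> (\<integral>z. ln (norm (poly p z)) * bump r (z - a) \<partial>lborel)" .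
qed

text \<open>A multiple of the bump of radius \<open>3 * t\<close> majorises the indicator of the
  concentric disc of radius \<open>2 * t\<close>. That disc contains the disc of radius
  \<open>t\<close> about every point at distance at most \<open>t\<close> from the centre, so the
  centre of the bump may be displaced from the net point it serves. The constant works because
  \<open>2 * (1 - 4 / 9) \<ge> 1\<close>.\<close>

lemma bump_lower:
  assumes "t > 0" "norm z \<le> 2 * t"
  shows "1 \<le> 9 * t\<^sup>2 * bump (3 * t) z"
proof -
  have "(norm z)\<^sup>2 \<le> (2 * t)\<^sup>2" using assms by (intro power_mono) auto
  then have "(norm z)\<^sup>2 / (3 * t)\<^sup>2 \<le> 4 / 9" using assms by (simp add: field_simps)
  then have "max 0 (1 - (norm z)\<^sup>2 / (3 * t)\<^sup>2) \<ge> 5 / 9" by simp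
  then have "2 * max 0 (1 - (norm z)\<^sup>2 / (3 * t)\<^sup>2) \<ge> 1" by argo
  moreover have "9 * t\<^sup>2 * bump (3 * t) z = 2 * max 0 (1 - (norm z)\<^sup>2 / (3 * t)\<^sup>2)"
    using assms by (simp add: bump_def power_mult_distrib)
  ultimately show ?thesis by argo
qed

text \<open>What matters is the product of the number of points and the squared mesh
  \<open>2 * R / m\<close>: it is at most \<open>36 * R\<^sup>2\<close> for every \<open>m\<close>,
  so refining the grid does not increase errors proportional to the covered area.\<close>

lemma complex_grid:
  assumes "R > 0" "m > 0"
  shows "\<exists>A. finite A \<and> card A \<le> 9 * m\<^sup>2 \<and> (\<forall>a\<in>A. norm a \<le> 2 * R) \<and>
     (\<forall>z::complex. norm z \<le> R \<longrightarrow> (\<exists>a\<in>A. dist a z < 2 * R / m))"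
proof -
  define G where "G = (\<lambda>(i, j). Complex (R * of_int i / m) (R * of_int j / m)) ` ({-int m..int m} \<times> {-int m..int m})"
  have "card G \<le> card ({-int m..int m} \<times> {-int m..int m})" unfolding G_def by (rule card_image_le) auto
  also have "\<dots> = (2 * m + 1)\<^sup>2" by (simp add: card_cartesian_product power2_eq_square nat_add_distrib nat_mult_distrib algebra_simps)
  also have "\<dots> \<le> (3 * m)\<^sup>2" using assms by (intro power_mono) auto
  finally have card: "card G \<le> 9 * m\<^sup>2" by (simp add: power_mult_distrib)
  have nrm: "norm a \<le> 2 * R" if a: "a \<in> G" for a
  proof -
    from a obtain i j where ij: "a = Complex (R * of_int i / m) (R * of_int j / m)" "\<bar>i\<bar> \<le> int m" "\<bar>j\<bar> \<le> int m"
      unfolding G_def by (force simp: abs_le_iff)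
    have "\<bar>R * of_int k / m\<bar> \<le> R" if "\<bar>k\<bar> \<le> int m" for k :: int
    proof -
      have "\<bar>of_int k\<bar> \<le> (real m)" using that by linarith
      then have "R * \<bar>of_int k\<bar> \<le> R * real m" using assms by (intro mult_left_mono) auto
      then show ?thesis using assms by (simp add: abs_mult field_simps)
    qed
    from this[OF ij(2)] this[OF ij(3)] show ?thesis using cmod_le[of a] by (simp add: ij(1))
  qed
  have cov: "\<exists>a\<in>G. dist a z < 2 * R / m" if z: "norm z \<le> R" for z :: complex
  proof -
    \<comment> \<open>Rounding towards 0 keeps the index within \<open>-m..m\<close> and moves the
      coordinate by less than one grid step.\<close>
    define rnd where "rnd x = (if x \<ge> 0 then \<lfloor>x * m / R\<rfloor> else \<lceil>x * m / R\<rceil>)" for x :: real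
    have rnd: "\<bar>rnd x\<bar> \<le> int m \<and> \<bar>R * of_int (rnd x) / m - x\<bar> < R / m" if "\<bar>x\<bar> \<le> R" for x
    proof -
      define y where "y = x * m / R"
      have y: "\<bar>y\<bar> \<le> m" using that assms by (simp add: y_def abs_mult field_simps)
      have x: "x = R * y / m" using assms by (simp add: y_def)
      have sg: "x \<ge> 0 \<longleftrightarrow> y \<ge> 0" using assms by (simp add: y_def zero_le_divide_iff zero_le_mult_iff)
      have 1: "\<bar>rnd x\<bar> \<le> int m" "\<bar>of_int (rnd x) - y\<bar> < 1"
      proof -
        consider "y \<ge> 0" "rnd x = \<lfloor>y\<rfloor>" | "y < 0" "rnd x = \<lceil>y\<rceil>"
          using sg by (cases "y \<ge> 0") (auto simp: rnd_def y_def)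
        then have "\<bar>rnd x\<bar> \<le> int m \<and> \<bar>of_int (rnd x) - y\<bar> < 1"
          by cases (use y in linarith)+
        then show "\<bar>rnd x\<bar> \<le> int m" "\<bar>of_int (rnd x) - y\<bar> < 1" by auto
      qed
      have "R * of_int (rnd x) / m - x = R / m * (of_int (rnd x) - y)"
        using assms by (subst (2) x) (simp add: right_diff_distrib)
      then have "\<bar>R * of_int (rnd x) / m - x\<bar> = R / m * \<bar>of_int (rnd x) - y\<bar>"
        using assms by (simp add: abs_mult)
      also have "\<dots> < R / m * 1" using 1 assms by (intro mult_strict_left_mono) auto
      finally show ?thesis using 1 by simp
    qed
    have r: "\<bar>Re z\<bar> \<le> R" "\<bar>Im z\<bar> \<le> R"
      using z abs_Re_le_cmod[of z] abs_Im_le_cmod[of z] by auto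
    let ?a = "Complex (R * of_int (rnd (Re z)) / m) (R * of_int (rnd (Im z)) / m)"
    have "(rnd (Re z), rnd (Im z)) \<in> {-int m..int m} \<times> {-int m..int m}"
      using rnd[OF r(1)] rnd[OF r(2)] by (simp add: abs_le_iff)
    then have "?a \<in> G" unfolding G_def by (rule rev_image_eqI) simp
    moreover have "dist ?a z < 2 * R / m"
    proof -
      have "dist ?a z \<le> \<bar>R * of_int (rnd (Re z)) / m - Re z\<bar> + \<bar>R * of_int (rnd (Im z)) / m - Im z\<bar>"
        using cmod_le[of "?a - z"] unfolding dist_norm by simp
      also have "\<dots> < R / m + R / m" using rnd[OF r(1)] rnd[OF r(2)] by (intro add_strict_mono) auto
      finally show ?thesis by simp
    qed
    ultimately show ?thesis by blast
  qed
  have "finite G" unfolding G_def by simp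
  then show ?thesis using card nrm cov by blast
qed

context C2_compact
begin

text \<open>The logarithm of the leading coefficient multiplies the integral of the Laplacian, which
  is 0; therefore \<open>p\<close> needs no normalisation.\<close>

lemma zero_integral_eq_ln_integral:
  assumes "p \<noteq> 0"
  shows "2 * pi * zero_integral p f = (\<integral>z. ln (norm (poly p z)) * lap z \<partial>lborel)"
  by (subst integral_ln_poly[OF R_pos cont_lap supp_lap assms])
     (simp_all only: integral_lap green(2) zero_integral_def sum_distrib_left mult_zero_right add_0,
       auto intro!: sum.cong)

text \<open>This is the deterministic part of the convergence proof. The constants \<open>e\<close>
  and \<open>\<tau>\<close> and the net \<open>A\<close> are obtained before \<open>p\<close>, so
  they depend only on \<open>f\<close>, \<open>U\<close> and the accuracy; for random polynomials
  only finitely many discs have to be examined.\<close>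

lemma potential_control:
  fixes U :: "real \<Rightarrow> real"
  assumes U: "continuous_on {0..} U" and eps: "\<epsilon> > 0"
  obtains e \<tau> A where "e > 0" "\<tau> > 0" "finite A"
    "\<And>p. degree p > 0 \<Longrightarrow>
      (\<And>a z. a \<in> A \<Longrightarrow> norm z \<le> norm a + 4 * \<tau> \<Longrightarrow>
          norm (poly p z) \<le> exp (degree p * (U (norm a + 4 * \<tau>) + e))) \<Longrightarrow>
      (\<And>a. a \<in> A \<Longrightarrow> \<exists>z\<in>ball a \<tau>. norm (poly p z) \<ge> exp (degree p * (U (norm z) - e))) \<Longrightarrow>
      \<bar>zero_integral p f / degree p - (\<integral>z. U (norm z) * lap z \<partial>lborel) / (2 * pi)\<bar> \<le> \<epsilon>"
proof -
  obtain C where C: "C > 0" "\<And>z. \<bar>lap z\<bar> \<le> C"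
    using bounded_of_cont_supp[OF R_pos cont_lap supp_lap] by auto
  \<comment> \<open>\<open>K * e\<close> is the total error: \<open>36 * R\<^sup>2\<close> bounds
    \<open>card A * \<tau>\<^sup>2\<close> for every grid, 9 is the constant of
    \<open>bump_lower\<close>, and each net point costs \<open>5 * e\<close>. Since \<open>K\<close>
    does not involve the grid, \<open>e\<close> can be fixed before the mesh.\<close>
  define K where "K = C * 36 * R\<^sup>2 * 9 * bump_mass * 5"
  have K: "K \<ge> 0" unfolding K_def using C bump_mass_nonneg by simp
  define e where "e = 2 * pi * \<epsilon> / (K + 1)"
  have e: "e > 0" using K eps by (simp add: e_def add_nonneg_pos)
  have Ke: "K * e \<le> 2 * pi * \<epsilon>"
  proof -
    have "K * e = (K / (K + 1)) * (2 * pi * \<epsilon>)" by (simp add: e_def)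
    also have "\<dots> \<le> 1 * (2 * pi * \<epsilon>)" using K eps by (intro mult_right_mono) auto
    finally show ?thesis by simp
  qed
  have "uniformly_continuous_on {0..2 * R + 9} U"
    by (intro compact_uniformly_continuous continuous_on_subset[OF U]) auto
  then obtain \<delta> where \<delta>: "\<delta> > 0" "\<And>x y. x \<in> {0..2 * R + 9} \<Longrightarrow> y \<in> {0..2 * R + 9} \<Longrightarrow> dist x y < \<delta> \<Longrightarrow> dist (U x) (U y) < e"
    unfolding uniformly_continuous_on_def using e by metis
  obtain m :: nat where m: "real m > 10 * R / \<delta>" "real m > 2 * R"
    using reals_Archimedean2[of "max (10 * R / \<delta>) (2 * R)"] by auto
  have m0: "m > 0" using m(2) R_pos by (cases m) auto
  define \<tau> where "\<tau> = 2 * R / m"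
  \<comment> \<open>A bump of radius \<open>3 * \<tau>\<close> about a point within
    \<open>\<tau>\<close> of \<open>a\<close> stays within \<open>4 * \<tau>\<close> of
    \<open>a\<close>. The modulus of a point within \<open>\<tau>\<close> of \<open>a\<close>
    therefore differs from \<open>norm a + 4 * \<tau>\<close> by at most
    \<open>5 * \<tau>\<close>.\<close>
  have \<tau>: "\<tau> > 0" "\<tau> \<le> 1" "5 * \<tau> < \<delta>"
    using m m0 R_pos \<delta>(1) by (auto simp: \<tau>_def field_simps)
  obtain A where A: "finite A" "card A \<le> 9 * m\<^sup>2" "\<And>a. a \<in> A \<Longrightarrow> norm a \<le> 2 * R"
    "\<And>z::complex. norm z \<le> R \<Longrightarrow> \<exists>a\<in>A. dist a z < \<tau>"
    using complex_grid[OF R_pos m0] unfolding \<tau>_def by auto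
  have Uc: "\<bar>U s - U t\<bar> \<le> e" if "0 \<le> s" "0 \<le> t" "s \<le> 2 * R + 9" "t \<le> 2 * R + 9" "\<bar>s - t\<bar> \<le> 5 * \<tau>" for s t
    using \<delta>(2)[of s t] that \<tau> by (auto simp: dist_real_def)
  show ?thesis
  proof (rule that[OF e \<tau>(1) A(1)])
    fix p :: "complex poly"
    assume deg: "degree p > 0"
      and up: "\<And>a z. a \<in> A \<Longrightarrow> norm z \<le> norm a + 4 * \<tau> \<Longrightarrow> norm (poly p z) \<le> exp (degree p * (U (norm a + 4 * \<tau>) + e))"
      and low: "\<And>a. a \<in> A \<Longrightarrow> \<exists>z\<in>ball a \<tau>. norm (poly p z) \<ge> exp (degree p * (U (norm z) - e))"
    define d where "d = real (degree p)"
    have d: "d > 0" using deg by (simp add: d_def)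
    have p0: "p \<noteq> 0" using deg by auto
    from low obtain \<zeta> where \<zeta>: "\<And>a. a \<in> A \<Longrightarrow> dist a (\<zeta> a) < \<tau>"
      "\<And>a. a \<in> A \<Longrightarrow> norm (poly p (\<zeta> a)) \<ge> exp (d * (U (norm (\<zeta> a)) - e))"
      unfolding d_def by (metis mem_ball)
    define u where "u a = U (norm a + 4 * \<tau>) + e" for a :: complex
    define L where "L z = ln (norm (poly p z)) / d" for z
    have pz: "poly p (\<zeta> a) \<noteq> 0" if "a \<in> A" for a
      using \<zeta>(2)[OF that] exp_gt_zero[of "d * (U (norm (\<zeta> a)) - e)"] by (intro notI) simp
    have L\<zeta>: "L (\<zeta> a) \<ge> U (norm (\<zeta> a)) - e" if "a \<in> A" for a
    proof -
      have "d * (U (norm (\<zeta> a)) - e) \<le> ln (norm (poly p (\<zeta> a)))"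
        using \<zeta>(2)[OF that] pz[OF that] by (subst ln_ge_iff) auto
      then show ?thesis using d by (simp add: L_def field_simps)
    qed
    have Lu: "L z \<le> u a" if "a \<in> A" "norm z \<le> norm a + 4 * \<tau>" "poly p z \<noteq> 0" for a z
    proof -
      have "ln (norm (poly p z)) \<le> d * u a"
        using up[OF that(1,2)] that(3) unfolding u_def d_def[symmetric]
        by (metis ln_exp ln_mono zero_less_norm_iff)
      then show ?thesis using d by (simp add: L_def field_simps)
    qed
    let ?b = "\<lambda>a z. bump (3 * \<tau>) (z - \<zeta> a)"
    have ib: "integrable lborel (\<lambda>z. L z * ?b a z)" if "a \<in> A" for a
      using integrable_ln_poly_bump[OF _ pz[OF that], of "3 * \<tau>"] \<tau> by (simp add: L_def)
    have mb [measurable]: "bump (3 * \<tau>) \<in> borel_measurable borel"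
      using bump_cont[of "3 * \<tau>"] \<tau> by (intro borel_measurable_continuous_onI) auto
    have ib1: "integrable lborel (?b a)" "(\<integral>z. ?b a z \<partial>lborel) = bump_mass" for a
      using integral_translate_complex[of "bump (3 * \<tau>)" "- \<zeta> a"] integrable_bump[of "3 * \<tau>"] integral_bump[of "3 * \<tau>"] \<tau>
      by simp_all
    have i1: "integrable lborel (\<lambda>z. L z * lap z)"
      using integrable_ln_poly[OF R_pos cont_lap supp_lap p0] by (simp add: L_def)
    have i2: "integrable lborel (\<lambda>z. U (norm z) * lap z)"
      by (rule integrable_cont_supp[OF R_pos])
         (auto intro!: continuous_intros cont_lap continuous_on_compose2[OF U] simp: supp_lap)
    \<comment> \<open>The sub-mean-value inequality is one-sided and cannot handle an absolute
      value. But \<open>L z \<le> u a\<close>, and \<open>u a\<close> differs from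
      \<open>U (norm z)\<close> by at most \<open>2 * e\<close>, so
      \<open>\<bar>L z - U (norm z)\<bar> \<le> u a + 2 * e - L z\<close>, which is affine in
      \<open>L\<close>. This majorant is nonnegative almost everywhere on the support of every bump,
      so the other net points can only enlarge the sum.\<close>
    have key: "AE z in lborel. norm ((L z - U (norm z)) * lap z) \<le>
        C * (\<Sum>a\<in>A. 9 * \<tau>\<^sup>2 * ((u a + 2 * e) * ?b a z - L z * ?b a z))"
      using AE_poly_nonzero[OF p0]
    proof eventually_elim
      fix z assume z: "poly p z \<noteq> 0"
      have nn: "0 \<le> 9 * \<tau>\<^sup>2 * ((u a + 2 * e) * ?b a z - L z * ?b a z)" if a: "a \<in> A" for a
      proof (cases "norm (z - \<zeta> a) > 3 * \<tau>")
        case True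
        then show ?thesis using bump_supp[of "3 * \<tau>"] \<tau> by simp
      next
        case False
        have "norm z \<le> norm a + norm (z - \<zeta> a) + dist a (\<zeta> a)"
          using norm_triangle_ineq[of a "z - a"] norm_triangle_ineq[of "z - \<zeta> a" "\<zeta> a - a"]
          by (simp add: dist_norm norm_minus_commute)
        then have "L z \<le> u a" using \<zeta>(1)[OF a] False a z by (intro Lu) auto
        then have "0 \<le> (u a + 2 * e - L z) * ?b a z" using e by (intro mult_nonneg_nonneg bump_nonneg) auto
        then show ?thesis by (simp flip: left_diff_distrib)
      qed
      show "norm ((L z - U (norm z)) * lap z) \<le> C * (\<Sum>a\<in>A. 9 * \<tau>\<^sup>2 * ((u a + 2 * e) * ?b a z - L z * ?b a z))"
      proof (cases "norm z > R")
        case True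
        then show ?thesis using C nn by (simp add: supp_lap sum_nonneg)
      next
        case False
        then obtain a where a: "a \<in> A" "dist a z < \<tau>" using A(4)[of z] by auto
        have na: "norm a \<le> 2 * R" using A a by auto
        have 1: "\<bar>norm a - norm z\<bar> \<le> \<tau>" using a norm_triangle_ineq3[of a z] by (simp add: dist_norm)
        have Lz: "L z \<le> u a" using 1 \<tau> a z by (intro Lu) auto
        have "\<bar>U (norm a + 4 * \<tau>) - U (norm z)\<bar> \<le> e" using 1 \<tau> na False R_pos by (intro Uc) auto
        then have "\<bar>L z - U (norm z)\<bar> \<le> u a + 2 * e - L z" using Lz unfolding u_def by linarith
        also have "\<dots> = 1 * (u a + 2 * e - L z)" by simp
        also have "\<dots> \<le> 9 * \<tau>\<^sup>2 * ?b a z * (u a + 2 * e - L z)"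
        proof (intro mult_right_mono bump_lower)
          have "norm (z - \<zeta> a) \<le> dist a z + dist a (\<zeta> a)"
            using dist_triangle[of z "\<zeta> a" a] by (simp add: dist_norm norm_minus_commute)
          then show "norm (z - \<zeta> a) \<le> 2 * \<tau>" using a \<zeta>(1)[OF a(1)] by simp
        qed (use \<tau> Lz e in auto)
        also have "\<dots> = 9 * \<tau>\<^sup>2 * ((u a + 2 * e) * ?b a z - L z * ?b a z)" by (simp add: algebra_simps)
        also have "\<dots> \<le> (\<Sum>a\<in>A. 9 * \<tau>\<^sup>2 * ((u a + 2 * e) * ?b a z - L z * ?b a z))"
          using A a nn by (intro member_le_sum) auto
        finally have "\<bar>L z - U (norm z)\<bar> * \<bar>lap z\<bar> \<le> (\<Sum>a\<in>A. 9 * \<tau>\<^sup>2 * ((u a + 2 * e) * ?b a z - L z * ?b a z)) * C"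
          using C by (intro mult_mono) auto
        then show ?thesis by (simp add: abs_mult mult.commute)
      qed
    qed
    have "\<bar>\<integral>z. (L z - U (norm z)) * lap z \<partial>lborel\<bar> \<le> (\<integral>z. norm ((L z - U (norm z)) * lap z) \<partial>lborel)"
      using integral_norm_bound[of lborel "\<lambda>z. (L z - U (norm z)) * lap z"] by simp
    also have "\<dots> \<le> (\<integral>z. C * (\<Sum>a\<in>A. 9 * \<tau>\<^sup>2 * ((u a + 2 * e) * ?b a z - L z * ?b a z)) \<partial>lborel)"
    proof (rule integral_mono_AE[OF _ _ key])
      show "integrable lborel (\<lambda>z. norm ((L z - U (norm z)) * lap z))"
        using i1 i2 by (simp add: left_diff_distrib)
      show "integrable lborel (\<lambda>z. C * (\<Sum>a\<in>A. 9 * \<tau>\<^sup>2 * ((u a + 2 * e) * ?b a z - L z * ?b a z)))"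
        using ib ib1 by (intro integrable_mult_right integrable_sum Bochner_Integration.integrable_diff) auto
    qed
    also have "\<dots> = C * (\<Sum>a\<in>A. 9 * \<tau>\<^sup>2 * ((u a + 2 * e) * bump_mass - (\<integral>z. L z * ?b a z \<partial>lborel)))"
      unfolding integral_mult_right_zero using ib ib1
      by (subst Bochner_Integration.integral_sum) auto
    also have "\<dots> \<le> C * (\<Sum>a\<in>A. 9 * \<tau>\<^sup>2 * (bump_mass * (5 * e)))"
    proof (intro mult_left_mono sum_mono)
      fix a assume a: "a \<in> A"
      have "bump_mass * ln (norm (poly p (\<zeta> a))) \<le> (\<integral>z. ln (norm (poly p z)) * ?b a z \<partial>lborel)"
        using submean_poly[OF _ pz[OF a], of "3 * \<tau>"] \<tau> by simp
      then have "bump_mass * ln (norm (poly p (\<zeta> a))) / d \<le> (\<integral>z. ln (norm (poly p z)) * ?b a z \<partial>lborel) / d"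
        using d by (intro divide_right_mono) auto
      then have "bump_mass * L (\<zeta> a) \<le> (\<integral>z. L z * ?b a z \<partial>lborel)"
        by (simp add: L_def)
      \<comment> \<open>The five errors: two from the majorant, one from the \<open>e\<close> inside
        \<open>u\<close>, one from the continuity of \<open>U\<close>, and one from the lower bound
        at \<open>\<zeta> a\<close>.\<close>
      moreover have "bump_mass * (u a + 2 * e - 5 * e) \<le> bump_mass * L (\<zeta> a)"
      proof (intro mult_left_mono bump_mass_nonneg)
        have na: "norm a \<le> 2 * R" using A a by auto
        have 1: "\<bar>norm a - norm (\<zeta> a)\<bar> \<le> \<tau>" using \<zeta>(1)[OF a] norm_triangle_ineq3[of a "\<zeta> a"] by (simp add: dist_norm)
        have "\<bar>U (norm a + 4 * \<tau>) - U (norm (\<zeta> a))\<bar> \<le> e" using 1 \<tau> na R_pos by (intro Uc) auto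
        then show "u a + 2 * e - 5 * e \<le> L (\<zeta> a)" using L\<zeta>[OF a] unfolding u_def by linarith
      qed
      ultimately show "(u a + 2 * e) * bump_mass - (\<integral>z. L z * ?b a z \<partial>lborel) \<le> bump_mass * (5 * e)"
        by (simp add: algebra_simps)
    qed (use C in auto)
    also have "\<dots> = C * (real (card A) * \<tau>\<^sup>2) * 9 * bump_mass * 5 * e" by simp
    also have "\<dots> \<le> C * (36 * R\<^sup>2) * 9 * bump_mass * 5 * e"
    proof -
      have "real (card A) \<le> 9 * (real m)\<^sup>2" using A(2) of_nat_mono[OF A(2), where 'a=real] by simp
      then have "real (card A) * \<tau>\<^sup>2 \<le> 9 * (real m)\<^sup>2 * \<tau>\<^sup>2" by (intro mult_right_mono) auto
      also have "\<dots> = 36 * R\<^sup>2" using m0 by (simp add: \<tau>_def power_divide power_mult_distrib)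
      finally show ?thesis using C e bump_mass_nonneg by (intro mult_right_mono mult_left_mono) auto
    qed
    also have "\<dots> = K * e" by (simp add: K_def)
    also note Ke
    finally have fin: "\<bar>\<integral>z. (L z - U (norm z)) * lap z \<partial>lborel\<bar> \<le> 2 * pi * \<epsilon>" .
    have "(\<integral>z. (L z - U (norm z)) * lap z \<partial>lborel) = (\<integral>z. L z * lap z \<partial>lborel) - (\<integral>z. U (norm z) * lap z \<partial>lborel)"
      using i1 i2 by (simp add: left_diff_distrib)
    also have "(\<integral>z. L z * lap z \<partial>lborel) = 2 * pi * zero_integral p f / d"
      unfolding zero_integral_eq_ln_integral[OF p0] by (simp add: L_def)
    finally have "\<bar>2 * pi * zero_integral p f / d - (\<integral>z. U (norm z) * lap z \<partial>lborel)\<bar> / (2 * pi) \<le> \<epsilon>"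
      using fin by (simp add: field_simps)
    moreover have "\<bar>2 * pi * zero_integral p f / d - (\<integral>z. U (norm z) * lap z \<partial>lborel)\<bar> / (2 * pi) =
       \<bar>zero_integral p f / d - (\<integral>z. U (norm z) * lap z \<partial>lborel) / (2 * pi)\<bar>"
    proof -
      have "zero_integral p f / d - (\<integral>z. U (norm z) * lap z \<partial>lborel) / (2 * pi) =
         (2 * pi * zero_integral p f / d - (\<integral>z. U (norm z) * lap z \<partial>lborel)) / (2 * pi)"
        by (simp add: diff_divide_distrib)
      then show ?thesis by (simp add: abs_divide)
    qed
    ultimately show "\<bar>zero_integral p f / degree p - (\<integral>z. U (norm z) * lap z \<partial>lborel) / (2 * pi)\<bar> \<le> \<epsilon>"
      unfolding d_def by simp
  qed
qed

end

section \<open>The maximum principle on arcs\<close>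

lemma sphere_max_ge_center:
  assumes h: "F holomorphic_on UNIV" and s: "s > 0"
  obtains z where "norm z = s" "norm (F 0) \<le> norm (F z :: complex)"
proof -
  have c: "continuous_on A F" for A using h holomorphic_on_imp_continuous_on continuous_on_subset by blast
  have "compact (sphere (0::complex) s)" "sphere (0::complex) s \<noteq> {}" using s by auto
  moreover have "continuous_on (sphere 0 s) (\<lambda>z. norm (F z))" by (intro continuous_intros c)
  ultimately obtain z where z: "z \<in> sphere 0 s" "\<forall>y\<in>sphere 0 s. norm (F y) \<le> norm (F z)"
    using continuous_attains_sup[of "sphere 0 s" "\<lambda>z. norm (F z)"] by blast
  have "norm (F 0) \<le> norm (F z)"
  proof (rule maximum_modulus_frontier[of F "cball 0 s"])
    show "F holomorphic_on interior (cball 0 s)" using h holomorphic_on_subset by blast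
    show "continuous_on (closure (cball 0 s)) F" by (rule c)
    show "norm (F y) \<le> norm (F z)" if "y \<in> frontier (cball 0 s)" for y
      using z(2) that by auto
  qed (use s in auto)
  then show ?thesis using z that by auto
qed

lemma rotation_near:
  fixes \<alpha> \<beta> :: real
  assumes m: "m > 0"
  shows "\<exists>k::int. \<bar>\<beta> + 2 * pi * of_int k / real m - \<alpha>\<bar> \<le> pi / real m"
proof -
  define k :: int where "k = round ((\<alpha> - \<beta>) * m / (2 * pi))"
  have "\<bar>of_int k - (\<alpha> - \<beta>) * m / (2 * pi)\<bar> \<le> 1 / 2" unfolding k_def by (rule of_int_round_abs_le)
  then have "2 * pi / m * \<bar>of_int k - (\<alpha> - \<beta>) * m / (2 * pi)\<bar> \<le> 2 * pi / m * (1 / 2)"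
    using m by (intro mult_left_mono) auto
  also have "2 * pi / m * \<bar>of_int k - (\<alpha> - \<beta>) * m / (2 * pi)\<bar> = \<bar>2 * pi / m * (of_int k - (\<alpha> - \<beta>) * m / (2 * pi))\<bar>"
    by (simp add: abs_mult)
  also have "2 * pi / m * (of_int k - (\<alpha> - \<beta>) * m / (2 * pi)) = \<beta> + 2 * pi * of_int k / real m - \<alpha>"
    using m by (simp add: field_simps)
  finally show ?thesis by auto
qed

text \<open>Multiplying \<open>p\<close> by its rotations through the \<open>m\<close>-th roots of unity spreads any arc of length
  \<open>2\<pi>/m\<close> over the whole circle, so the maximum principle sees that arc.\<close>

lemma arc_point_inner:
  fixes p :: "complex poly"
  assumes s: "s > 0" and m: "m > 0" and B: "\<And>z. norm z = s \<Longrightarrow> norm (poly p z) \<le> B"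
  obtains \<theta> where "\<bar>\<theta> - \<alpha>\<bar> \<le> pi / real m"
    "norm (poly p 0) ^ m \<le> norm (poly p (of_real s * cis \<theta>)) * B ^ (m - 1)"
proof -
  define F where "F z = (\<Prod>j<m. poly p (cis (2 * pi * real j / m) * z))" for z
  have h: "F holomorphic_on UNIV" unfolding F_def by (intro holomorphic_intros)
  obtain z where z: "norm z = s" "norm (F 0) \<le> norm (F z)"
    using sphere_max_ge_center[OF h s] by blast
  define \<beta> where "\<beta> = Arg z"
  have z_eq: "z = of_real s * cis \<beta>" using rcis_cmod_Arg[of z] z(1) by (simp add: \<beta>_def rcis_def)
  obtain k :: int where k: "\<bar>\<beta> + 2 * pi * of_int k / real m - \<alpha>\<bar> \<le> pi / real m"
    using rotation_near[OF m] by blast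
  define \<theta> where "\<theta> = \<beta> + 2 * pi * of_int k / m"
  have th: "\<bar>\<theta> - \<alpha>\<bar> \<le> pi / m" using k by (simp add: \<theta>_def)
  define j where "j = nat (k mod int m)"
  have j: "j < m" using m by (simp add: j_def nat_less_iff)
  have "k = int m * (k div int m) + int j" using m by (simp add: j_def)
  then have "real_of_int k = real m * real_of_int (k div int m) + real j"
    by (metis of_int_add of_int_mult of_int_of_nat_eq)
  then have "\<theta> = \<beta> + 2 * pi * real j / m + 2 * pi * of_int (k div int m)"
    using m unfolding \<theta>_def by (simp add: field_simps)
  then have "cis \<theta> = cis (\<beta> + 2 * pi * real j / m) * cis (2 * pi * of_int (k div int m))"
    by (simp only: cis_mult)
  also have "cis (2 * pi * of_int (k div int m)) = 1" by (rule cis_multiple_2pi) auto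
  finally have cth: "cis \<theta> = cis (2 * pi * real j / m) * cis \<beta>" by (simp add: cis_mult add.commute)
  have "norm (poly p 0) ^ m = norm (F 0)" by (simp add: F_def norm_power)
  also have "\<dots> \<le> norm (F z)" by (rule z)
  \<comment> \<open>The rotation \<open>j\<close> carries the maximising point \<open>z\<close> into
    the prescribed arc; the remaining \<open>m - 1\<close> factors are values on the same circle,
    bounded by \<open>B\<close>.\<close>
  also have "\<dots> = norm (poly p (cis (2 * pi * real j / m) * z)) * (\<Prod>i\<in>{..<m}-{j}. norm (poly p (cis (2 * pi * real i / m) * z)))"
    unfolding F_def prod_norm[symmetric] using j by (subst prod.remove[of _ j]) auto
  also have "\<dots> \<le> norm (poly p (cis (2 * pi * real j / m) * z)) * (\<Prod>i\<in>{..<m}-{j}. B)"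
    using z(1) by (intro mult_left_mono prod_mono conjI B) (auto simp: norm_mult)
  also have "\<dots> = norm (poly p (of_real s * cis \<theta>)) * B ^ (m - 1)"
    using j by (simp add: cth z_eq mult_ac)
  finally show ?thesis using th that by blast
qed

text \<open>The inner version is applied to the reciprocal polynomial, whose value at 0 is the
  leading coefficient of \<open>p\<close>, on the circle of radius \<open>1 / s\<close>. Inversion
  reverses arguments, hence \<open>-\<alpha>\<close> and \<open>-\<theta>\<close>.\<close>

lemma arc_point_outer:
  fixes p :: "complex poly"
  assumes s: "s > 0" and m: "m > 0" and B: "\<And>z. norm z = s \<Longrightarrow> norm (poly p z) \<le> B"
  obtains \<theta> where "\<bar>\<theta> - \<alpha>\<bar> \<le> pi / real m"
    "(norm (lead_coeff p) * s ^ degree p) ^ m \<le> norm (poly p (of_real s * cis \<theta>)) * B ^ (m - 1)"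
proof -
  define q where "q = reflect_poly p"
  define d where "d = degree p"
  have q: "norm (poly q x) = norm (poly p (inverse x)) / s ^ d" if "norm x = inverse s" for x
  proof -
    have "x \<noteq> 0" using that s by auto
    then show ?thesis using that by (simp add: q_def d_def poly_reflect_poly_nz norm_mult norm_power power_inverse field_simps)
  qed
  have Bq: "norm (poly q x) \<le> B / s ^ d" if "norm x = inverse s" for x
  proof -
    have "norm (inverse x) = s" using that s by (simp add: norm_inverse)
    then show ?thesis using q[OF that] B s by (auto intro!: divide_right_mono)
  qed
  have "inverse s > 0" using s by simp
  from arc_point_inner[OF this m Bq, of "-\<alpha>"] obtain \<theta> where
    \<theta>: "\<bar>\<theta> - (-\<alpha>)\<bar> \<le> pi / m" "norm (poly q 0) ^ m \<le> norm (poly q (of_real (inverse s) * cis \<theta>)) * (B / s ^ d) ^ (m - 1)"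
    by blast
  have x: "inverse (of_real (inverse s) * cis \<theta>) = of_real s * cis (-\<theta>)" using s by (simp add: cis_inverse)
  have "norm (poly q (of_real (inverse s) * cis \<theta>)) = norm (poly p (of_real s * cis (-\<theta>))) / s ^ d"
    using q[of "of_real (inverse s) * cis \<theta>"] s unfolding x by (simp add: norm_mult norm_inverse)
  with \<theta>(2) have "norm (lead_coeff p) ^ m \<le> norm (poly p (of_real s * cis (-\<theta>))) / s ^ d * (B / s ^ d) ^ (m - 1)"
    by (simp add: q_def)
  also have "\<dots> = norm (poly p (of_real s * cis (-\<theta>))) * B ^ (m - 1) / (s ^ d) ^ m"
    using m by (cases m) (auto simp: power_divide)
  finally have "(norm (lead_coeff p) * s ^ d) ^ m \<le> norm (poly p (of_real s * cis (-\<theta>))) * B ^ (m - 1)"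
    using s by (simp add: field_simps power_mult_distrib)
  moreover have "\<bar>-\<theta> - \<alpha>\<bar> \<le> pi / m" using \<theta>(1) by linarith
  ultimately show ?thesis using that[of "-\<theta>"] by (simp add: d_def)
qed

section \<open>Counting zeros outside a disc\<close>

lemma sum_order_eq_degree:
  fixes p :: "complex poly"
  assumes p: "p \<noteq> 0"
  shows "(\<Sum>w | poly p w = 0. order w p) = degree p"
proof -
  let ?Z = "{w. poly p w = 0}"
  have dec: "smult (lead_coeff p) (\<Prod>w\<in>?Z. [:- w, 1:] ^ order w p) = p" by (rule complex_poly_decompose)
  have "degree p = degree (\<Prod>w\<in>?Z. [:- w, 1:] ^ order w p)"
    using p by (subst dec[symmetric]) simp
  also have "\<dots> = (\<Sum>w\<in>?Z. order w p)"
    by (subst degree_prod_eq_sum_degree) (auto simp: degree_linear_power)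
  finally show ?thesis by simp
qed

text \<open>Each factor \<open>z - w\<close> with \<open>norm w > s\<close> is exchanged for the
  linear factor \<open>s - cnj w * z / s\<close>, which has the same modulus on the circle of radius
  \<open>s\<close> and leading coefficient of modulus \<open>norm w / s\<close>. The degree is
  unchanged, the bound \<open>B\<close> on the circle persists, and the product over the outer zeros
  moves into the leading coefficient. The case \<open>m = 1\<close> of
  \<open>arc_point_outer\<close> then is the plain maximum principle at infinity.\<close>

lemma jensen_outer:
  fixes p :: "complex poly"
  assumes p: "p \<noteq> 0" and s: "s > 0" and B: "\<And>z. norm z = s \<Longrightarrow> norm (poly p z) \<le> B"
  shows "norm (lead_coeff p) * s ^ degree p * (\<Prod>w | poly p w = 0 \<and> norm w > s. (norm w / s) ^ order w p) \<le> B"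
proof -
  let ?Z = "{w. poly p w = 0}"
  have fin: "finite ?Z" using p by (rule poly_roots_finite)
  define fac where "fac w = (if norm w > s then [:of_real s, - cnj w / of_real s:] else [:- w, 1:])" for w
  define g where "g = smult (lead_coeff p) (\<Prod>w\<in>?Z. fac w ^ order w p)"
  have fac0: "fac w \<noteq> 0" for w using s by (auto simp: fac_def)
  have degf: "degree (fac w) = 1" for w using s by (auto simp: fac_def)
  have leadf: "norm (lead_coeff (fac w)) = (if norm w > s then norm w / s else 1)" for w
    using s by (auto simp: fac_def norm_divide)
  have dec: "smult (lead_coeff p) (\<Prod>w\<in>?Z. [:- w, 1:] ^ order w p) = p" by (rule complex_poly_decompose)
  have degp: "degree p = (\<Sum>w\<in>?Z. order w p)" using sum_order_eq_degree[OF p] by simp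
  have degg: "degree g = degree p"
  proof -
    have "degree g = (\<Sum>w\<in>?Z. order w p)"
      using p unfolding g_def by (simp add: degree_prod_eq_sum_degree fac0 degree_power_eq degf)
    then show ?thesis using degp by simp
  qed
  have leadg: "norm (lead_coeff g) = norm (lead_coeff p) * (\<Prod>w\<in>?Z. (if norm w > s then norm w / s else 1) ^ order w p)"
    by (simp add: g_def lead_coeff_smult lead_coeff_prod lead_coeff_power norm_mult prod_norm[symmetric] norm_power leadf)
  have "(\<Prod>w\<in>?Z. (if norm w > s then norm w / s else 1) ^ order w p) = (\<Prod>w | poly p w = 0 \<and> norm w > s. (norm w / s) ^ order w p)"
    using fin by (intro prod.mono_neutral_cong_right) auto
  note leadg = leadg[unfolded this]
  have gB: "norm (poly g z) \<le> B" if z: "norm z = s" for z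
  proof -
    have "norm (poly (fac w) z) = norm (z - w)" for w
    proof (cases "norm w > s")
      case True
      have zz: "z * cnj z = of_real s * of_real s" using z complex_norm_square[of z] by (simp add: power2_eq_square)
      have "of_real s * poly (fac w) z = z * cnj (z - w)"
        using True s zz by (simp add: fac_def field_simps)
      then have "s * norm (poly (fac w) z) = s * norm (z - w)"
        using z s by (metis complex_mod_cnj norm_mult norm_of_real abs_of_pos)
      then show ?thesis using s by simp
    qed (simp add: fac_def)
    then have "norm (poly g z) = norm (poly (smult (lead_coeff p) (\<Prod>w\<in>?Z. [:- w, 1:] ^ order w p)) z)"
      by (simp add: g_def poly_prod norm_mult prod_norm[symmetric] norm_power)
    then show ?thesis using B[OF z] unfolding dec by simp
  qed
  have "(0::nat) < 1" by simp
  from arc_point_outer[OF s this gB, of 0] obtain \<theta> where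
    "(norm (lead_coeff g) * s ^ degree g) ^ 1 \<le> norm (poly g (of_real s * cis \<theta>)) * B ^ (1 - 1)" by blast
  also have "\<dots> \<le> B" using gB[of "of_real s * cis \<theta>"] s by (simp add: norm_mult)
  finally have "norm (lead_coeff g) * s ^ degree g \<le> B" by simp
  then show ?thesis by (simp only: leadg) (simp add: degg mult_ac)
qed

text \<open>A zero beyond \<open>2 * s\<close> contributes a factor of at least 2 to the preceding
  product. If the maximum on the circle and the leading term agree up to a factor
  \<open>exp (\<epsilon> * D)\<close>, only a small fraction of the zeros lies that far out.\<close>

lemma zeros_outside_le:
  fixes p :: "complex poly"
  assumes p: "p \<noteq> 0" and s: "s > 0" and B: "\<And>z. norm z = s \<Longrightarrow> norm (poly p z) \<le> B"
  shows "real (\<Sum>w | poly p w = 0 \<and> norm w > 2 * s. order w p) * ln 2 \<le> ln B - ln (norm (lead_coeff p) * s ^ degree p)"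
proof -
  let ?S = "{w. poly p w = 0 \<and> norm w > s}" and ?T = "{w. poly p w = 0 \<and> norm w > 2 * s}"
  have fin: "finite ?S" by (rule finite_subset[OF _ poly_roots_finite[OF p]]) auto
  have sub: "?T \<subseteq> ?S" using s by auto
  have "2 ^ (\<Sum>w\<in>?T. order w p) = (\<Prod>w\<in>?T. 2 ^ order w p :: real)" by (simp add: power_sum)
  also have "\<dots> \<le> (\<Prod>w\<in>?T. (norm w / s) ^ order w p)"
    using s by (intro prod_mono conjI power_mono) (auto simp: field_simps)
  also have "\<dots> \<le> (\<Prod>w\<in>?S. (norm w / s) ^ order w p)"
    using s fin sub by (intro prod_mono2) (auto intro!: one_le_power simp: le_divide_eq)
  finally have le: "2 ^ (\<Sum>w\<in>?T. order w p) \<le> (\<Prod>w\<in>?S. (norm w / s) ^ order w p)" .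
  have pos: "norm (lead_coeff p) * s ^ degree p > 0" using p s by simp
  have "norm (lead_coeff p) * s ^ degree p * 2 ^ (\<Sum>w\<in>?T. order w p) \<le>
      norm (lead_coeff p) * s ^ degree p * (\<Prod>w\<in>?S. (norm w / s) ^ order w p)"
    using le pos by (intro mult_left_mono) auto
  also have "\<dots> \<le> B" by (rule jensen_outer[OF assms])
  finally have "ln (norm (lead_coeff p) * s ^ degree p * 2 ^ (\<Sum>w\<in>?T. order w p)) \<le> ln B"
    using pos by (intro ln_mono) auto
  moreover have "ln (norm (lead_coeff p) * s ^ degree p * 2 ^ (\<Sum>w\<in>?T. order w p)) =
      ln (norm (lead_coeff p) * s ^ degree p) + real (\<Sum>w\<in>?T. order w p) * ln 2"
    by (subst ln_mult_pos[OF pos]) (auto simp: ln_realpow)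
  ultimately show ?thesis by linarith
qed

section \<open>Negative binomial weights\<close>

text \<open>After multiplication by \<open>1 - r\<close> this is the negative binomial distribution,
  the number of failures of probability \<open>r\<close> before success number \<open>N + 1\<close>.
  The normalisation by \<open>(1 - r) ^ N\<close> puts the largest weight between
  \<open>1 / (2 * nb_mode N r + 3)\<close> and 1, so \<open>(1 - r) ^ N\<close> alone carries the
  exponential rate.\<close>

definition nbw :: "nat \<Rightarrow> real \<Rightarrow> nat \<Rightarrow> real" where
  "nbw N r k = real ((N + k) choose k) * r ^ k * (1 - r) ^ N"

text \<open>The real index at which the ratio of consecutive weights passes through 1; its integer
  part is a mode.\<close>

definition nb_mode :: "nat \<Rightarrow> real \<Rightarrow> real" where
  "nb_mode N r = r * real N / (1 - r)"

lemma nbw_nonneg: "0 \<le> r \<Longrightarrow> r \<le> 1 \<Longrightarrow> nbw N r k \<ge> 0"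
  by (simp add: nbw_def)

lemma nbw_pos: "0 < r \<Longrightarrow> r < 1 \<Longrightarrow> nbw N r k > 0"
  by (simp add: nbw_def)

text \<open>The weight is a single term of the binomial expansion of
  \<open>(r + (1 - r)) ^ (N + k)\<close>.\<close>

lemma nbw_le_1:
  assumes "0 \<le> r" "r \<le> 1"
  shows "nbw N r k \<le> 1"
proof -
  have "nbw N r k = real ((N + k) choose k) * r ^ k * (1 - r) ^ (N + k - k)" by (simp add: nbw_def)
  also have "\<dots> \<le> (\<Sum>j\<le>N + k. real ((N + k) choose j) * r ^ j * (1 - r) ^ (N + k - j))"
    using assms by (intro member_le_sum[of k]) auto
  also have "\<dots> = (r + (1 - r)) ^ (N + k)" by (subst binomial_ring) simp
  finally show ?thesis by simp
qed

text \<open>The ratio is arranged so that its deviation from 1 has the sign of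
  \<open>nb_mode N r - (k + 1)\<close> and is visibly small near the mode.\<close>

lemma nbw_Suc:
  assumes "r < 1"
  shows "nbw N r (Suc k) = nbw N r k * (1 + (1 - r) * (nb_mode N r / real (Suc k) - 1))"
proof -
  have "Suc k * ((N + Suc k) choose (Suc k)) = (N + Suc k) * ((N + k) choose k)"
    using Suc_times_binomial_eq[of "N + k" k] by (simp add: mult.commute)
  then have "real (Suc k) * real ((N + Suc k) choose (Suc k)) = real (N + Suc k) * real ((N + k) choose k)"
    by (metis of_nat_mult)
  then have "real ((N + Suc k) choose (Suc k)) = real (N + Suc k) / real (Suc k) * real ((N + k) choose k)"
    by (simp add: field_simps del: of_nat_Suc binomial_Suc_Suc)
  then have "nbw N r (Suc k) = nbw N r k * (r * real (N + Suc k) / real (Suc k))"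
    by (simp add: nbw_def del: binomial_Suc_Suc of_nat_Suc)
  also have "r * real (N + Suc k) / real (Suc k) = 1 + (1 - r) * (nb_mode N r / real (Suc k) - 1)"
  proof -
    have "(1 - r) * nb_mode N r = r * real N" using assms by (simp add: nb_mode_def)
    then have "(1 - r) * (nb_mode N r / real (Suc k) - 1) = r * real N / real (Suc k) - (1 - r)"
      by (simp add: right_diff_distrib del: of_nat_Suc)
    moreover have "r * real (N + Suc k) / real (Suc k) = r * real N / real (Suc k) + r"
      by (simp only: of_nat_add distrib_left add_divide_distrib) simp
    ultimately show ?thesis by simp
  qed
  finally show ?thesis .
qed

lemma nb_mode_nonneg: "0 \<le> r \<Longrightarrow> r < 1 \<Longrightarrow> nb_mode N r \<ge> 0"
  by (simp add: nb_mode_def)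

lemma nbw_mode_max:
  assumes r: "0 \<le> r" "r < 1"
  shows "nbw N r k \<le> nbw N r (nat \<lfloor>nb_mode N r\<rfloor>)"
proof -
  let ?m = "nat \<lfloor>nb_mode N r\<rfloor>"
  note k0 = nb_mode_nonneg[OF r, of N]
  have up: "nbw N r k \<le> nbw N r (Suc k)" if "Suc k \<le> ?m" for k
  proof -
    have "real (Suc k) \<le> nb_mode N r" using that k0 by linarith
    then have "(1 - r) * (nb_mode N r / real (Suc k) - 1) \<ge> 0" using r by (intro mult_nonneg_nonneg) (auto simp: field_simps)
    then have "nbw N r k * 1 \<le> nbw N r k * (1 + (1 - r) * (nb_mode N r / real (Suc k) - 1))"
      using nbw_nonneg[of r N k] r by (intro mult_left_mono) auto
    then show ?thesis using nbw_Suc[OF r(2)] by simp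
  qed
  have down: "nbw N r (Suc k) \<le> nbw N r k" if "k \<ge> ?m" for k
  proof -
    have "nb_mode N r \<le> real (Suc k)" using that k0 by linarith
    then have "(1 - r) * (nb_mode N r / real (Suc k) - 1) \<le> 0" using r by (intro mult_nonneg_nonpos) (auto simp: field_simps)
    then have "nbw N r k * (1 + (1 - r) * (nb_mode N r / real (Suc k) - 1)) \<le> nbw N r k * 1"
      using nbw_nonneg[of r N k] r by (intro mult_left_mono) auto
    then show ?thesis using nbw_Suc[OF r(2)] by simp
  qed
  show ?thesis
  proof (cases "k \<le> ?m")
    case True
    then show ?thesis 
    proof (induction rule: inc_induct)
      case (step k)
      then show ?case using up[of k] by linarith
    qed simp
  next
    case False
    then have "?m \<le> k" by simp
    then show ?thesis 
    proof (induction rule: dec_induct)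
      case (step k)
      then show ?case using down[of k] by linarith
    qed simp
  qed
qed

lemma nbw_sums:
  assumes r: "0 \<le> r" "r < 1"
  shows "nbw N r sums (1 / (1 - r))"
proof -
  have "(\<lambda>k. ((- real (Suc N)) gchoose k) * (- r) ^ k) sums (1 + (- r)) powr (- real (Suc N))"
    by (rule gen_binomial_real) (use r in auto)
  moreover have "((- real (Suc N)) gchoose k) * (- r) ^ k = real ((N + k) choose k) * r ^ k" for k
  proof -
    have "(- real (Suc N)) gchoose k = (-1) ^ k * ((real (Suc N) + real k - 1) gchoose k)"
      by (rule gbinomial_minus)
    also have "real (Suc N) + real k - 1 = real (N + k)" by simp
    also have "real (N + k) gchoose k = real ((N + k) choose k)" by (simp add: binomial_gbinomial)
    finally show ?thesis by (simp add: power_mult_distrib[symmetric] mult_ac flip: power_mult_distrib)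
  qed
  ultimately have "(\<lambda>k. real ((N + k) choose k) * r ^ k) sums (1 - r) powr (- real (Suc N))" by simp
  then have "(\<lambda>k. real ((N + k) choose k) * r ^ k * (1 - r) ^ N) sums ((1 - r) powr (- real (Suc N)) * (1 - r) ^ N)"
    by (rule sums_mult2)
  also have "(1 - r) powr (- real (Suc N)) * (1 - r) ^ N = 1 / (1 - r)"
    using r by (simp add: powr_minus powr_realpow field_simps del: of_nat_Suc)
  finally show ?thesis unfolding nbw_def .
qed

text \<open>The total mass is \<open>1 / (1 - r)\<close>. Beyond twice the mode each weight is at
  most \<open>q = (1 + r) / 2\<close> times its predecessor, so the tail is at most
  \<open>2 / (1 - r)\<close> times the largest weight; the earlier weights number at most
  \<open>2 * nb_mode N r + 1\<close>. Multiplying by \<open>1 - r\<close> gives a bound whose only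
  dependence on \<open>r\<close> is through the mode.\<close>

lemma nbw_mode_lower:
  assumes r: "0 \<le> r" "r < 1"
  shows "1 \<le> nbw N r (nat \<lfloor>nb_mode N r\<rfloor>) * (2 * nb_mode N r + 3)"
proof -
  let ?w = "nbw N r (nat \<lfloor>nb_mode N r\<rfloor>)"
  note k0 = nb_mode_nonneg[OF r, of N]
  define T where "T = nat \<lceil>2 * nb_mode N r\<rceil>"
  have T: "2 * nb_mode N r \<le> T" "T \<le> 2 * nb_mode N r + 1" using k0 unfolding T_def by linarith+
  define q where "q = (1 + r) / 2"
  have q: "0 \<le> q" "q < 1" using r by (auto simp: q_def)
  have w0: "?w \<ge> 0" using r by (intro nbw_nonneg) auto
  have geo: "nbw N r (j + T) \<le> ?w * q ^ j" for j
  proof (induction j)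
    case 0 then show ?case using nbw_mode_max[OF r] by simp
  next
    case (Suc j)
    have "nb_mode N r / real (Suc (j + T)) \<le> 1 / 2" using T by (simp add: field_simps)
    then have "nb_mode N r / real (Suc (j + T)) - 1 \<le> - 1 / 2" by linarith
    then have "(1 - r) * (nb_mode N r / real (Suc (j + T)) - 1) \<le> (1 - r) * (- 1 / 2)"
      using r(2) by (intro mult_left_mono) (assumption, linarith)
    then have "1 + (1 - r) * (nb_mode N r / real (Suc (j + T)) - 1) \<le> q" by (simp add: q_def field_simps)
    then have "nbw N r (Suc (j + T)) \<le> nbw N r (j + T) * q"
      unfolding nbw_Suc[OF r(2), of N "j + T"] using nbw_nonneg[of r N "j + T"] r by (intro mult_left_mono) auto
    also have "\<dots> \<le> ?w * q ^ j * q" using Suc q by (intro mult_right_mono) auto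
    finally show ?case by (simp add: mult_ac)
  qed
  have s: "summable (nbw N r)" "suminf (nbw N r) = 1 / (1 - r)"
    using nbw_sums[OF r, of N] by (auto simp: sums_iff)
  have sq: "summable (\<lambda>j. ?w * q ^ j)" "(\<Sum>j. ?w * q ^ j) = ?w / (1 - q)"
    using q by (auto simp: summable_mult summable_geometric suminf_mult suminf_geometric)
  have "1 / (1 - r) = (\<Sum>j. nbw N r (j + T)) + (\<Sum>k<T. nbw N r k)"
    using suminf_split_initial_segment[OF s(1), of T] s(2) by simp
  also have "\<dots> \<le> ?w / (1 - q) + real T * ?w"
  proof (intro add_mono)
    show "(\<Sum>j. nbw N r (j + T)) \<le> ?w / (1 - q)"
      unfolding sq(2)[symmetric] using s sq geo by (intro suminf_le) (auto simp: summable_iff_shift)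
    show "(\<Sum>k<T. nbw N r k) \<le> real T * ?w"
      using sum_bounded_above[of "{..<T}" "nbw N r" ?w] nbw_mode_max[OF r] by simp
  qed
  finally have "(1 - r) * (1 / (1 - r)) \<le> (1 - r) * (?w / (1 - q) + real T * ?w)"
    using r by (intro mult_left_mono) auto
  also have "\<dots> = ?w * (2 + (1 - r) * T)" using r by (simp add: q_def field_simps)
  also have "\<dots> \<le> ?w * (2 + 1 * real T)"
  proof -
    have "(1 - r) * real T \<le> 1 * real T" by (rule mult_right_mono) (use r in auto)
    then show ?thesis by (intro mult_left_mono add_left_mono w0)
  qed
  also have "\<dots> \<le> ?w * (2 * nb_mode N r + 3)" using w0 T by (intro mult_left_mono) auto
  finally show ?thesis using r by simp
qed

text \<open>At distance \<open>j\<close> past the mode one step changes the weight by a relative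
  amount of at most \<open>(j + 1) / nb_mode\<close>, which tends to 0, and only a fixed number of
  steps is taken. The radius \<open>r n\<close> may vary with \<open>n\<close>, even tend to 0, as
  long as the mode tends to infinity.\<close>

lemma nbw_near_mode:
  assumes r: "\<forall>\<^sub>F n in sequentially. 0 < r n \<and> r n < 1" and lim: "filterlim (\<lambda>n. nb_mode (N n) (r n)) at_top sequentially"
  shows "(\<lambda>n. nbw (N n) (r n) (nat \<lfloor>nb_mode (N n) (r n)\<rfloor> + j) / nbw (N n) (r n) (nat \<lfloor>nb_mode (N n) (r n)\<rfloor>)) \<longlonglongrightarrow> 1"
proof (induction j)
  case 0
  from r have "\<forall>\<^sub>F n in sequentially. nbw (N n) (r n) (nat \<lfloor>nb_mode (N n) (r n)\<rfloor> + 0) / nbw (N n) (r n) (nat \<lfloor>nb_mode (N n) (r n)\<rfloor>) = 1"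
  proof eventually_elim
    fix n assume "0 < r n \<and> r n < 1"
    then have "nbw (N n) (r n) (nat \<lfloor>nb_mode (N n) (r n)\<rfloor>) > 0" by (intro nbw_pos) auto
    then show "nbw (N n) (r n) (nat \<lfloor>nb_mode (N n) (r n)\<rfloor> + 0) / nbw (N n) (r n) (nat \<lfloor>nb_mode (N n) (r n)\<rfloor>) = 1"
      by simp
  qed
  then show ?case by (rule tendsto_eventually)
next
  case (Suc j)
  let ?k = "\<lambda>n. nat \<lfloor>nb_mode (N n) (r n)\<rfloor>"
  let ?c = "\<lambda>n. (1 - r n) * (nb_mode (N n) (r n) / real (Suc (?k n + j)) - 1)"
  have c0: "?c \<longlonglongrightarrow> 0"
  proof (rule Lim_null_comparison)
    have "\<forall>\<^sub>F n in sequentially. nb_mode (N n) (r n) \<ge> 1" using lim by (simp add: filterlim_at_top)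
    with r show "\<forall>\<^sub>F n in sequentially. norm (?c n) \<le> real (Suc j) / nb_mode (N n) (r n)"
    proof eventually_elim
      fix n assume rn: "0 < r n \<and> r n < 1" and n: "nb_mode (N n) (r n) \<ge> 1"
      define \<kappa> where "\<kappa> = nb_mode (N n) (r n)"
      have k: "real (?k n) \<le> \<kappa>" "\<kappa> < real (?k n) + 1" using n unfolding \<kappa>_def by linarith+
      have "\<bar>\<kappa> / real (Suc (?k n + j)) - 1\<bar> = \<bar>\<kappa> - real (Suc (?k n + j))\<bar> / real (Suc (?k n + j))"
        by (simp add: field_simps abs_divide[symmetric] del: of_nat_Suc)
      also have "\<dots> \<le> real (Suc j) / real (Suc (?k n + j))"
        using k by (intro divide_right_mono) auto
      also have "\<dots> \<le> real (Suc j) / \<kappa>"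
        by (intro divide_left_mono mult_pos_pos) (use k n[folded \<kappa>_def] in linarith)+
      finally have 1: "\<bar>\<kappa> / real (Suc (?k n + j)) - 1\<bar> \<le> real (Suc j) / \<kappa>" .
      have "norm (?c n) \<le> 1 * \<bar>\<kappa> / real (Suc (?k n + j)) - 1\<bar>"
        unfolding \<kappa>_def[symmetric] real_norm_def abs_mult using rn by (intro mult_right_mono) auto
      then show "norm (?c n) \<le> real (Suc j) / nb_mode (N n) (r n)" using 1 unfolding \<kappa>_def by simp
    qed
    show "(\<lambda>n. real (Suc j) / nb_mode (N n) (r n)) \<longlonglongrightarrow> 0"
      by (rule real_tendsto_divide_at_top[OF tendsto_const lim])
  qed
  have "(\<lambda>n. nbw (N n) (r n) (?k n + j) / nbw (N n) (r n) (?k n) * (1 + ?c n)) \<longlonglongrightarrow> 1 * (1 + 0)"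
    by (intro tendsto_intros Suc c0)
  then have "(\<lambda>n. nbw (N n) (r n) (?k n + j) / nbw (N n) (r n) (?k n) * (1 + ?c n)) \<longlonglongrightarrow> 1" by simp
  moreover from r have "\<forall>\<^sub>F n in sequentially. nbw (N n) (r n) (?k n + j) / nbw (N n) (r n) (?k n) * (1 + ?c n) =
      nbw (N n) (r n) (?k n + Suc j) / nbw (N n) (r n) (?k n)"
    by eventually_elim (simp add: nbw_Suc mult_ac)
  ultimately show ?case by (rule Lim_transform_eventually)
qed

section \<open>Potentials of rotation invariant measures\<close>

lemma zero_integral_root_of_power:
  assumes w: "w \<noteq> 0" and m: "m > 0"
  shows "zero_integral (monom 1 m - [:w ^ m:]) f = (\<Sum>j<m. f (cis (2 * pi * real j / real m) * w))"
proof -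
  let ?p = "monom 1 m - [:w ^ m:] :: complex poly"
  have roots: "{z. poly ?p z = 0} = (\<lambda>z. z * w) ` {z. z ^ m = 1}"
  proof (intro equalityI subsetI)
    fix z assume "z \<in> {z. poly ?p z = 0}"
    then have "z ^ m = w ^ m" by (simp add: poly_monom)
    then show "z \<in> (\<lambda>z. z * w) ` {z. z ^ m = 1}"
      using w by (intro image_eqI[of _ _ "z / w"]) (auto simp: power_divide)
  qed (auto simp: poly_monom power_mult_distrib)
  have ord: "order z ?p = 1" if "poly ?p z = 0" for z
  proof -
    have "z ^ m = w ^ m" using that by (simp add: poly_monom)
    then have z: "z \<noteq> 0" using w m by (metis power_eq_0_iff)
    have "coeff ?p m = 1" using m by (cases m) auto
    then have p0: "?p \<noteq> 0" by (metis coeff_0 zero_neq_one)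
    have "poly (pderiv ?p) z \<noteq> 0" using z m by (simp add: pderiv_diff pderiv_monom poly_monom pderiv_pCons)
    then have "order z (pderiv ?p) = 0" by (rule order_0I)
    then show ?thesis using order_pderiv[OF p0 that] by simp
  qed
  have inj: "inj_on (\<lambda>z. z * w) {z. z ^ m = 1}" using w by (auto simp: inj_on_def)
  have "zero_integral ?p f = (\<Sum>z | poly ?p z = 0. f z)"
    unfolding zero_integral_def by (intro sum.cong) (auto simp: ord)
  also have "\<dots> = (\<Sum>z | z ^ m = 1. f (z * w))"
    unfolding roots by (subst sum.reindex[OF inj]) simp
  also have "\<dots> = (\<Sum>j<m. f (cis (2 * pi * real j / real m) * w))"
    by (rule sum.reindex_bij_betw[OF Complex.bij_betw_roots_unity[OF m], symmetric])
  finally show ?thesis .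
qed

text \<open>Moves a point off a circle on which the estimates degenerate, or off the origin when
  \<open>t = 0\<close>.\<close>

lemma exists_in_ball_norm_neq:
  fixes a :: complex assumes "\<tau> > 0" shows "\<exists>z\<in>ball a \<tau>. norm z \<noteq> t"
proof (cases "norm a = t")
  case True
  show ?thesis
  proof (cases "a = 0")
    case True
    then show ?thesis using assms \<open>norm a = t\<close> by (intro bexI[of _ "of_real (\<tau> / 2)"]) auto
  next
    case False
    define c where "c = 1 + \<tau> / (2 * norm a)"
    have "dist a (of_real c * a) = \<tau> / 2"
    proof -
      have "a - of_real c * a = - (of_real (\<tau> / (2 * norm a)) * a)" by (simp add: c_def algebra_simps)
      then show ?thesis using False assms by (simp add: dist_norm norm_mult norm_divide)
    qed
    moreover have "norm (of_real c * a) = norm a + \<tau> / 2"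
    proof -
      have "c > 0" using False assms by (simp add: c_def add_pos_pos)
      then have "norm (of_real c * a) = c * norm a" by (simp add: norm_mult)
      then show ?thesis using False by (simp add: c_def distrib_right)
    qed
    ultimately show ?thesis using assms \<open>norm a = t\<close> by (intro bexI[of _ "of_real c * a"]) auto
  qed
qed (use assms in auto)

context C2_compact
begin

text \<open>The mean of \<open>f\<close> over the circle of radius \<open>t\<close> about 0. It is
  encoded through Green's formula, \<open>ln (max (norm z) t)\<close> being the potential of the
  uniform distribution on that circle, so that it compares directly with the limits in
  \<open>potential_control\<close>.\<close>

definition circle_mean :: "real \<Rightarrow> real" where
  "circle_mean t = (\<integral>z. ln (max (norm z) t) * lap z \<partial>lborel) / (2 * pi)"

text \<open>The average is the normalised zero sum of \<open>z ^ m - w ^ m\<close>, so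
  \<open>potential_control\<close> yields the limit without a Riemann sum argument: the modulus of
  this polynomial is at most twice the \<open>m\<close>-th power of
  \<open>max (norm z) (norm w)\<close>, and off the circle comparable to it.\<close>

lemma rotation_average_tendsto:
  "(\<lambda>m. (\<Sum>j<m. f (cis (2 * pi * real j / real m) * w)) / real m) \<longlonglongrightarrow> circle_mean (norm w)"
proof (cases "w = 0")
  case True
  have eq: "max (norm z) 0 = norm z" for z :: complex by simp
  have "circle_mean (norm w) = f 0"
    unfolding circle_mean_def True norm_zero eq green_origin by simp
  moreover have "\<forall>\<^sub>F m in sequentially. f 0 = (\<Sum>j<m. f (cis (2 * pi * real j / real m) * w)) / real m"
    using eventually_gt_at_top[of 0] by eventually_elim (simp add: True)
  ultimately show ?thesis using Lim_transform_eventually[OF tendsto_const] by simp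
next
  case False
  define t where "t = norm w"
  have t: "t > 0" using False by (simp add: t_def)
  define U where "U s = ln (max s t)" for s
  have U: "continuous_on {0..} U" unfolding U_def using t by (intro continuous_intros) (auto simp: max_def)
  show ?thesis
  proof (rule LIMSEQ_I)
    fix \<epsilon>' :: real assume "\<epsilon>' > 0"
    define \<epsilon> where "\<epsilon> = \<epsilon>' / 2"
    have \<epsilon>: "\<epsilon> > 0" "\<epsilon> < \<epsilon>'" using \<open>\<epsilon>' > 0\<close> by (auto simp: \<epsilon>_def)
    from potential_control[OF U \<epsilon>(1)] obtain e \<tau> A where eA: "e > 0" "\<tau> > 0" "finite A"
      and ctrl: "\<And>p. degree p > 0 \<Longrightarrow>
      (\<And>a z. a \<in> A \<Longrightarrow> norm z \<le> norm a + 4 * \<tau> \<Longrightarrow>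
          norm (poly p z) \<le> exp (degree p * (U (norm a + 4 * \<tau>) + e))) \<Longrightarrow>
      (\<And>a. a \<in> A \<Longrightarrow> \<exists>z\<in>ball a \<tau>. norm (poly p z) \<ge> exp (degree p * (U (norm z) - e))) \<Longrightarrow>
      \<bar>zero_integral p f / degree p - (\<integral>z. U (norm z) * lap z \<partial>lborel) / (2 * pi)\<bar> \<le> \<epsilon>"
      by blast
    from exists_in_ball_norm_neq[OF eA(2), of _ t] obtain \<zeta> :: "complex \<Rightarrow> complex"
      where \<zeta>: "\<And>a. \<zeta> a \<in> ball a \<tau>" "\<And>a. norm (\<zeta> a) \<noteq> t"
      by metis
    \<comment> \<open>Off the circle one of the powers \<open>norm z ^ m\<close> and
      \<open>t ^ m\<close> dominates the other; \<open>q a ^ m\<close> is their ratio and tends to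
      0, so cancellation is excluded whatever the arguments are.\<close>
    define q where "q a = min (norm (\<zeta> a)) t / max (norm (\<zeta> a)) t" for a
    have q: "0 \<le> q a" "q a < 1" for a
      using \<zeta>(2)[of a] t by (auto simp: q_def min_def max_def divide_less_eq)
    have ev1: "\<forall>\<^sub>F m in sequentially. exp (- (real m * e)) \<le> 1 / 2"
    proof -
      have "(\<lambda>m. exp (- (real m * e))) \<longlonglongrightarrow> 0" using eA(1) by real_asymp
      then have "\<forall>\<^sub>F m in sequentially. exp (- (real m * e)) < 1 / 2" by (intro order_tendstoD) auto
      then show ?thesis by eventually_elim simp
    qed
    have ev2: "\<forall>\<^sub>F m in sequentially. \<forall>a\<in>A. q a ^ m \<le> 1 / 2"
    proof (intro eventually_ball_finite[OF eA(3)] ballI)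
      fix a
      have "(\<lambda>m. q a ^ m) \<longlonglongrightarrow> 0" using q by (intro LIMSEQ_realpow_zero) auto
      then have "\<forall>\<^sub>F m in sequentially. q a ^ m < 1 / 2" by (intro order_tendstoD) auto
      then show "\<forall>\<^sub>F m in sequentially. q a ^ m \<le> 1 / 2" by eventually_elim simp
    qed
    have "\<forall>\<^sub>F m in sequentially. norm ((\<Sum>j<m. f (cis (2 * pi * real j / real m) * w)) / real m - circle_mean (norm w)) < \<epsilon>'"
      using eventually_gt_at_top[of 0] ev1 ev2
    proof eventually_elim
      fix m :: nat assume m: "m > 0" and e1: "exp (- (real m * e)) \<le> 1 / 2" and e2: "\<forall>a\<in>A. q a ^ m \<le> 1 / 2"
      let ?p = "monom 1 m - [:w ^ m:] :: complex poly"
      have deg: "degree ?p = m"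
        using m unfolding diff_conv_add_uminus by (subst degree_add_eq_left) (auto simp: degree_monom_eq)
      have p: "poly ?p z = z ^ m - w ^ m" for z by (simp add: poly_monom)
      have expU: "exp (real m * U s) = max s t ^ m" for s
        using t by (simp add: U_def exp_of_nat_mult)
      have "2 * exp (- (real m * e)) \<le> 1" using e1 by simp
      then have e3: "2 \<le> exp (real m * e)" by (simp add: exp_minus field_simps)
      have "\<bar>zero_integral ?p f / degree ?p - (\<integral>z. U (norm z) * lap z \<partial>lborel) / (2 * pi)\<bar> \<le> \<epsilon>"
      proof (rule ctrl)
        show "degree ?p > 0" using deg m by simp
      next
        fix a z :: complex assume z: "norm z \<le> norm a + 4 * \<tau>"
        let ?s = "norm a + 4 * \<tau>"
        have "norm (poly ?p z) \<le> norm z ^ m + t ^ m"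
          unfolding p t_def using norm_triangle_ineq4[of "z ^ m" "w ^ m"] by (simp add: norm_power)
        also have "\<dots> \<le> max ?s t ^ m + max ?s t ^ m"
          using z t by (intro add_mono power_mono) auto
        also have "\<dots> = 2 * exp (real m * U ?s)" by (simp add: expU)
        also have "\<dots> \<le> exp (real m * e) * exp (real m * U ?s)" using e3 by (intro mult_right_mono) auto
        also have "\<dots> = exp (real m * (U ?s + e))" by (simp add: exp_add[symmetric] algebra_simps)
        finally show "norm (poly ?p z) \<le> exp (degree ?p * (U ?s + e))" unfolding deg .
      next
        fix a assume a: "a \<in> A"
        let ?z = "\<zeta> a"
        let ?M = "max (norm ?z) t" and ?m = "min (norm ?z) t"
        have "exp (real m * (U (norm ?z) - e)) = ?M ^ m * exp (- (real m * e))"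
          by (simp add: expU[symmetric] exp_add[symmetric] algebra_simps)
        also have "\<dots> \<le> ?M ^ m * (1 - q a ^ m)"
          using e1 e2 a t by (intro mult_left_mono) (force intro: order_trans[of _ "1/2"])+
        also have "\<dots> = ?M ^ m - ?m ^ m"
          using t by (simp add: q_def power_divide right_diff_distrib max_def)
        also have "\<dots> = \<bar>norm (?z ^ m) - norm (w ^ m)\<bar>"
          using power_mono[of "norm ?z" t m] power_mono[of t "norm ?z" m] t
          unfolding norm_power t_def[symmetric] by (cases "norm ?z \<le> t") (auto simp: max_def min_def)
        also have "\<dots> \<le> norm (poly ?p ?z)" unfolding p by (rule norm_triangle_ineq3)
        finally show "\<exists>z\<in>ball a \<tau>. norm (poly ?p z) \<ge> exp (degree ?p * (U (norm z) - e))"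
          using \<zeta>(1)[of a] unfolding deg by blast
      qed
      then show "norm ((\<Sum>j<m. f (cis (2 * pi * real j / real m) * w)) / real m - circle_mean (norm w)) < \<epsilon>'"
        using \<epsilon> unfolding deg zero_integral_root_of_power[OF False m] circle_mean_def U_def t_def by simp
    qed
    then show "\<exists>no. \<forall>n\<ge>no. norm ((\<Sum>j<n. f (cis (2 * pi * real j / real n) * w)) / real n - circle_mean (norm w)) < \<epsilon>'"
      by (simp add: eventually_sequentially)
  qed
qed

text \<open>Averaging over the \<open>m\<close>-th roots of unity leaves the integral unchanged, and
  the averages are bounded by a bound of \<open>f\<close>. Invariance is assumed only for integrals
  of \<open>f\<close>, which is the form available for the uniform measure on the circle.\<close>

lemma integral_rot_invariant:
  assumes "prob_space \<nu>" and s: "sets \<nu> = sets borel"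
    and inv: "\<And>\<theta>. 0 \<le> \<theta> \<Longrightarrow> \<theta> \<le> 2 * pi \<Longrightarrow> (\<integral>z. f (cis \<theta> * z) \<partial>\<nu>) = (\<integral>z. f z \<partial>\<nu>)"
  shows "(\<integral>z. f z \<partial>\<nu>) = (\<integral>w. circle_mean (norm w) \<partial>\<nu>)"
    and "(\<lambda>w. circle_mean (norm w)) \<in> borel_measurable \<nu>"
proof -
  interpret prob_space \<nu> by fact
  obtain C where C: "C > 0" "\<And>z. \<bar>f z\<bar> \<le> C" using bounded_of_cont_supp[OF R_pos cont_f supp] by auto
  have meas: "(\<lambda>w. f (c * w)) \<in> borel_measurable \<nu>" for c
    unfolding measurable_cong_sets[OF s refl]
    by (intro borel_measurable_continuous_onI continuous_on_compose2[OF cont_f] continuous_intros) auto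
  let ?s = "\<lambda>m w. (\<Sum>j<m. f (cis (2 * pi * real j / real m) * w)) / real m"
  have ms: "?s m \<in> borel_measurable \<nu>" for m using meas by (intro borel_measurable_divide borel_measurable_sum) auto
  show mc: "(\<lambda>w. circle_mean (norm w)) \<in> borel_measurable \<nu>"
    by (rule borel_measurable_LIMSEQ_real[OF rotation_average_tendsto ms])
  have int: "integrable \<nu> (\<lambda>w. f (c * w))" for c
    using C by (intro integrable_const_bound[where B=C] meas) auto
  have "(\<lambda>m. \<integral>w. ?s m w \<partial>\<nu>) \<longlonglongrightarrow> (\<integral>w. circle_mean (norm w) \<partial>\<nu>)"
  proof (rule integral_dominated_convergence[where w="\<lambda>_. C"])
    show "AE w in \<nu>. norm (?s m w) \<le> C" for m
    proof (intro AE_I2)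
      fix w
      have "\<bar>\<Sum>j<m. f (cis (2 * pi * real j / real m) * w)\<bar> \<le> (\<Sum>j<m. C)"
        by (rule order_trans[OF sum_abs]) (intro sum_mono C)
      then show "norm (?s m w) \<le> C" using C(1) by (cases "m = 0") (auto simp: field_simps)
    qed
  qed (use mc ms rotation_average_tendsto in auto)
  moreover have "\<forall>\<^sub>F m in sequentially. (\<integral>w. ?s m w \<partial>\<nu>) = (\<integral>z. f z \<partial>\<nu>)"
    using eventually_gt_at_top[of 0]
  proof eventually_elim
    fix m :: nat assume m: "m > 0"
    have "(\<integral>z. f (cis (2 * pi * real j / real m) * z) \<partial>\<nu>) = (\<integral>z. f z \<partial>\<nu>)" if "j < m" for j
      using m that by (intro inv) (auto simp: field_simps)
    then show "(\<integral>w. ?s m w \<partial>\<nu>) = (\<integral>z. f z \<partial>\<nu>)" using m by (simp add: int)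
  qed
  ultimately have "(\<lambda>m::nat. \<integral>z. f z \<partial>\<nu>) \<longlonglongrightarrow> (\<integral>w. circle_mean (norm w) \<partial>\<nu>)"
    by (rule Lim_transform_eventually)
  then show "(\<integral>z. f z \<partial>\<nu>) = (\<integral>w. circle_mean (norm w) \<partial>\<nu>)" by (simp add: LIMSEQ_const_iff)
qed

lemma integral_circle_mean:
  assumes "prob_space \<nu>" and s: "sets \<nu> = sets borel" and sc: "sc > 0" "AE w in \<nu>. norm w < sc"
  shows "(\<integral>w. circle_mean (norm w) \<partial>\<nu>) =
    (\<integral>z. (\<integral>w. ln (max (norm z) (norm w)) \<partial>\<nu>) * lap z \<partial>lborel) / (2 * pi)"
proof -
  interpret N: prob_space \<nu> by fact
  interpret P: pair_sigma_finite "lborel :: complex measure" \<nu> ..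
  let ?H = "\<lambda>z w. ln (max (norm z) (norm w)) * lap z"
  have [measurable_cong]: "sets \<nu> = sets borel" by (rule s)
  have mH [measurable]: "(\<lambda>(z, w). ?H z w) \<in> borel_measurable (lborel \<Otimes>\<^sub>M \<nu>)" by measurable
  \<comment> \<open>The logarithm of the maximum lies between \<open>ln (norm z)\<close> and the
    larger of \<open>ln (norm z)\<close> and \<open>ln sc\<close>, so this majorant does not depend
    on \<open>w\<close>; this is where the bounded support of \<open>\<nu>\<close> enters.\<close>
  define b where "b z = \<bar>ln (norm z) * lap z\<bar> + \<bar>ln sc\<bar> * \<bar>lap z\<bar>" for z
  have b: "integrable lborel b"
    unfolding b_def using integrable_ln_mult[OF R_pos cont_lap supp_lap] integrable_cont_supp[OF R_pos cont_lap supp_lap]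
    by (intro Bochner_Integration.integrable_add integrable_mult_right integrable_abs) auto
  have bound: "\<bar>?H z w\<bar> \<le> b z" if "z \<noteq> 0" "norm w < sc" for z w
  proof -
    have "\<bar>ln (max (norm z) (norm w))\<bar> \<le> \<bar>ln (norm z)\<bar> + \<bar>ln sc\<bar>"
    proof (cases "norm w \<le> norm z")
      case False
      then have "ln (norm z) \<le> ln (norm w)" "ln (norm w) \<le> ln sc"
        using that sc by (auto intro!: ln_mono intro: le_less_trans[OF norm_ge_zero])
      then show ?thesis using False by (simp add: max_def)
    qed (simp add: max_def)
    then have "\<bar>ln (max (norm z) (norm w))\<bar> * \<bar>lap z\<bar> \<le> (\<bar>ln (norm z)\<bar> + \<bar>ln sc\<bar>) * \<bar>lap z\<bar>"
      by (intro mult_right_mono) auto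
    then show ?thesis by (simp add: b_def abs_mult distrib_right)
  qed
  have AE0: "AE z in lborel. z \<noteq> (0::complex)" by (rule AE_lborel_singleton)
  have int: "integrable (lborel \<Otimes>\<^sub>M \<nu>) (\<lambda>(z, w). ?H z w)"
  proof (rule P.Fubini_integrable)
    have i: "integrable \<nu> (\<lambda>w. ?H z w)" if "z \<noteq> 0" for z
    proof (rule N.integrable_const_bound)
      show "AE w in \<nu>. norm (?H z w) \<le> b z" using sc(2) by eventually_elim (use bound that in auto)
    qed measurable
    then show "AE z in lborel. integrable \<nu> (\<lambda>w. case (z, w) of (z, w) \<Rightarrow> ?H z w)"
      using AE0 by auto
    show "integrable lborel (\<lambda>z. \<integral>w. norm (case (z, w) of (z, w) \<Rightarrow> ?H z w) \<partial>\<nu>)"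
    proof (rule Bochner_Integration.integrable_bound[OF b])
      show "AE z in lborel. norm (\<integral>w. norm (case (z, w) of (z, w) \<Rightarrow> ?H z w) \<partial>\<nu>) \<le> norm (b z)"
        using AE0
      proof eventually_elim
        fix z :: complex assume z: "z \<noteq> 0"
        have "(\<integral>w. norm (?H z w) \<partial>\<nu>) \<le> (\<integral>w. b z \<partial>\<nu>)"
        proof (rule integral_mono_AE)
          show "AE w in \<nu>. norm (?H z w) \<le> b z" using sc(2) by eventually_elim (use bound z in auto)
        qed (use i[OF z] in auto)
        then show "norm (\<integral>w. norm (case (z, w) of (z, w) \<Rightarrow> ?H z w) \<partial>\<nu>) \<le> norm (b z)"
          by (simp add: N.prob_space)
      qed
    qed measurable
  qed (rule mH)
  have "(\<integral>w. circle_mean (norm w) \<partial>\<nu>) = (\<integral>w. (\<integral>z. ?H z w \<partial>lborel) \<partial>\<nu>) / (2 * pi)"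
    by (simp add: circle_mean_def)
  also have "(\<integral>w. (\<integral>z. ?H z w \<partial>lborel) \<partial>\<nu>) = (\<integral>z. (\<integral>w. ?H z w \<partial>\<nu>) \<partial>lborel)"
    by (rule P.Fubini_integral[OF int])
  finally show ?thesis by simp
qed

end

text \<open>For \<open>s < sc\<close> the difference \<open>ln sc - ln (max s (norm w))\<close> is
  the integral of \<open>1 / t\<close> over those \<open>t\<close> between \<open>s\<close> and
  \<open>sc\<close> with \<open>norm w < t\<close>. Exchanging integrals leaves the mass of the disc
  of radius \<open>t\<close> divided by \<open>t\<close>, which is \<open>g' t\<close>, and the
  fundamental theorem gives \<open>g sc - g s\<close>.\<close>

lemma integral_ln_max:
  assumes "prob_space \<nu>" and sets: "sets \<nu> = sets borel" and sc: "sc > 0" "AE w in \<nu>. norm w < sc"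
    and g: "\<And>t. 0 < t \<Longrightarrow> t \<le> sc \<Longrightarrow> (g has_real_derivative g' t) (at t)"
    and g'm: "g' \<in> borel_measurable borel"
    and g'0: "\<And>t. 0 < t \<Longrightarrow> t \<le> sc \<Longrightarrow> g' t \<ge> 0"
    and F: "\<And>t. 0 < t \<Longrightarrow> t < sc \<Longrightarrow> emeasure \<nu> (ball 0 t) = ennreal (t * g' t)"
    and s: "s > 0"
  shows "(\<integral>w. ln (max s (norm (w::complex))) \<partial>\<nu>) = (if s \<le> sc then g s else g sc + ln (s / sc)) - g sc + ln sc"
proof -
  interpret N: prob_space \<nu> by fact
  interpret P: pair_sigma_finite "lborel :: real measure" \<nu> ..
  have [measurable_cong]: "sets \<nu> = sets borel" by (rule sets)
  have [measurable]: "g' \<in> borel_measurable borel" by (rule g'm)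
  show ?thesis
  proof (cases "s < sc")
    case False
    have "(\<integral>w. ln (max s (norm w)) \<partial>\<nu>) = (\<integral>w. ln s \<partial>\<nu>)"
    proof (rule integral_cong_AE)
      show "AE w in \<nu>. ln (max s (norm w)) = ln s" using sc(2) by eventually_elim (use False in auto)
    qed measurable
    then show ?thesis using False s sc by (auto simp: N.prob_space ln_div)
  next
    case True
    let ?k = "\<lambda>w. ln sc - ln (max s (norm w))"
    have k0: "AE w in \<nu>. 0 \<le> ?k w" using sc(2) by eventually_elim (use s True in \<open>auto intro!: ln_mono\<close>)
    have AEt: "AE t in lborel. t \<noteq> (c::real)" for c by (rule AE_lborel_singleton)
    have "(\<integral>\<^sup>+w. ennreal (?k w) \<partial>\<nu>) = (\<integral>\<^sup>+w. (\<integral>\<^sup>+t. indicator {s..sc} t * indicator (ball 0 t) w * ennreal (1 / t) \<partial>lborel) \<partial>\<nu>)"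
    proof (rule nn_integral_cong_AE)
      show "AE w in \<nu>. ennreal (?k w) = (\<integral>\<^sup>+t. indicator {s..sc} t * indicator (ball 0 t) w * ennreal (1 / t) \<partial>lborel)"
        using sc(2)
      proof eventually_elim
        fix w :: complex assume w: "norm w < sc"
        let ?a = "max s (norm w)"
        have "(\<integral>\<^sup>+t. ennreal (1 / t) * indicator {?a..sc} t \<partial>lborel) = ennreal (ln sc - ln ?a)"
          by (rule nn_integral_FTC_Icc) (use s w True in \<open>auto intro!: derivative_eq_intros\<close>)
        also have "(\<integral>\<^sup>+t. ennreal (1 / t) * indicator {?a..sc} t \<partial>lborel) =
           (\<integral>\<^sup>+t. indicator {s..sc} t * indicator (ball 0 t) w * ennreal (1 / t) \<partial>lborel)"
        proof (rule nn_integral_cong_AE)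
          show "AE t in lborel. ennreal (1 / t) * indicator {?a..sc} t = indicator {s..sc} t * indicator (ball 0 t) w * ennreal (1 / t)"
            using AEt[of "norm w"] by eventually_elim (auto simp: indicator_def)
        qed
        finally show "ennreal (?k w) = (\<integral>\<^sup>+t. indicator {s..sc} t * indicator (ball 0 t) w * ennreal (1 / t) \<partial>lborel)" ..
      qed
    qed
    also have "\<dots> = (\<integral>\<^sup>+t. (\<integral>\<^sup>+w. indicator {s..sc} t * indicator (ball 0 t) w * ennreal (1 / t) \<partial>\<nu>) \<partial>lborel)"
    proof (rule P.Fubini')
      have "(\<lambda>(t, w). indicator {s..sc} t * (if norm w < t then 1 else 0) * ennreal (1 / t)) \<in> borel_measurable (lborel \<Otimes>\<^sub>M \<nu>)"
        by measurable
      also have "(\<lambda>(t, w). indicator {s..sc} t * (if norm w < t then 1 else 0) * ennreal (1 / t)) =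
         (\<lambda>(t, w). indicator {s..sc} t * indicator (ball 0 t) w * ennreal (1 / t))"
        by (auto simp: fun_eq_iff indicator_def)
      finally show "(\<lambda>(t, w). indicator {s..sc} t * indicator (ball 0 t) (w::complex) * ennreal (1 / t)) \<in> borel_measurable (lborel \<Otimes>\<^sub>M \<nu>)" .
    qed
    also have "\<dots> = (\<integral>\<^sup>+t. ennreal (g' t) * indicator {s..sc} t \<partial>lborel)"
    proof (rule nn_integral_cong_AE)
      show "AE t in lborel. (\<integral>\<^sup>+w. indicator {s..sc} t * indicator (ball 0 t) w * ennreal (1 / t) \<partial>\<nu>) = ennreal (g' t) * indicator {s..sc} t"
        using AEt[of sc]
      proof eventually_elim
        fix t assume t: "t \<noteq> sc"
        have m: "ball 0 t \<in> sets \<nu>" unfolding sets by simp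
        have "(\<integral>\<^sup>+w. indicator {s..sc} t * indicator (ball 0 t) w * ennreal (1 / t) \<partial>\<nu>) =
           (\<integral>\<^sup>+w. (indicator {s..sc} t * ennreal (1 / t)) * indicator (ball 0 t) w \<partial>\<nu>)"
          by (simp add: mult_ac)
        also have "\<dots> = indicator {s..sc} t * ennreal (1 / t) * emeasure \<nu> (ball 0 t)"
          using m by (rule nn_integral_cmult_indicator)
        also have "\<dots> = ennreal (g' t) * indicator {s..sc} t"
        proof (cases "t \<in> {s..sc}")
          case True
          then have t': "0 < t" "t < sc" using t s by auto
          then have "ennreal (1 / t) * ennreal (t * g' t) = ennreal (g' t)"
            using g'0[of t] by (subst ennreal_mult[symmetric]) auto
          then show ?thesis using True by (simp add: F[OF t'])
        qed simp
        finally show "(\<integral>\<^sup>+w. indicator {s..sc} t * indicator (ball 0 t) w * ennreal (1 / t) \<partial>\<nu>) = ennreal (g' t) * indicator {s..sc} t" .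
      qed
    qed
    also have "\<dots> = ennreal (g sc - g s)"
      by (rule nn_integral_FTC_Icc) (use s True g g'0 in auto)
    finally have "(\<integral>\<^sup>+w. ennreal (?k w) \<partial>\<nu>) = ennreal (g sc - g s)" .
    moreover have "g s \<le> g sc"
    proof (rule DERIV_nonneg_imp_nondecreasing[where f=g])
      show "\<exists>y. (g has_real_derivative y) (at x) \<and> 0 \<le> y" if "s \<le> x" "x \<le> sc" for x
        using g[of x] g'0[of x] that s by auto
    qed (use True in simp)
    ultimately have "(\<integral>w. ?k w \<partial>\<nu>) = g sc - g s"
      using k0 by (intro integral_eq_nn_integral[THEN trans]) auto
    moreover have "(\<integral>w. ?k w \<partial>\<nu>) = ln sc - (\<integral>w. ln (max s (norm w)) \<partial>\<nu>)"
    proof -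
      have "integrable \<nu> (\<lambda>w. ln (max s (norm w)))"
      proof (rule N.integrable_const_bound[where B="\<bar>ln s\<bar> + \<bar>ln sc\<bar>"])
        show "AE w in \<nu>. norm (ln (max s (norm w))) \<le> \<bar>ln s\<bar> + \<bar>ln sc\<bar>"
          using sc(2)
        proof eventually_elim
          fix w :: complex assume "norm w < sc"
          then have "ln s \<le> ln (max s (norm w))" "ln (max s (norm w)) \<le> ln sc"
            using s True by (auto intro!: ln_mono)
          then show "norm (ln (max s (norm w))) \<le> \<bar>ln s\<bar> + \<bar>ln sc\<bar>" by simp
        qed
      qed measurable
      then show ?thesis by (simp add: N.prob_space)
    qed
    ultimately show ?thesis using True by simp
  qed
qed

text \<open>Only masses of discs are prescribed: exhausting the plane by discs gives total mass 1,
  and the smallest disc of mass 1 already carries almost every point.\<close>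

lemma prob_space_of_balls:
  assumes s: "sets \<nu> = sets borel" and b: "\<And>r. r \<ge> sc \<Longrightarrow> emeasure \<nu> (ball (0::complex) r) = 1"
  shows "prob_space \<nu>" "AE w in \<nu>. norm w < sc"
proof -
  have sp: "space \<nu> = UNIV" using sets_eq_imp_space_eq[OF s] by simp
  have inc: "incseq (\<lambda>n. ball (0::complex) (sc + real n))" by (auto simp: incseq_def)
  have "(\<Union>n. ball (0::complex) (sc + real n)) = UNIV"
  proof (intro equalityI subsetI UNIV_I)
    fix z :: complex
    obtain n :: nat where "norm z - sc < real n" using reals_Archimedean2 by blast
    then show "z \<in> (\<Union>n. ball 0 (sc + real n))" by (auto intro!: exI[of _ n])
  qed
  moreover have "(SUP n. emeasure \<nu> (ball 0 (sc + real n))) = emeasure \<nu> (\<Union>n. ball (0::complex) (sc + real n))"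
    by (rule SUP_emeasure_incseq[OF _ inc]) (auto simp: s)
  ultimately have "emeasure \<nu> UNIV = 1" using b by simp
  then show p: "prob_space \<nu>" by (intro prob_spaceI) (simp add: sp)
  then interpret prob_space \<nu> .
  have "ball 0 sc \<in> events" by (simp add: s)
  moreover have "prob (ball 0 sc) = 1" using b[of sc] by (simp add: measure_def)
  ultimately have "AE w in \<nu>. w \<in> ball 0 sc" using AE_in_set_eq_1[of "ball 0 sc"] by blast
  then show "AE w in \<nu>. norm w < sc" by simp
qed

text \<open>The potential of \<open>\<nu>\<close> differs from the function on the right by the
  constant \<open>ln sc - g sc\<close>, which disappears against a Laplacian because the latter has
  integral 0. So \<open>g\<close> matters only up to an additive constant.\<close>

lemma (in C2_compact) integral_rot_invariant_potential:
  assumes rot: "rot_invariant \<nu>" and sc: "sc > 0"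
    and b: "\<And>r. r \<ge> sc \<Longrightarrow> emeasure \<nu> (ball (0::complex) r) = 1"
    and g: "\<And>t. 0 < t \<Longrightarrow> t \<le> sc \<Longrightarrow> (g has_real_derivative g' t) (at t)"
    and g'm: "g' \<in> borel_measurable borel"
    and g'0: "\<And>t. 0 < t \<Longrightarrow> t \<le> sc \<Longrightarrow> g' t \<ge> 0"
    and F: "\<And>t. 0 < t \<Longrightarrow> t < sc \<Longrightarrow> emeasure \<nu> (ball 0 t) = ennreal (t * g' t)"
    and c: "continuous_on {0..} (\<lambda>s. if s \<le> sc then g s else g sc + ln (s / sc))"
  shows "(\<integral>z. f z \<partial>\<nu>) = (\<integral>z. (if norm z \<le> sc then g (norm z) else g sc + ln (norm z / sc)) * lap z \<partial>lborel) / (2 * pi)"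
proof -
  have s: "sets \<nu> = sets borel" using rot by (simp add: rot_invariant_def)
  have P: "prob_space \<nu>" "AE w in \<nu>. norm w < sc" using prob_space_of_balls[OF s] b by blast+
  have "(\<integral>z. f (cis \<theta> * z) \<partial>\<nu>) = (\<integral>z. f z \<partial>\<nu>)" for \<theta>
  proof -
    have "(\<integral>z. f z \<partial>distr \<nu> borel (\<lambda>z. cis \<theta> * z)) = (\<integral>z. f (cis \<theta> * z) \<partial>\<nu>)"
      by (rule integral_distr) (auto simp: measurable_cong_sets[OF s refl])
    then show ?thesis using rot by (simp add: rot_invariant_def)
  qed
  note 1 = integral_rot_invariant(1)[OF P(1) s this]
  let ?U = "\<lambda>s. if s \<le> sc then g s else g sc + ln (s / sc)"
  have iU: "integrable lborel (\<lambda>z. ?U (norm z) * lap z)"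
    by (rule integrable_cont_supp[OF R_pos])
       (auto intro!: continuous_on_mult cont_lap continuous_on_compose2[OF c continuous_on_norm_id] simp: supp_lap)
  have "(\<integral>z. (\<integral>w. ln (max (norm z) (norm w)) \<partial>\<nu>) * lap z \<partial>lborel) =
        (\<integral>z. ?U (norm z) * lap z + (ln sc - g sc) * lap z \<partial>lborel)"
  proof (rule integral_cong_AE)
    have "AE z in lborel. z \<noteq> (0::complex)" by (rule AE_lborel_singleton)
    then show "AE z in lborel. (\<integral>w. ln (max (norm z) (norm w)) \<partial>\<nu>) * lap z = ?U (norm z) * lap z + (ln sc - g sc) * lap z"
    proof eventually_elim
      fix z :: complex assume "z \<noteq> 0"
      then have "norm z > 0" by simp
      from integral_ln_max[OF P(1) s sc P(2) g g'm g'0 F this]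
      have eq: "(\<integral>w. ln (max (norm z) (norm w)) \<partial>\<nu>) = ?U (norm z) + (ln sc - g sc)" by simp
      show "(\<integral>w. ln (max (norm z) (norm w)) \<partial>\<nu>) * lap z = ?U (norm z) * lap z + (ln sc - g sc) * lap z"
        unfolding eq by (rule distrib_right)
    qed
    interpret prob_space \<nu> by (rule P)
    have [measurable_cong]: "sets \<nu> = sets borel" by (rule s)
    show "(\<lambda>z. (\<integral>w. ln (max (norm z) (norm w)) \<partial>\<nu>) * lap z) \<in> borel_measurable lborel"
      by measurable
    show "(\<lambda>z. ?U (norm z) * lap z + (ln sc - g sc) * lap z) \<in> borel_measurable lborel"
      using iU by (intro borel_measurable_add borel_measurable_integrable[OF iU]) measurable
  qed
  also have "\<dots> = (\<integral>z. ?U (norm z) * lap z \<partial>lborel)"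
    using iU integrable_cont_supp[OF R_pos cont_lap supp_lap] by (simp add: integral_lap)
  finally show ?thesis unfolding 1 integral_circle_mean[OF P(1) s sc P(2)] by simp
qed

section \<open>The uniform measure on the unit circle\<close>

lemma unif_circle_rotate:
  fixes f :: "complex \<Rightarrow> real"
  assumes c: "continuous_on UNIV f" and \<theta>: "0 \<le> \<theta>" "\<theta> \<le> 2 * pi"
  shows "(\<integral>z. f (cis \<theta> * z) \<partial>unif_circle) = (\<integral>z. f z \<partial>unif_circle)"
proof -
  have cc: "continuous_on A (\<lambda>t. f (w * cis t))" for A :: "real set" and w
    by (intro continuous_on_compose2[OF c] continuous_intros) auto
  have [measurable]: "cis \<in> borel_measurable borel"
    by (intro borel_measurable_continuous_onI continuous_intros)
  have eq: "(\<integral>z. f (w * z) \<partial>unif_circle) = integral {0..2*pi} (\<lambda>t. f (w * cis t)) / (2 * pi)" for w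
  proof -
    have "(\<integral>z. f (w * z) \<partial>unif_circle) = (\<integral>t. f (w * cis t) \<partial>uniform_measure lborel {0..2*pi})"
      unfolding unif_circle_def
      by (rule integral_distr) (auto intro!: borel_measurable_continuous_onI continuous_on_compose2[OF c] continuous_intros)
    also have "uniform_measure lborel {0..2*pi} = density lborel (\<lambda>t. ennreal (indicator {0..2*pi} t / (2 * pi)))"
      unfolding uniform_measure_def by (intro arg_cong2[where f=density] refl ext) (auto simp: indicator_def divide_ennreal[symmetric])
    also have "(\<integral>t. f (w * cis t) \<partial>density lborel (\<lambda>t. ennreal (indicator {0..2*pi} t / (2 * pi)))) =
       (\<integral>t. (indicator {0..2*pi} t / (2 * pi)) *\<^sub>R f (w * cis t) \<partial>lborel)"
      by (rule integral_density) (auto intro!: borel_measurable_continuous_onI cc)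
    also have "\<dots> = (\<integral>t. indicator {0..2*pi} t * f (w * cis t) \<partial>lborel) / (2 * pi)" by simp
    also have "(\<integral>t. indicator {0..2*pi} t * f (w * cis t) \<partial>lborel) = integral {0..2*pi} (\<lambda>t. f (w * cis t))"
      using set_borel_integral_eq_integral(2)[of "{0..2*pi}" "\<lambda>t. f (w * cis t)"] borel_integrable_atLeastAtMost'[OF cc[of _ w]]
      by (simp add: set_lebesgue_integral_def)
    finally show ?thesis .
  qed
  have "integral {0..2*pi} (\<lambda>t. f (cis \<theta> * cis t)) = integral {0..2*pi} (\<lambda>t. f (1 * cis t))"
  proof -
    let ?h = "\<lambda>t. f (cis t)"
    have ih: "?h integrable_on {a..b}" for a b
      using cc[of "{a..b}" 1] by (intro integrable_continuous_interval) simp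
    have "integral {0..2*pi} (\<lambda>t. f (cis \<theta> * cis t)) = integral {0..2*pi} (?h \<circ> ((+) \<theta>))"
      by (simp add: o_def cis_mult)
    also have "\<dots> = integral {\<theta>..2*pi+\<theta>} ?h" using integral_shift_Icc_real[of 0 "2*pi" ?h \<theta>] by simp
    also have "\<dots> = integral {\<theta>..2*pi} ?h + integral {2*pi..2*pi+\<theta>} ?h"
      by (rule Henstock_Kurzweil_Integration.integral_combine[symmetric]) (use \<theta> ih in auto)
    also have "integral {2*pi..2*pi+\<theta>} ?h = integral {0..\<theta>} (?h \<circ> ((+) (2*pi)))"
      using integral_shift_Icc_real[of 0 \<theta> ?h "2*pi"] by (simp add: add.commute)
    also have "?h \<circ> ((+) (2*pi)) = ?h" by (simp add: o_def fun_eq_iff flip: cis_mult)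
    also have "integral {\<theta>..2*pi} ?h + integral {0..\<theta>} ?h = integral {0..2*pi} ?h"
      using Henstock_Kurzweil_Integration.integral_combine[of 0 \<theta> "2*pi" ?h] \<theta> ih by simp
    finally show ?thesis by simp
  qed
  then show ?thesis using eq[of "cis \<theta>"] eq[of 1] by simp
qed

lemma unif_circle_prob: "prob_space unif_circle" "sets unif_circle = sets borel" "AE w in unif_circle. norm w = 1"
proof -
  have [measurable]: "cis \<in> borel_measurable borel"
    by (intro borel_measurable_continuous_onI continuous_intros)
  have "prob_space (uniform_measure lborel {0..2*pi})"
    by (rule prob_space_uniform_measure) auto
  then show "prob_space unif_circle" unfolding unif_circle_def
    by (rule prob_space.prob_space_distr) simp
  show "sets unif_circle = sets borel" by (simp add: unif_circle_def)
  show "AE w in unif_circle. norm w = 1"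
    unfolding unif_circle_def by (subst AE_distr_iff) auto
qed

text \<open>The description by masses of open discs does not fit this measure: the open unit disc
  has mass 0, and the mass jumps at radius 1. Since almost every point has modulus 1, the circle
  means are constant instead. The integrand is spelled out to match the limiting potential with
  \<open>g = 0\<close> and \<open>sc = 1\<close>.\<close>

lemma (in C2_compact) integral_unif_circle:
  "(\<integral>z. f z \<partial>unif_circle) = (\<integral>z. (if norm z \<le> 1 then 0 else 0 + ln (norm z / 1)) * lap z \<partial>lborel) / (2 * pi)"
proof -
  interpret prob_space unif_circle by (rule unif_circle_prob)
  have "(\<integral>z. f z \<partial>unif_circle) = (\<integral>w. circle_mean (norm w) \<partial>unif_circle)"
    by (rule integral_rot_invariant(1)[OF unif_circle_prob(1,2)]) (rule unif_circle_rotate[OF cont_f])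
  also have "\<dots> = (\<integral>w. circle_mean 1 \<partial>unif_circle)"
  proof (rule integral_cong_AE)
    show "(\<lambda>w. circle_mean (norm w)) \<in> borel_measurable unif_circle"
      by (rule integral_rot_invariant(2)[OF unif_circle_prob(1,2)]) (rule unif_circle_rotate[OF cont_f])
    show "AE w in unif_circle. circle_mean (norm w) = circle_mean 1"
      using unif_circle_prob(3) by eventually_elim simp
  qed simp
  also have "\<dots> = circle_mean 1" by (simp add: prob_space)
  also have "ln (max (norm z) 1) = (if norm z \<le> 1 then 0 else 0 + ln (norm z / 1))" for z :: complex
    by (auto simp: max_def)
  then have "circle_mean 1 = (\<integral>z. (if norm z \<le> 1 then 0 else 0 + ln (norm z / 1)) * lap z \<partial>lborel) / (2 * pi)"
    unfolding circle_mean_def by (simp only:)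
  finally show ?thesis .
qed

section \<open>Small balls and tails of random coefficients\<close>

text \<open>Probability tending to one in the same outer sense as in \<open>conv_in_prob\<close>.
  The predicate itself may be nonmeasurable, so it can quantify over all points of a disc or speak
  about zeros.\<close>

definition whp :: "'a measure \<Rightarrow> (nat \<Rightarrow> 'a \<Rightarrow> bool) \<Rightarrow> bool" where
  "whp M P \<longleftrightarrow> (\<forall>\<delta>>0. \<forall>\<^sub>F n in sequentially. \<exists>A\<in>sets M. {\<omega>\<in>space M. \<not> P n \<omega>} \<subseteq> A \<and> measure M A < \<delta>)"

lemma conv_in_probI:
  assumes "\<And>\<epsilon>. \<epsilon> > 0 \<Longrightarrow> whp M (\<lambda>n \<omega>. \<bar>X n \<omega> - c\<bar> \<le> \<epsilon>)"
  shows "conv_in_prob M X c"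
  using assms unfolding conv_in_prob_def whp_def by (simp add: not_le)

lemma whp_mono:
  assumes "whp M P" "\<forall>\<^sub>F n in sequentially. \<forall>\<omega>\<in>space M. P n \<omega> \<longrightarrow> Q n \<omega>"
  shows "whp M Q"
  unfolding whp_def
proof (intro allI impI)
  fix \<delta> :: real assume "\<delta> > 0"
  then have "\<forall>\<^sub>F n in sequentially. \<exists>A\<in>sets M. {\<omega>\<in>space M. \<not> P n \<omega>} \<subseteq> A \<and> measure M A < \<delta>"
    using assms(1) by (simp add: whp_def)
  with assms(2) show "\<forall>\<^sub>F n in sequentially. \<exists>A\<in>sets M. {\<omega>\<in>space M. \<not> Q n \<omega>} \<subseteq> A \<and> measure M A < \<delta>"
  proof eventually_elim
    fix n assume 1: "\<forall>\<omega>\<in>space M. P n \<omega> \<longrightarrow> Q n \<omega>"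
      and 2: "\<exists>A\<in>sets M. {\<omega>\<in>space M. \<not> P n \<omega>} \<subseteq> A \<and> measure M A < \<delta>"
    then show "\<exists>A\<in>sets M. {\<omega>\<in>space M. \<not> Q n \<omega>} \<subseteq> A \<and> measure M A < \<delta>" by blast
  qed
qed

context prob_space
begin

lemma whp_True: "whp M (\<lambda>_ _. True)"
  unfolding whp_def by (auto intro!: bexI[of _ "{}"])

lemma whp_conj:
  assumes "whp M P" "whp M Q"
  shows "whp M (\<lambda>n \<omega>. P n \<omega> \<and> Q n \<omega>)"
  unfolding whp_def
proof (intro allI impI)
  fix \<delta> :: real assume "\<delta> > 0"
  then have "\<delta> / 2 > 0" by simp
  then have "\<forall>\<^sub>F n in sequentially. \<exists>A\<in>sets M. {\<omega>\<in>space M. \<not> P n \<omega>} \<subseteq> A \<and> measure M A < \<delta> / 2"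
    "\<forall>\<^sub>F n in sequentially. \<exists>A\<in>sets M. {\<omega>\<in>space M. \<not> Q n \<omega>} \<subseteq> A \<and> measure M A < \<delta> / 2"
    using assms unfolding whp_def by blast+
  then show "\<forall>\<^sub>F n in sequentially. \<exists>A\<in>sets M. {\<omega>\<in>space M. \<not> (P n \<omega> \<and> Q n \<omega>)} \<subseteq> A \<and> measure M A < \<delta>"
  proof eventually_elim
    fix n
    assume "\<exists>A\<in>sets M. {\<omega>\<in>space M. \<not> P n \<omega>} \<subseteq> A \<and> measure M A < \<delta> / 2"
      "\<exists>A\<in>sets M. {\<omega>\<in>space M. \<not> Q n \<omega>} \<subseteq> A \<and> measure M A < \<delta> / 2"
    then obtain A B where AB: "A \<in> sets M" "{\<omega>\<in>space M. \<not> P n \<omega>} \<subseteq> A" "measure M A < \<delta> / 2"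
      "B \<in> sets M" "{\<omega>\<in>space M. \<not> Q n \<omega>} \<subseteq> B" "measure M B < \<delta> / 2" by blast
    have "measure M (A \<union> B) \<le> measure M A + measure M B" using AB by (intro measure_Un_le) auto
    then have "measure M (A \<union> B) < \<delta>" using AB by linarith
    then show "\<exists>A\<in>sets M. {\<omega>\<in>space M. \<not> (P n \<omega> \<and> Q n \<omega>)} \<subseteq> A \<and> measure M A < \<delta>"
      using AB by (intro bexI[of _ "A \<union> B"]) auto
  qed
qed

lemma whp_ball_finite:
  assumes "finite S" "\<And>a. a \<in> S \<Longrightarrow> whp M (P a)"
  shows "whp M (\<lambda>n \<omega>. \<forall>a\<in>S. P a n \<omega>)"
  using assms by (induction S) (auto simp: whp_True intro: whp_conj)

lemma whp_of_prob_tendsto_0: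
  assumes m: "\<And>n. {\<omega>\<in>space M. \<not> P n \<omega>} \<in> sets M" and l: "(\<lambda>n. prob {\<omega>\<in>space M. \<not> P n \<omega>}) \<longlonglongrightarrow> 0"
  shows "whp M P"
  unfolding whp_def
proof (intro allI impI)
  fix \<delta> :: real assume "\<delta> > 0"
  then have "\<forall>\<^sub>F n in sequentially. prob {\<omega>\<in>space M. \<not> P n \<omega>} < \<delta>" using l by (intro order_tendstoD) auto
  then show "\<forall>\<^sub>F n in sequentially. \<exists>A\<in>sets M. {\<omega>\<in>space M. \<not> P n \<omega>} \<subseteq> A \<and> prob A < \<delta>"
    by eventually_elim (use m in auto)
qed

end

text \<open>An inequality of Esseen type: the indicator of the unit interval is at most
  \<open>exp (1 / 2) * exp (- x\<^sup>2 / 2)\<close>, and the Gaussian function is the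
  characteristic function of the standard normal distribution, so Fubini turns its expectation into
  a Gaussian average of \<open>char M\<close>.\<close>

lemma (in real_distribution) small_ball_le_char:
  "prob {x. \<bar>x\<bar> < 1} \<le> exp (1 / 2) * (\<integral>g. norm (char M g) \<partial>std_normal_distribution)"
proof -
  interpret G: real_distribution std_normal_distribution by (rule real_dist_normal_dist)
  interpret P: pair_sigma_finite M std_normal_distribution ..
  have int: "integrable (M \<Otimes>\<^sub>M std_normal_distribution) (\<lambda>(x, g). iexp (x * g))"
  proof (rule finite_measure.integrable_const_bound[where B=1])
    interpret pair_prob_space M std_normal_distribution ..
    show "finite_measure (M \<Otimes>\<^sub>M std_normal_distribution)" by unfold_locales
  qed (auto simp del: of_real_mult)
  have int2: "integrable M (\<lambda>x. exp (- x\<^sup>2 / 2))"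
    by (rule integrable_const_bound[where B=1]) auto
  have "prob {x. \<bar>x\<bar> < 1} = (\<integral>x. indicator {x. \<bar>x\<bar> < 1} x \<partial>M)" by simp
  also have "\<dots> \<le> (\<integral>x. exp (1 / 2) * exp (- x\<^sup>2 / 2) \<partial>M)"
  proof (rule integral_mono)
    fix x :: real
    have "x\<^sup>2 \<le> 1" if "\<bar>x\<bar> < 1" using that by (simp add: abs_square_le_1)
    then show "indicator {x. \<bar>x\<bar> < 1} x \<le> exp (1 / 2) * exp (- x\<^sup>2 / 2)"
      by (auto simp: indicator_def exp_add[symmetric])
  qed (use int2 in \<open>auto intro!: integrable_real_indicator simp: emeasure_eq_measure\<close>)
  also have "\<dots> = exp (1 / 2) * (\<integral>x. exp (- x\<^sup>2 / 2) \<partial>M)" by simp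
  also have "(\<integral>x. exp (- x\<^sup>2 / 2) \<partial>M) \<le> (\<integral>g. norm (char M g) \<partial>std_normal_distribution)"
  proof -
    have "complex_of_real (\<integral>x. exp (- x\<^sup>2 / 2) \<partial>M) = (CLINT x|M. char std_normal_distribution x)"
      unfolding char_std_normal_distribution by (rule integral_complex_of_real[symmetric])
    also have "\<dots> = (CLINT x|M. CLINT g|std_normal_distribution. iexp (x * g))"
      by (simp add: char_def)
    also have "\<dots> = (CLINT g|std_normal_distribution. CLINT x|M. iexp (x * g))"
      by (rule P.Fubini_integral[OF int, symmetric])
    also have "\<dots> = (CLINT g|std_normal_distribution. char M g)"
      by (simp add: char_def mult.commute)
    finally have eq: "complex_of_real (\<integral>x. exp (- x\<^sup>2 / 2) \<partial>M) = (CLINT g|std_normal_distribution. char M g)" .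
    have "(\<integral>x. exp (- x\<^sup>2 / 2) \<partial>M) \<le> norm (complex_of_real (\<integral>x. exp (- x\<^sup>2 / 2) \<partial>M))" by simp
    also have "\<dots> \<le> (\<integral>g. norm (char M g) \<partial>std_normal_distribution)"
      unfolding eq by (rule integral_norm_bound)
    finally show ?thesis .
  qed
  finally show ?thesis by simp
qed

text \<open>This is the equality case of the triangle inequality:
  \<open>1 - Re (cnj c * iexp (t * x))\<close>, with \<open>c = char M t\<close>, is nonnegative and
  has integral 0.\<close>

lemma (in real_distribution) char_norm_1_AE:
  assumes "norm (char M t) = 1"
  shows "AE x in M. iexp (t * x) = char M t"
proof -
  let ?c = "char M t"
  have i: "integrable M (\<lambda>x. iexp (t * x))" by (rule integrable_iexp) auto
  have cc: "cnj ?c * ?c = 1" using assms complex_norm_square[of ?c] by (simp add: mult.commute)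
  have iR: "integrable M (\<lambda>x. Re (cnj ?c * iexp (t * x)))"
    using i by (intro integrable_Re integrable_mult_right) auto
  have "(\<integral>x. 1 - Re (cnj ?c * iexp (t * x)) \<partial>M) = 1 - Re (\<integral>x. cnj ?c * iexp (t * x) \<partial>M)"
    using i iR prob_space by (simp del: of_real_mult)
  also have "(\<integral>x. cnj ?c * iexp (t * x) \<partial>M) = cnj ?c * ?c" by (simp add: char_def)
  finally have 0: "(\<integral>x. 1 - Re (cnj ?c * iexp (t * x)) \<partial>M) = 0" using cc by simp
  have le: "Re (cnj ?c * iexp (t * x)) \<le> 1" for x
    using complex_Re_le_cmod[of "cnj ?c * iexp (t * x)"] assms by (simp add: norm_mult del: of_real_mult)
  have "AE x in M. 1 - Re (cnj ?c * iexp (t * x)) = 0"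
    using 0 iR le by (subst (asm) integral_nonneg_eq_0_iff_AE) auto
  then show ?thesis
  proof eventually_elim
    fix x assume "1 - Re (cnj ?c * iexp (t * x)) = 0"
    then have re: "Re (cnj ?c * iexp (t * x)) = 1" by simp
    have nm: "norm (cnj ?c * iexp (t * x)) = 1" using assms by (simp add: norm_mult del: of_real_mult)
    have "cnj ?c * iexp (t * x) = 1"
      using re nm cmod_power2[of "cnj ?c * iexp (t * x)"] by (intro complex_eqI) (auto simp del: of_real_mult)
    then have "?c * (cnj ?c * iexp (t * x)) = ?c" by simp
    then show "iexp (t * x) = ?c" using cc by (simp add: mult.assoc[symmetric] mult.commute[of ?c])
  qed
qed

lemma countable_iexp_eq_1:
  assumes "d \<noteq> 0" shows "countable {t::real. iexp (t * d) = 1}"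
proof -
  have "{t::real. iexp (t * d) = 1} \<subseteq> range (\<lambda>k::int. 2 * pi * of_int k / d)"
  proof
    fix t assume "t \<in> {t::real. iexp (t * d) = 1}"
    then obtain k :: int where "t * d = of_int (2 * k) * pi"
      by (auto simp: exp_eq_1)
    then show "t \<in> range (\<lambda>k::int. 2 * pi * of_int k / d)" using assms by (intro image_eqI[of _ _ k]) (auto simp: field_simps)
  qed
  then show ?thesis by (rule countable_subset) auto
qed

text \<open>If \<open>char M t\<close> has modulus 1, then for almost all pairs of independent
  samples \<open>t\<close> times their difference is a multiple of \<open>2 * pi\<close>. For two
  distinct values only countably many \<open>t\<close> satisfy this, so by Fubini almost no
  \<open>t\<close> does so unless the samples almost surely coincide, which makes the distribution
  degenerate.\<close>

lemma (in real_distribution) AE_char_norm_less_1: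
  assumes nd: "\<And>c. \<not> (AE x in M. x = c)"
  shows "AE t in lborel. norm (char M t) < 1"
proof -
  interpret MM: pair_prob_space M M ..
  interpret P: pair_sigma_finite lborel "M \<Otimes>\<^sub>M M" ..
  let ?P = "\<lambda>t p. fst p \<noteq> snd p \<longrightarrow> iexp (t * (fst p - snd p)) \<noteq> 1"
  have "AE p in M \<Otimes>\<^sub>M M. AE t in lborel. ?P t p"
  proof (rule AE_I2)
    fix p :: "real \<times> real"
    show "AE t in lborel. ?P t p"
    proof (cases "fst p = snd p")
      case False
      then have "{t::real. iexp (t * (fst p - snd p)) = 1} \<in> null_sets lborel"
        by (intro countable_imp_null_set_lborel countable_iexp_eq_1) auto
      then show ?thesis by (rule AE_not_in[THEN AE_mp]) auto
    qed simp
  qed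
  then have "AE t in lborel. AE p in M \<Otimes>\<^sub>M M. ?P t p"
    by (subst P.AE_commute) measurable
  then show ?thesis
  proof eventually_elim
    fix t assume t: "AE p in M \<Otimes>\<^sub>M M. ?P t p"
    have "norm (char M t) \<noteq> 1"
    proof
      assume c: "norm (char M t) = 1"
      have 1: "AE x in M. AE y in M. ?P t (x, y)" using MM.AE_pair[OF t] by simp
      have 2: "AE x in M. iexp (t * x) = char M t" by (rule char_norm_1_AE[OF c])
      have "AE x in M. AE y in M. y = x"
        using 1 2
      proof eventually_elim
        fix x assume x1: "AE y in M. ?P t (x, y)" and x2: "iexp (t * x) = char M t"
        show "AE y in M. y = x" using x1 2
        proof eventually_elim
          fix y assume y: "?P t (x, y)" and y2: "iexp (t * y) = char M t"
          have "iexp (t * (x - y)) = iexp (t * x) / iexp (t * y)"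
            by (simp add: right_diff_distrib exp_diff)
          also have "\<dots> = 1" using x2 y2 c by auto
          finally show "y = x" using y by auto
        qed
      qed
      then obtain x where "AE y in M. y = x"
        using AE_False eventually_mono[of "\<lambda>x. AE y in M. y = x" "ae_filter M" "\<lambda>_. False"] by blast
      then show False using nd by blast
    qed
    then show "norm (char M t) < 1" using cmod_char_le_1[of t] by simp
  qed
qed

section \<open>Consequences of the hypotheses on the coefficients\<close>

locale iid_coeffs = prob_space M for M :: "'a measure" +
  fixes \<xi> :: "nat \<Rightarrow> 'a \<Rightarrow> complex"
  assumes rv [measurable]: "\<And>k. \<xi> k \<in> borel_measurable M"
    and indep: "indep_vars (\<lambda>_. borel) \<xi> UNIV"
    and ident: "\<And>k. distr M borel (\<xi> k) = distr M borel (\<xi> 0)"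
    and nondeg: "\<not> (\<exists>c. prob {\<omega>\<in>space M. \<xi> 0 \<omega> = c} = 1)"
    and nozero: "prob {\<omega>\<in>space M. \<xi> 0 \<omega> = 0} = 0"
    and logmom: "integrable M (\<lambda>\<omega>. ln (1 + cmod (\<xi> 0 \<omega>)))"
begin

lemma prob_ident:
  assumes "A \<in> sets borel"
  shows "prob {\<omega>\<in>space M. \<xi> k \<omega> \<in> A} = prob {\<omega>\<in>space M. \<xi> 0 \<omega> \<in> A}"
proof -
  have "prob {\<omega>\<in>space M. \<xi> j \<omega> \<in> A} = measure (distr M borel (\<xi> j)) A" for j
    using assms by (subst measure_distr) (auto intro!: arg_cong[where f=prob])
  then show ?thesis using ident[of k] by simp
qed

text \<open>A union bound reduces the claim to \<open>(D + 1)\<close> times the probability that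
  \<open>X = ln (1 + cmod (\<xi> 0 \<omega>))\<close> exceeds \<open>\<epsilon> * D\<close>. Since
  \<open>D + 1 \<le> 2 * D\<close>, this is at most \<open>2 / \<epsilon>\<close> times the
  expectation of \<open>X\<close> restricted to that event, which vanishes by dominated
  convergence.\<close>

lemma whp_max_le:
  assumes D: "filterlim D at_top sequentially" and e: "\<epsilon> > 0"
  shows "whp M (\<lambda>n \<omega>. \<forall>k\<le>D n. norm (\<xi> (N n + k) \<omega>) \<le> exp (\<epsilon> * real (D n)))"
proof (rule whp_of_prob_tendsto_0)
  let ?B = "\<lambda>n. {\<omega>\<in>space M. \<not> (\<forall>k\<le>D n. norm (\<xi> (N n + k) \<omega>) \<le> exp (\<epsilon> * real (D n)))}"
  show mB: "?B n \<in> sets M" for n by measurable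
  let ?X = "\<lambda>\<omega>. ln (1 + cmod (\<xi> 0 \<omega>))"
  let ?T = "\<lambda>n. \<integral>\<omega>. ?X \<omega> * indicator {\<omega>. ?X \<omega> > \<epsilon> * real (D n)} \<omega> \<partial>M"
  have X0: "?X \<omega> \<ge> 0" for \<omega> by simp
  have T: "?T \<longlonglongrightarrow> (\<integral>\<omega>. 0 \<partial>M)"
  proof (rule integral_dominated_convergence[OF _ _ logmom])
    show "AE \<omega> in M. (\<lambda>n. ?X \<omega> * indicator {\<omega>. ?X \<omega> > \<epsilon> * real (D n)} \<omega>) \<longlonglongrightarrow> 0"
    proof (intro AE_I2 tendsto_eventually)
      fix \<omega>
      have "filterlim (\<lambda>n. \<epsilon> * real (D n)) at_top sequentially"
        by (intro filterlim_tendsto_pos_mult_at_top[OF tendsto_const e] filterlim_compose[OF filterlim_real_sequentially D])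
      then have "\<forall>\<^sub>F n in sequentially. \<epsilon> * real (D n) \<ge> ?X \<omega>" by (simp add: filterlim_at_top)
      then show "\<forall>\<^sub>F n in sequentially. ?X \<omega> * indicator {\<omega>. ?X \<omega> > \<epsilon> * real (D n)} \<omega> = 0"
        by eventually_elim simp
    qed
    show "AE \<omega> in M. norm (?X \<omega> * indicator {\<omega>. ?X \<omega> > \<epsilon> * real (D n)} \<omega>) \<le> ?X \<omega>" for n
      using X0 by (auto simp: indicator_def)
  qed measurable
  show "(\<lambda>n. prob (?B n)) \<longlonglongrightarrow> 0"
  proof (rule tendsto_sandwich[OF _ _ tendsto_const])
    have "\<forall>\<^sub>F n in sequentially. D n \<ge> 1" using D by (simp add: filterlim_at_top)
    then show "\<forall>\<^sub>F n in sequentially. prob (?B n) \<le> 2 / \<epsilon> * ?T n"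
    proof eventually_elim
      fix n assume Dn: "D n \<ge> 1"
      let ?E = "{\<omega>\<in>space M. ?X \<omega> > \<epsilon> * real (D n)}"
      have E: "?E \<in> sets M" by measurable
      have "prob (?B n) \<le> prob (\<Union>k\<in>{..D n}. {\<omega>\<in>space M. \<xi> (N n + k) \<omega> \<in> {z. norm z > exp (\<epsilon> * real (D n))}})"
        by (intro finite_measure_mono) auto
      also have "\<dots> \<le> (\<Sum>k\<in>{..D n}. prob {\<omega>\<in>space M. \<xi> (N n + k) \<omega> \<in> {z. norm z > exp (\<epsilon> * real (D n))}})"
        by (intro finite_measure_subadditive_finite) auto
      also have "\<dots> = (\<Sum>k\<in>{..D n}. prob {\<omega>\<in>space M. \<xi> 0 \<omega> \<in> {z. norm z > exp (\<epsilon> * real (D n))}})"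
        by (intro sum.cong refl prob_ident) measurable
      also have "\<dots> \<le> (\<Sum>k\<in>{..D n}. prob ?E)"
      proof (intro sum_mono finite_measure_mono E)
        show "{\<omega>\<in>space M. \<xi> 0 \<omega> \<in> {z. norm z > exp (\<epsilon> * real (D n))}} \<subseteq> ?E"
        proof safe
          fix \<omega> assume "norm (\<xi> 0 \<omega>) > exp (\<epsilon> * real (D n))"
          then have "1 + norm (\<xi> 0 \<omega>) > exp (\<epsilon> * real (D n))" by simp
          then show "\<epsilon> * real (D n) < ?X \<omega>" by (subst ln_exp[symmetric], subst ln_less_cancel_iff) (auto intro: add_pos_nonneg)
        qed
      qed
      also have "\<dots> = (1 + real (D n)) * prob ?E" by simp
      also have "\<dots> \<le> (2 * real (D n)) * prob ?E" using Dn by (intro mult_right_mono) auto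
      also have "\<dots> = 2 / \<epsilon> * (\<epsilon> * real (D n) * prob ?E)" using e by simp
      also have "\<epsilon> * real (D n) * prob ?E = (\<integral>\<omega>. \<epsilon> * real (D n) * indicator ?E \<omega> \<partial>M)" using E by simp
      also have "2 / \<epsilon> * \<dots> \<le> 2 / \<epsilon> * ?T n"
      proof (rule mult_left_mono[OF integral_mono])
        show "integrable M (\<lambda>\<omega>. \<epsilon> * real (D n) * indicator ?E \<omega>)"
          using E by (intro integrable_mult_right integrable_real_indicator) (auto simp: emeasure_eq_measure)
        show "integrable M (\<lambda>\<omega>. ?X \<omega> * indicator {\<omega>. ?X \<omega> > \<epsilon> * real (D n)} \<omega>)"
          by (rule Bochner_Integration.integrable_bound[OF logmom]) (auto simp: indicator_def)
        show "\<epsilon> * real (D n) * indicator ?E \<omega> \<le> ?X \<omega> * indicator {\<omega>. ?X \<omega> > \<epsilon> * real (D n)} \<omega>" if "\<omega> \<in> space M" for \<omega>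
          using that by (auto simp: indicator_def)
      qed (use e in simp)
      finally show "prob (?B n) \<le> 2 / \<epsilon> * ?T n" .
    qed
    show "(\<lambda>n. 2 / \<epsilon> * ?T n) \<longlonglongrightarrow> 0" using tendsto_mult_left[OF T, of "2 / \<epsilon>"] by simp
  qed auto
qed

text \<open>The index may depend on \<open>n\<close>, since identical distribution reduces every
  index to 0. It is a bound for one coefficient only: no rate is known at which the probability of
  small values decays.\<close>

lemma whp_coeff_ge:
  assumes D: "filterlim D at_top sequentially" and e: "\<epsilon> > 0"
  shows "whp M (\<lambda>n \<omega>. norm (\<xi> (k n) \<omega>) \<ge> exp (- (\<epsilon> * real (D n))))"
proof (rule whp_of_prob_tendsto_0)
  let ?B = "\<lambda>j n. {\<omega>\<in>space M. \<not> norm (\<xi> j \<omega>) \<ge> exp (- (\<epsilon> * real (D n)))}"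
  show mB: "?B (k n) n \<in> sets M" for n by measurable
  have eq: "prob (?B (k n) n) = prob (?B 0 n)" for n
    using prob_ident[of "{z. \<not> norm z \<ge> exp (- (\<epsilon> * real (D n)))}" "k n"] by simp
  have "(\<lambda>n. \<integral>\<omega>. indicator (?B 0 n) \<omega> \<partial>M) \<longlonglongrightarrow> (\<integral>\<omega>. (0::real) \<partial>M)"
  proof (rule integral_dominated_convergence[where w="\<lambda>_. 1"])
    have "AE \<omega> in M. \<xi> 0 \<omega> \<noteq> 0"
      using nozero prob_eq_0[of "{\<omega>\<in>space M. \<xi> 0 \<omega> = 0}"] by auto
    then show "AE \<omega> in M. (\<lambda>n. indicator (?B 0 n) \<omega> :: real) \<longlonglongrightarrow> 0"
    proof eventually_elim
      fix \<omega> assume nz: "\<xi> 0 \<omega> \<noteq> 0"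
      have "filterlim (\<lambda>n. \<epsilon> * real (D n)) at_top sequentially"
        by (intro filterlim_tendsto_pos_mult_at_top[OF tendsto_const e] filterlim_compose[OF filterlim_real_sequentially D])
      then have "\<forall>\<^sub>F n in sequentially. \<epsilon> * real (D n) \<ge> - ln (norm (\<xi> 0 \<omega>))" by (simp add: filterlim_at_top)
      then show "(\<lambda>n. indicator (?B 0 n) \<omega> :: real) \<longlonglongrightarrow> 0"
      proof (intro tendsto_eventually, eventually_elim)
        fix n assume "\<epsilon> * real (D n) \<ge> - ln (norm (\<xi> 0 \<omega>))"
        then have "exp (- (\<epsilon> * real (D n))) \<le> exp (ln (norm (\<xi> 0 \<omega>)))" by simp
        then show "indicator (?B 0 n) \<omega> = (0::real)" using nz by simp
      qed
    qed
  qed (auto simp: indicator_def)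
  moreover have "?B 0 n \<in> sets M" for n by measurable
  ultimately show "(\<lambda>n. prob (?B (k n) n)) \<longlonglongrightarrow> 0" unfolding eq by simp
qed

text \<open>If the real and the imaginary part were both almost surely constant, so would be the
  coefficient. The multiplier \<open>- \<i>\<close> selects the imaginary part.\<close>

lemma nondegenerate_projection:
  "\<exists>u::complex. norm u = 1 \<and> (\<forall>c. \<not> (AE \<omega> in M. Re (u * \<xi> 0 \<omega>) = c))"
proof (cases "\<exists>c. AE \<omega> in M. Re (1 * \<xi> 0 \<omega>) = c")
  case True
  then obtain a where a: "AE \<omega> in M. Re (\<xi> 0 \<omega>) = a" by auto
  have "\<not> (AE \<omega> in M. Re (- \<i> * \<xi> 0 \<omega>) = c)" for c
  proof
    assume "AE \<omega> in M. Re (- \<i> * \<xi> 0 \<omega>) = c"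
    with a have "AE \<omega> in M. \<xi> 0 \<omega> = Complex a c" by eventually_elim (auto simp: complex_eq_iff)
    then have "prob {\<omega>\<in>space M. \<xi> 0 \<omega> = Complex a c} = 1"
      using prob_Collect_eq_1[of "\<lambda>\<omega>. \<xi> 0 \<omega> = Complex a c"] by auto
    then show False using nondeg by blast
  qed
  then show ?thesis by (intro exI[of _ "- \<i>"]) simp
next
  case False
  then show ?thesis by (intro exI[of _ 1]) auto
qed

text \<open>The weights have to be known only at the indices \<open>k0 n + q * j\<close>. By
  independence the characteristic function of the projected sum is a product, in which every other
  factor has modulus at most 1 and may be dropped. For fixed \<open>L\<close> the remaining
  \<open>L\<close> factors converge to a single function \<open>\<phi>\<close>, giving the bound
  \<open>exp (1 / 2)\<close> times the Gaussian integral of \<open>\<phi> ^ L\<close>; this is small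
  for large \<open>L\<close> because \<open>\<phi> < 1\<close> almost everywhere.\<close>

lemma anticoncentration:
  assumes fit: "\<And>L. \<forall>\<^sub>F n in sequentially. k0 n + q * L \<le> D n" and q: "q > 0"
    and b: "\<And>j. (\<lambda>n. b n j) \<longlonglongrightarrow> 1"
    and c: "\<And>n j. k0 n + q * j \<le> D n \<Longrightarrow> c n (k0 n + q * j) = complex_of_real (b n j)"
  shows "whp M (\<lambda>n \<omega>. norm (\<Sum>k\<le>D n. c n k * \<xi> (N n + k) \<omega>) \<ge> 1)"
proof (rule whp_of_prob_tendsto_0)
  let ?S = "\<lambda>n \<omega>. \<Sum>k\<le>D n. c n k * \<xi> (N n + k) \<omega>"
  let ?B = "\<lambda>n. {\<omega>\<in>space M. \<not> norm (?S n \<omega>) \<ge> 1}"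
  show "?B n \<in> sets M" for n by measurable
  obtain u :: complex where u: "norm u = 1" "\<And>c. \<not> (AE \<omega> in M. Re (u * \<xi> 0 \<omega>) = c)"
    using nondegenerate_projection by blast
  define \<mu> where "\<mu> = distr M borel (\<lambda>\<omega>. Re (u * \<xi> 0 \<omega>))"
  interpret mu: real_distribution \<mu> unfolding \<mu>_def by (rule real_distribution_distr) measurable
  interpret G: real_distribution std_normal_distribution by (rule real_dist_normal_dist)
  define \<phi> where "\<phi> t = norm (char \<mu> t)" for t
  have \<phi>0: "0 \<le> \<phi> t" "\<phi> t \<le> 1" for t using mu.cmod_char_le_1 by (auto simp: \<phi>_def)
  have [measurable]: "\<phi> \<in> borel_measurable borel" unfolding \<phi>_def by measurable
  have "\<not> (AE x in \<mu>. x = c)" for c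
    unfolding \<mu>_def using u(2)[of c] by (subst AE_distr_iff) auto
  from mu.AE_char_norm_less_1[OF this] have AE\<phi>: "AE t in std_normal_distribution. \<phi> t < 1"
    unfolding \<phi>_def by (subst AE_density) auto
  have limL: "(\<lambda>L. \<integral>g. \<phi> g ^ L \<partial>std_normal_distribution) \<longlonglongrightarrow> (\<integral>g. 0 \<partial>std_normal_distribution)"
  proof (rule integral_dominated_convergence[where w="\<lambda>_. 1"])
    show "AE t in std_normal_distribution. (\<lambda>L. \<phi> t ^ L) \<longlonglongrightarrow> 0"
      using AE\<phi> by eventually_elim (use \<phi>0 in \<open>auto intro!: LIMSEQ_realpow_zero\<close>)
    show "AE t in std_normal_distribution. norm (\<phi> t ^ L) \<le> 1" for L
      using \<phi>0 by (auto intro!: power_le_one)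
  qed auto
  have limn: "(\<lambda>n. \<integral>g. (\<Prod>j<L. \<phi> (b n j * g)) \<partial>std_normal_distribution) \<longlonglongrightarrow> (\<integral>g. \<phi> g ^ L \<partial>std_normal_distribution)" for L
  proof (rule integral_dominated_convergence[where w="\<lambda>_. 1"])
    show "AE g in std_normal_distribution. (\<lambda>n. \<Prod>j<L. \<phi> (b n j * g)) \<longlonglongrightarrow> \<phi> g ^ L"
    proof (intro AE_I2)
      fix g
      have "(\<lambda>n. \<Prod>j<L. \<phi> (b n j * g)) \<longlonglongrightarrow> (\<Prod>j<L. \<phi> (1 * g))"
        unfolding \<phi>_def
        by (intro tendsto_prod tendsto_norm isCont_tendsto_compose[OF mu.isCont_char] tendsto_mult b tendsto_const)
      then show "(\<lambda>n. \<Prod>j<L. \<phi> (b n j * g)) \<longlonglongrightarrow> \<phi> g ^ L" by simp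
    qed
    show "AE g in std_normal_distribution. norm (\<Prod>j<L. \<phi> (b n j * g)) \<le> 1" for n
      using \<phi>0 by (auto simp: abs_prod intro!: prod_le_1)
  qed auto
  have bound: "prob (?B n) \<le> exp (1 / 2) * (\<integral>g. (\<Prod>j<L. \<phi> (b n j * g)) \<partial>std_normal_distribution)"
    if nL: "k0 n + q * L \<le> D n" for n L
  proof -
    let ?I = "{N n..N n + D n}"
    define Y where "Y i \<omega> = Re (u * (c n (i - N n) * \<xi> i \<omega>))" for i \<omega>
    define Z where "Z \<omega> = (\<Sum>i\<in>?I. Y i \<omega>)" for \<omega>
    have [measurable]: "Y i \<in> borel_measurable M" for i unfolding Y_def by measurable
    have [measurable]: "Z \<in> borel_measurable M" unfolding Z_def by measurable
    have Z_eq: "Z \<omega> = Re (u * ?S n \<omega>)" for \<omega>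
    proof -
      have "Z \<omega> = (\<Sum>k\<in>{0..D n}. Y (k + N n) \<omega>)"
        unfolding Z_def using sum.shift_bounds_cl_nat_ivl[of "\<lambda>i. Y i \<omega>" 0 "N n" "D n"] by (simp add: add.commute)
      then show ?thesis by (simp add: Y_def sum_distrib_left add.commute atLeast0AtMost)
    qed
    have indepY: "indep_vars (\<lambda>_. borel) Y ?I"
    proof -
      have "indep_vars (\<lambda>_. borel) (\<lambda>i \<omega>. (\<lambda>i z. Re (u * (c n (i - N n) * z))) i (\<xi> i \<omega>)) ?I"
        by (rule indep_vars_compose2[OF indep_vars_subset[OF indep]]) auto
      then show ?thesis unfolding Y_def .
    qed
    interpret z: real_distribution "distr M borel Z" by (rule real_distribution_distr) measurable
    have charY: "char (distr M borel (Y i)) g = char (distr M borel (\<lambda>\<omega>. Re (u * (c n (i - N n) * \<xi> 0 \<omega>)))) g" for i g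
    proof -
      have m: "(\<lambda>z. Re (u * (c n (i - N n) * z))) \<in> borel_measurable borel" by measurable
      have "distr M borel (Y i) = distr (distr M borel (\<xi> i)) borel (\<lambda>z. Re (u * (c n (i - N n) * z)))"
        unfolding Y_def by (subst distr_distr) (auto simp: o_def)
      also have "\<dots> = distr M borel (\<lambda>\<omega>. Re (u * (c n (i - N n) * \<xi> 0 \<omega>)))"
        unfolding ident[of i] by (subst distr_distr) (auto simp: o_def)
      finally show ?thesis by simp
    qed
    have charle: "norm (char (distr M borel (Y i)) g) \<le> 1" for i g
    proof -
      interpret y: real_distribution "distr M borel (Y i)" by (rule real_distribution_distr) measurable
      show ?thesis by (rule y.cmod_char_le_1)
    qed
    have charJ: "norm (char (distr M borel (Y (N n + (k0 n + q * j)))) g) = \<phi> (b n j * g)" if "j < L" for j g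
    proof -
      have "q * j \<le> q * L" using that by simp
      then have "c n (k0 n + q * j) = complex_of_real (b n j)" using nL by (intro c) linarith
      then have "char (distr M borel (Y (N n + (k0 n + q * j)))) g = char (distr M borel (\<lambda>\<omega>. b n j * Re (u * \<xi> 0 \<omega>))) g"
        unfolding charY by (simp add: algebra_simps)
      also have "\<dots> = char \<mu> (b n j * g)"
        unfolding char_def \<mu>_def by (subst (1 2) integral_distr) (auto simp: mult_ac simp del: of_real_mult)
      finally show ?thesis by (simp add: \<phi>_def)
    qed
    let ?J = "(\<lambda>j. N n + (k0 n + q * j)) ` {..<L}"
    have J: "?J \<subseteq> ?I"
    proof safe
      fix j assume "j < L"
      then have "q * j \<le> q * L" by simp
      then have "k0 n + q * j \<le> D n" using nL by linarith
      then show "N n + (k0 n + q * j) \<in> ?I" by simp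
    qed
    have inj: "inj_on (\<lambda>j. N n + (k0 n + q * j)) {..<L}" using q by (auto simp: inj_on_def)
    have charZ: "norm (char (distr M borel Z) g) \<le> (\<Prod>j<L. \<phi> (b n j * g))" for g
    proof -
      have "char (distr M borel Z) g = (\<Prod>i\<in>?I. char (distr M borel (Y i)) g)"
        unfolding Z_def by (rule char_distr_sum[OF indepY])
      then have "norm (char (distr M borel Z) g) = (\<Prod>i\<in>?I. norm (char (distr M borel (Y i)) g))"
        by (simp add: prod_norm)
      also have "\<dots> = (\<Prod>i\<in>?J. norm (char (distr M borel (Y i)) g)) * (\<Prod>i\<in>?I - ?J. norm (char (distr M borel (Y i)) g))"
        using J by (subst mult.commute, intro prod.subset_diff) auto
      also have "\<dots> \<le> (\<Prod>i\<in>?J. norm (char (distr M borel (Y i)) g)) * 1"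
        by (intro mult_left_mono prod_le_1 prod_nonneg) (auto simp: charle)
      also have "\<dots> = (\<Prod>j<L. \<phi> (b n j * g))"
        by (simp add: prod.reindex[OF inj] charJ)
      finally show ?thesis .
    qed
    have "prob (?B n) \<le> prob {\<omega>\<in>space M. \<bar>Z \<omega>\<bar> < 1}"
    proof (intro finite_measure_mono)
      show "?B n \<subseteq> {\<omega>\<in>space M. \<bar>Z \<omega>\<bar> < 1}"
      proof safe
        fix \<omega> assume "\<not> 1 \<le> norm (?S n \<omega>)"
        then show "\<bar>Z \<omega>\<bar> < 1"
          using abs_Re_le_cmod[of "u * ?S n \<omega>"] u(1) unfolding Z_eq norm_mult by simp
      qed
    qed measurable
    also have "\<dots> = measure (distr M borel Z) {x. \<bar>x\<bar> < 1}"
      by (subst measure_distr) (auto intro!: arg_cong[where f=prob])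
    also have "\<dots> \<le> exp (1 / 2) * (\<integral>g. norm (char (distr M borel Z) g) \<partial>std_normal_distribution)"
      by (rule z.small_ball_le_char)
    also have "\<dots> \<le> exp (1 / 2) * (\<integral>g. (\<Prod>j<L. \<phi> (b n j * g)) \<partial>std_normal_distribution)"
    proof (intro mult_left_mono integral_mono charZ)
      show "integrable std_normal_distribution (\<lambda>g. norm (char (distr M borel Z) g))"
        by (rule G.integrable_const_bound[where B=1]) (auto simp: z.cmod_char_le_1)
      show "integrable std_normal_distribution (\<lambda>g. \<Prod>j<L. \<phi> (b n j * g))"
        by (rule G.integrable_const_bound[where B=1]) (use \<phi>0 in \<open>auto simp: abs_prod intro!: prod_le_1\<close>)
    qed simp
    finally show ?thesis .
  qed
  show "(\<lambda>n. prob (?B n)) \<longlonglongrightarrow> 0"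
  proof (rule LIMSEQ_I)
    fix \<epsilon> :: real assume "\<epsilon> > 0"
    then have "\<epsilon> / exp (1 / 2) > 0" by simp
    then have "\<forall>\<^sub>F L in sequentially. (\<integral>g. \<phi> g ^ L \<partial>std_normal_distribution) < \<epsilon> / exp (1 / 2)"
      using limL by (intro order_tendstoD) auto
    then obtain L where L: "(\<integral>g. \<phi> g ^ L \<partial>std_normal_distribution) < \<epsilon> / exp (1 / 2)"
      using eventually_happens[of _ sequentially] by auto
    have "\<forall>\<^sub>F n in sequentially. (\<integral>g. (\<Prod>j<L. \<phi> (b n j * g)) \<partial>std_normal_distribution) < \<epsilon> / exp (1 / 2)"
      using limn[of L] L by (intro order_tendstoD) auto
    with fit[of L] have "\<forall>\<^sub>F n in sequentially. norm (prob (?B n) - 0) < \<epsilon>"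
    proof eventually_elim
      fix n assume "k0 n + q * L \<le> D n" and 2: "(\<integral>g. (\<Prod>j<L. \<phi> (b n j * g)) \<partial>std_normal_distribution) < \<epsilon> / exp (1 / 2)"
      then have "prob (?B n) \<le> exp (1 / 2) * (\<integral>g. (\<Prod>j<L. \<phi> (b n j * g)) \<partial>std_normal_distribution)" by (intro bound)
      also have "\<dots> < exp (1 / 2) * (\<epsilon> / exp (1 / 2))" using 2 by (intro mult_strict_left_mono) auto
      finally show "norm (prob (?B n) - 0) < \<epsilon>" by simp
    qed
    then show "\<exists>no. \<forall>n\<ge>no. norm (prob (?B n) - 0) < \<epsilon>" by (simp add: eventually_sequentially)
  qed
qed

end

section \<open>Potentials of derivatives of Kac polynomials\<close>

lemma order_pcompose_scale_le:
  fixes p :: "complex poly"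
  assumes "c \<noteq> 0" "p \<noteq> 0"
  shows "order (c * z) p \<le> order z (pcompose p [:0, c:])"
proof -
  have "[:- (c * z), 1:] ^ order (c * z) p dvd p" by (rule order_1)
  then obtain q where q: "p = [:- (c * z), 1:] ^ order (c * z) p * q" by (elim dvdE)
  have pw: "pcompose (a ^ n) [:0, c:] = (pcompose a [:0, c:]) ^ n" for a :: "complex poly" and n
    by (induction n) (auto simp: pcompose_1 pcompose_mult)
  have "pcompose p [:0, c:] = ([:- (c * z), c:]) ^ order (c * z) p * pcompose q [:0, c:]"
    by (subst q) (simp add: pcompose_mult pw pcompose_pCons)
  also have "[:- (c * z), c:] = smult c [:- z, 1:]" by simp
  finally have "pcompose p [:0, c:] = smult c [:- z, 1:] ^ order (c * z) p * pcompose q [:0, c:]" .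
  moreover have "[:- z, 1:] ^ order (c * z) p dvd smult c [:- z, 1:] ^ order (c * z) p"
    by (intro dvd_power_same dvd_smult dvd_refl)
  ultimately have "[:- z, 1:] ^ order (c * z) p dvd pcompose p [:0, c:]"
    by (metis dvd_mult2)
  moreover have "pcompose p [:0, c:] \<noteq> 0" using assms by (simp add: pcompose_eq_0_iff)
  ultimately show ?thesis by (simp add: order_divides)
qed

lemma order_pcompose_scale:
  fixes p :: "complex poly"
  assumes c: "c \<noteq> 0" and p: "p \<noteq> 0"
  shows "order z (pcompose p [:0, c:]) = order (c * z) p"
proof (rule antisym)
  let ?q = "pcompose p [:0, c:]"
  have q: "?q \<noteq> 0" using assms by (simp add: pcompose_eq_0_iff)
  have 1: "pcompose ?q [:0, inverse c:] = p"
    using c by (simp add: pcompose_assoc[symmetric] pcompose_pCons)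
  have 2: "inverse c * (c * z) = z" using c by simp
  show "order z ?q \<le> order (c * z) p"
    using order_pcompose_scale_le[of "inverse c" ?q "c * z", unfolded 1 2] c q by simp
qed (rule order_pcompose_scale_le[OF assms])

lemma zero_integral_pcompose_scale:
  assumes c: "c \<noteq> 0" and p: "p \<noteq> 0"
  shows "zero_integral (pcompose p [:0, c:]) \<phi> = zero_integral p (\<lambda>z. \<phi> (z / c))"
proof -
  have "{z. poly p z = 0} = (\<lambda>z. c * z) ` {z. poly (pcompose p [:0, c:]) z = 0}"
  proof (intro equalityI subsetI)
    fix z assume "z \<in> {z. poly p z = 0}"
    then show "z \<in> (\<lambda>z. c * z) ` {z. poly (pcompose p [:0, c:]) z = 0}"
      using c by (intro image_eqI[of _ _ "z / c"]) (auto simp: poly_pcompose)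
  qed (auto simp: poly_pcompose mult.commute)
  moreover have "inj_on (\<lambda>z. c * z) {z. poly (pcompose p [:0, c:]) z = 0}" using c by (auto simp: inj_on_def)
  ultimately show ?thesis
    unfolding zero_integral_def using c p by (simp add: sum.reindex order_pcompose_scale)
qed

lemma zero_integral_smult: "c \<noteq> 0 \<Longrightarrow> zero_integral (smult c p) \<phi> = zero_integral p \<phi>"
  unfolding zero_integral_def by (simp add: order_smult)

text \<open>Division by \<open>fact N\<close> turns the coefficients into binomial coefficients
  times those of the Kac polynomial, and the substitution displays the zeros in units of
  \<open>h\<close>.\<close>

definition scaled_poly :: "(nat \<Rightarrow> 'a \<Rightarrow> complex) \<Rightarrow> nat \<Rightarrow> real \<Rightarrow> nat \<Rightarrow> 'a \<Rightarrow> complex poly" where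
  "scaled_poly \<xi> N h n \<omega> = smult (inverse (fact N)) (pcompose ((pderiv ^^ N) (kac_poly \<xi> n \<omega>)) [:0, complex_of_real h:])"

lemma coeff_kac_poly: "coeff (kac_poly \<xi> n \<omega>) k = (if k \<le> n then \<xi> k \<omega> else 0)"
  unfolding kac_poly_def by (simp add: coeff_sum sum.delta)

lemma coeff_scaled_poly:
  assumes "N \<le> n"
  shows "coeff (scaled_poly \<xi> N h n \<omega>) k =
    (if k \<le> n - N then of_real (real ((N + k) choose k) * h ^ k) * \<xi> (N + k) \<omega> else 0)"
proof -
  have "pochhammer (of_nat (Suc k)) N / (fact N :: complex) = of_nat ((N + k) choose k)"
  proof -
    have "(pochhammer (of_nat (Suc k)) N :: complex) = fact (k + N) / fact k"
    proof -
      have "fact (k + N) = (fact k :: complex) * pochhammer (1 + of_nat k) N"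
        by (simp only: pochhammer_fact pochhammer_product')
      then show ?thesis by simp
    qed
    moreover have "(of_nat ((N + k) choose k) :: complex) = fact (N + k) / (fact k * fact N)"
      by (subst binomial_fact) auto
    ultimately show ?thesis by (simp add: add.commute)
  qed
  then have "inverse (fact N) * pochhammer (of_nat (Suc k)) N = (of_nat ((N + k) choose k) :: complex)"
    by (simp add: field_simps)
  then have "coeff (scaled_poly \<xi> N h n \<omega>) k = of_nat ((N + k) choose k) * (of_real h ^ k * coeff (kac_poly \<xi> n \<omega>) (k + N))"
    unfolding scaled_poly_def by (simp add: coeff_pcompose_linear coeff_higher_pderiv mult_ac)
  then show ?thesis using assms by (auto simp: coeff_kac_poly add.commute)
qed

lemma poly_scaled_poly:
  assumes "N \<le> n"
  shows "poly (scaled_poly \<xi> N h n \<omega>) z = (\<Sum>k\<le>n - N. of_real (real ((N + k) choose k) * h ^ k) * \<xi> (N + k) \<omega> * z ^ k)"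
proof -
  have "degree (scaled_poly \<xi> N h n \<omega>) \<le> n - N"
    by (rule degree_le) (simp add: coeff_scaled_poly[OF assms])
  then have "poly (scaled_poly \<xi> N h n \<omega>) z = (\<Sum>k\<le>n - N. coeff (scaled_poly \<xi> N h n \<omega>) k * z ^ k)"
    unfolding poly_altdef by (intro sum.mono_neutral_left) (auto simp: coeff_eq_0)
  then show ?thesis by (simp add: coeff_scaled_poly[OF assms])
qed

lemma scaled_poly_lead:
  assumes "N \<le> n" "h \<noteq> 0" "\<xi> n \<omega> \<noteq> 0"
  shows "degree (scaled_poly \<xi> N h n \<omega>) = n - N"
    and "lead_coeff (scaled_poly \<xi> N h n \<omega>) = of_real (real (n choose (n - N)) * h ^ (n - N)) * \<xi> n \<omega>"
proof -
  have c: "coeff (scaled_poly \<xi> N h n \<omega>) (n - N) = of_real (real (n choose (n - N)) * h ^ (n - N)) * \<xi> n \<omega>"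
    using assms by (simp add: coeff_scaled_poly)
  have "n - N \<le> n" by simp
  then have "coeff (scaled_poly \<xi> N h n \<omega>) (n - N) \<noteq> 0" using assms unfolding c by simp
  then have "n - N \<le> degree (scaled_poly \<xi> N h n \<omega>)" by (rule le_degree)
  moreover have "degree (scaled_poly \<xi> N h n \<omega>) \<le> n - N"
    by (rule degree_le) (simp add: coeff_scaled_poly[OF assms(1)])
  ultimately show d: "degree (scaled_poly \<xi> N h n \<omega>) = n - N" by simp
  show "lead_coeff (scaled_poly \<xi> N h n \<omega>) = of_real (real (n choose (n - N)) * h ^ (n - N)) * \<xi> n \<omega>"
    unfolding d by (rule c)
qed

lemma zero_integral_scaled_poly:
  assumes "N \<le> n" "h \<noteq> 0" "\<xi> n \<omega> \<noteq> 0"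
  shows "zero_integral (scaled_poly \<xi> N h n \<omega>) \<phi> =
    zero_integral ((pderiv ^^ N) (kac_poly \<xi> n \<omega>)) (\<lambda>z. \<phi> (z / of_real h))"
proof -
  have "scaled_poly \<xi> N h n \<omega> \<noteq> 0"
    using scaled_poly_lead(2)[where \<xi>=\<xi>, OF assms] assms by auto
  then have "(pderiv ^^ N) (kac_poly \<xi> n \<omega>) \<noteq> 0" unfolding scaled_poly_def by (intro notI) simp
  then show ?thesis
    unfolding scaled_poly_def using assms by (subst zero_integral_smult) (auto simp: zero_integral_pcompose_scale)
qed

section \<open>Terms at and below the critical radius\<close>

lemma binomial_term_le:
  assumes x: "0 \<le> x" "x < 1"
  shows "real ((N + k) choose k) * x ^ k \<le> exp (- (real N * ln (1 - x)))"
proof -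
  have "real ((N + k) choose k) * x ^ k * (1 - x) ^ N \<le> 1" using nbw_le_1[of x N k] x by (simp add: nbw_def)
  moreover have e: "exp (- (real N * ln (1 - x))) = 1 / (1 - x) ^ N"
    using x by (simp add: exp_minus exp_of_nat_mult field_simps)
  moreover have "(1 - x) ^ N > 0" using x by simp
  ultimately show ?thesis by (simp only: pos_le_divide_eq)
qed

text \<open>For \<open>N = 0\<close> the value \<open>ln 0 = 0\<close> makes the exponent vanish, which is the correct bound.\<close>

lemma binomial_term_le_critical:
  assumes "n = N + D" "D > 0"
  shows "real ((N + k) choose k) * (real D / real n) ^ k \<le> exp (- (real N * ln (1 - real D / real n)))"
proof (cases "N = 0")
  case False
  then show ?thesis using assms by (intro binomial_term_le) auto
qed (use assms in simp)

text \<open>The critical radius \<open>D / n\<close> is the one whose mode is exactly the top index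
  \<open>D\<close>, so the leading term there is the largest up to the factor
  \<open>2 * D + 3\<close>. For \<open>N = 0\<close> the left side is 1, by the value of
  \<open>ln 0\<close>.\<close>

lemma binomial_critical_lower:
  assumes n: "n = N + D" "D > 0"
  shows "exp (- (real N * ln (1 - real D / real n))) \<le>
    real (n choose D) * (real D / real n) ^ D * (2 * real D + 3)"
proof (cases "N = 0")
  case False
  let ?r = "real D / real n"
  have r: "0 \<le> ?r" "?r < 1" using n False by auto
  have "1 - ?r = real N / real n" using n by (simp add: field_simps)
  then have "nb_mode N ?r = real D" using n False by (simp add: nb_mode_def)
  then have "1 \<le> nbw N ?r D * (2 * real D + 3)" using nbw_mode_lower[OF r, of N] by simp
  then have 1: "1 \<le> real (n choose D) * ?r ^ D * (1 - ?r) ^ N * (2 * real D + 3)" using n by (simp add: nbw_def)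
  have e: "exp (- (real N * ln (1 - ?r))) = 1 / (1 - ?r) ^ N"
    using r by (simp add: exp_minus exp_of_nat_mult field_simps)
  have pos: "(1 - ?r) ^ N > 0" using r by simp
  show ?thesis unfolding e using 1 pos by (subst pos_divide_le_eq[OF pos]) (simp add: mult_ac)
qed (use n in simp)

text \<open>Up to the critical radius \<open>1 - x \<ge> N / n\<close>. Hence at a fixed fraction of
  the critical radius the mode is at most that fraction of \<open>D\<close>.\<close>

lemma nb_mode_le:
  assumes "n = N + D" "D > 0" "0 \<le> x" "x \<le> real D / real n" "x < 1"
  shows "nb_mode N x \<le> real n * x"
proof (cases "N = 0")
  case False
  have "real N / (1 - x) \<le> real N / (1 - real D / real n)"
    using assms False by (intro divide_left_mono mult_pos_pos) auto
  also have "\<dots> = real n" using assms False by (simp add: field_simps)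
  finally have "x * (real N / (1 - x)) \<le> x * real n" using assms by (intro mult_left_mono) auto
  then show ?thesis by (simp add: nb_mode_def mult.commute)
qed (use assms in \<open>simp add: nb_mode_def\<close>)

lemma power_eq_scaled: "(c::real) \<noteq> 0 \<Longrightarrow> x ^ k = c ^ k * (x / c) ^ k"
  by (simp add: power_divide)

text \<open>The zeros are observed at scale \<open>h n\<close>; in the rescaled variable \<open>sc\<close> is the limit of the critical
  radius and \<open>g\<close> the limiting potential inside it. The two alternatives in \<open>inner\<close> are the regime where the
  constant coefficient dominates and the one where the dominating index tends to infinity.\<close>

locale kac_scaling = iid_coeffs M \<xi> for M :: "'a measure" and \<xi> +
  fixes N :: "nat \<Rightarrow> nat" and h :: "nat \<Rightarrow> real" and g :: "real \<Rightarrow> real" and sc :: real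
  assumes N_le: "\<And>n. N n \<le> n"
    and D_inf: "filterlim (\<lambda>n. n - N n) at_top sequentially"
    and h_pos: "\<And>n. n - N n > 0 \<Longrightarrow> h n > 0"
    and sc_pos: "sc > 0"
    and g_lim: "\<And>s. 0 < s \<Longrightarrow> s < sc \<Longrightarrow> (\<lambda>n. - (real (N n) * ln (1 - h n * s)) / real (n - N n)) \<longlonglongrightarrow> g s"
    and sc_lim: "(\<lambda>n. real (n - N n) / real n / h n) \<longlonglongrightarrow> sc"
    and g_sc_lim: "(\<lambda>n. - (real (N n) * ln (1 - real (n - N n) / real n)) / real (n - N n)) \<longlonglongrightarrow> g sc"
    and U_cont: "continuous_on {0..} (\<lambda>s. if s \<le> sc then g s else g sc + ln (s / sc))"
    and inner: "(\<forall>s. 0 < s \<and> s < sc \<longrightarrow> g s = 0) \<or>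
       (\<forall>s. 0 < s \<and> s < sc \<longrightarrow> filterlim (\<lambda>n. nb_mode (N n) (h n * s)) at_top sequentially)"
begin

abbreviation "D n \<equiv> n - N n"

definition U :: "real \<Rightarrow> real" where
  "U s = (if s \<le> sc then g s else g sc + ln (s / sc))"

abbreviation "P n \<omega> \<equiv> scaled_poly \<xi> (N n) (h n) n \<omega>"

lemma n_eq: "n = N n + D n" using N_le[of n] by simp

lemma D_pos: "\<forall>\<^sub>F n in sequentially. D n > 0"
proof -
  have "\<forall>\<^sub>F n in sequentially. D n \<ge> 1" using D_inf by (simp add: filterlim_at_top)
  then show ?thesis by eventually_elim simp
qed

lemma D_real_inf: "filterlim (\<lambda>n. real (D n)) at_top sequentially"
  by (rule filterlim_compose[OF filterlim_real_sequentially D_inf])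

text \<open>Absorbs the number of terms and the loss \<open>2 * nb_mode + 3\<close> at the mode into
  an exponential error.\<close>

lemma ev_poly_le_exp:
  assumes "e > 0"
  shows "\<forall>\<^sub>F n in sequentially. 2 * real (D n) + 3 \<le> exp (e * real (D n))"
proof -
  have "\<forall>\<^sub>F x in at_top. 2 * x + 3 \<le> exp (e * x)" using assms by real_asymp
  then show ?thesis using D_real_inf by (rule eventually_compose_filterlim)
qed

lemma ratio_lim: "s > 0 \<Longrightarrow> (\<lambda>n. h n * s / (real (D n) / real n)) \<longlonglongrightarrow> s / sc"
  using tendsto_divide[OF tendsto_const[of s] sc_lim] sc_pos by (simp add: ac_simps)

lemma ev_below:
  assumes "0 < s" "s < sc"
  shows "\<forall>\<^sub>F n in sequentially. 0 < h n * s \<and> h n * s < real (D n) / real n \<and> h n * s < 1"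
proof -
  have "s / sc < 1" using assms by simp
  then have "\<forall>\<^sub>F n in sequentially. h n * s / (real (D n) / real n) < 1"
    using ratio_lim[OF assms(1)] by (intro order_tendstoD) auto
  with D_pos show ?thesis
  proof eventually_elim
    fix n assume D: "D n > 0" and r: "h n * s / (real (D n) / real n) < 1"
    have rho: "real (D n) / real n > 0" "real (D n) / real n \<le> 1" using D N_le[of n] by auto
    have "h n * s < real (D n) / real n" using r rho(1) by (simp only: pos_divide_less_eq mult_1)
    then show "0 < h n * s \<and> h n * s < real (D n) / real n \<and> h n * s < 1"
      using rho h_pos[OF D] assms by simp
  qed
qed

lemma ev_above:
  assumes "s > sc" "e > 0"
  shows "\<forall>\<^sub>F n in sequentially. h n * s > real (D n) / real n \<and>
    \<bar>ln (h n * s / (real (D n) / real n)) - ln (s / sc)\<bar> \<le> e"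
proof -
  have s0: "s > 0" using assms sc_pos by simp
  have "1 < s / sc" using assms sc_pos by simp
  then have 1: "\<forall>\<^sub>F n in sequentially. h n * s / (real (D n) / real n) > 1"
    using ratio_lim[OF s0] by (intro order_tendstoD) auto
  have "(\<lambda>n. ln (h n * s / (real (D n) / real n))) \<longlonglongrightarrow> ln (s / sc)"
    using s0 sc_pos by (intro tendsto_ln ratio_lim) auto
  then have 2: "\<forall>\<^sub>F n in sequentially. dist (ln (h n * s / (real (D n) / real n))) (ln (s / sc)) < e"
    using assms(2) by (rule tendstoD)
  from 1 2 D_pos show ?thesis
  proof eventually_elim
    fix n assume r: "h n * s / (real (D n) / real n) > 1" and d: "dist (ln (h n * s / (real (D n) / real n))) (ln (s / sc)) < e"
      and D: "D n > 0"
    have rho: "real (D n) / real n > 0" using D N_le[of n] by auto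
    have "h n * s > real (D n) / real n" using r rho by (simp only: pos_less_divide_eq mult_1)
    then show "h n * s > real (D n) / real n \<and> \<bar>ln (h n * s / (real (D n) / real n)) - ln (s / sc)\<bar> \<le> e"
      using d by (simp add: dist_real_def)
  qed
qed

lemma ev_quotient_lim:
  assumes "(\<lambda>n. X n / real (D n)) \<longlonglongrightarrow> l" "e > 0"
  shows "\<forall>\<^sub>F n in sequentially. \<bar>X n - real (D n) * l\<bar> \<le> real (D n) * e"
  using tendstoD[OF assms] D_pos
proof eventually_elim
  fix n assume d: "dist (X n / real (D n)) l < e" and D: "D n > 0"
  have "X n - real (D n) * l = real (D n) * (X n / real (D n) - l)" using D by (simp add: right_diff_distrib)
  also have "\<bar>\<dots>\<bar> = real (D n) * \<bar>X n / real (D n) - l\<bar>" by (simp add: abs_mult)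
  also have "\<dots> \<le> real (D n) * e" using d by (intro mult_left_mono) (auto simp: dist_real_def)
  finally show "\<bar>X n - real (D n) * l\<bar> \<le> real (D n) * e" .
qed

lemmas ev_g = ev_quotient_lim[OF g_lim]
lemmas ev_g_sc = ev_quotient_lim[OF g_sc_lim]

text \<open>Below the critical radius the negative binomial bound applies at \<open>h n * s\<close>
  itself. Above it, that bound is used at the critical radius, and the ratio of the radii, which
  exceeds 1, enters with exponent \<open>k\<close>, at worst \<open>D n\<close>. At
  \<open>s = sc\<close> it is undecided on which side \<open>h n * s\<close> falls, so that case is
  left to the continuity of \<open>U\<close>.\<close>

lemma ev_terms_le:
  assumes "s > 0" "s \<noteq> sc" "e > 0"
  shows "\<forall>\<^sub>F n in sequentially. \<forall>k\<le>D n. real ((N n + k) choose k) * (h n * s) ^ k \<le> exp (real (D n) * (U s + e))"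
proof (cases "s < sc")
  case True
  show ?thesis using ev_below[OF assms(1) True] ev_g[OF assms(1) True assms(3)]
  proof eventually_elim
    fix n
    assume b: "0 < h n * s \<and> h n * s < real (D n) / real n \<and> h n * s < 1"
      and gg: "\<bar>- (real (N n) * ln (1 - h n * s)) - real (D n) * g s\<bar> \<le> real (D n) * e"
    have "exp (- (real (N n) * ln (1 - h n * s))) \<le> exp (real (D n) * (U s + e))"
      using gg True by (auto simp: U_def distrib_left)
    then show "\<forall>k\<le>D n. real ((N n + k) choose k) * (h n * s) ^ k \<le> exp (real (D n) * (U s + e))"
      using binomial_term_le[of "h n * s" "N n"] b order_trans by fastforce
  qed
next
  case False
  then have s: "s > sc" using assms by simp
  have e2: "e / 2 > 0" using assms by simp
  show ?thesis using ev_above[OF s e2] ev_g_sc[OF e2] D_pos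
  proof eventually_elim
    fix n
    let ?\<rho> = "real (D n) / real n"
    assume a: "h n * s > ?\<rho> \<and> \<bar>ln (h n * s / ?\<rho>) - ln (s / sc)\<bar> \<le> e / 2"
      and gg: "\<bar>- (real (N n) * ln (1 - ?\<rho>)) - real (D n) * g sc\<bar> \<le> real (D n) * (e / 2)" and D: "D n > 0"
    have rho: "?\<rho> > 0" using D N_le[of n] by auto
    have q1: "h n * s / ?\<rho> > 1" using a rho by (simp only: pos_less_divide_eq mult_1)
    show "\<forall>k\<le>D n. real ((N n + k) choose k) * (h n * s) ^ k \<le> exp (real (D n) * (U s + e))"
    proof (intro allI impI)
      fix k assume k: "k \<le> D n"
      have pe: "(h n * s) ^ k = ?\<rho> ^ k * (h n * s / ?\<rho>) ^ k"
        by (rule power_eq_scaled) (use rho in linarith)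
      have "real ((N n + k) choose k) * (h n * s) ^ k = real ((N n + k) choose k) * ?\<rho> ^ k * (h n * s / ?\<rho>) ^ k"
        by (simp only: pe mult.assoc)
      also have "\<dots> \<le> exp (- (real (N n) * ln (1 - ?\<rho>))) * (h n * s / ?\<rho>) ^ D n"
        using binomial_term_le_critical[OF n_eq D, of k] k q1
        by (intro mult_mono power_increasing) auto
      also have "(h n * s / ?\<rho>) ^ D n = exp (real (D n) * ln (h n * s / ?\<rho>))"
        using q1 by (simp add: exp_of_nat_mult)
      also have "exp (- (real (N n) * ln (1 - ?\<rho>))) * \<dots> = exp (- (real (N n) * ln (1 - ?\<rho>)) + real (D n) * ln (h n * s / ?\<rho>))"
        by (rule exp_add[symmetric])
      also have "\<dots> \<le> exp (real (D n) * (U s + e))"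
      proof -
        have "real (D n) * ln (h n * s / ?\<rho>) \<le> real (D n) * (ln (s / sc) + e / 2)"
          by (rule mult_left_mono) (use a in linarith)+
        moreover have "real (D n) * (U s + e) = real (D n) * g sc + real (D n) * (e / 2) + real (D n) * (ln (s / sc) + e / 2)"
          using s by (simp add: U_def algebra_simps)
        ultimately show ?thesis using gg by (simp only: exp_le_cancel_iff) linarith
      qed
      finally show "real ((N n + k) choose k) * (h n * s) ^ k \<le> exp (real (D n) * (U s + e))" .
    qed
  qed
qed

section \<open>Upper bounds on discs and of the leading term from below\<close>

lemma upper_generic:
  assumes "s > 0" "s \<noteq> sc" "e > 0"
  shows "whp M (\<lambda>n \<omega>. \<forall>z. norm z \<le> s \<longrightarrow> norm (poly (P n \<omega>) z) \<le> exp (real (D n) * (U s + e)))"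
proof -
  \<comment> \<open>One third each for the deterministic terms, the coefficients and the number of
    terms.\<close>
  have e3: "e / 3 > 0" using assms by simp
  show ?thesis
  proof (rule whp_mono[OF whp_max_le[OF D_inf e3, of N]])
    show "\<forall>\<^sub>F n in sequentially. \<forall>\<omega>\<in>space M. (\<forall>k\<le>D n. norm (\<xi> (N n + k) \<omega>) \<le> exp (e / 3 * real (D n))) \<longrightarrow>
        (\<forall>z. norm z \<le> s \<longrightarrow> norm (poly (P n \<omega>) z) \<le> exp (real (D n) * (U s + e)))"
      using ev_terms_le[OF assms(1,2) e3] ev_poly_le_exp[OF e3] D_pos
    proof eventually_elim
      fix n
      assume t: "\<forall>k\<le>D n. real ((N n + k) choose k) * (h n * s) ^ k \<le> exp (real (D n) * (U s + e / 3))"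
        and pe: "2 * real (D n) + 3 \<le> exp (e / 3 * real (D n))" and D: "D n > 0"
      have hp: "h n > 0" using h_pos[OF D] .
      show "\<forall>\<omega>\<in>space M. (\<forall>k\<le>D n. norm (\<xi> (N n + k) \<omega>) \<le> exp (e / 3 * real (D n))) \<longrightarrow>
        (\<forall>z. norm z \<le> s \<longrightarrow> norm (poly (P n \<omega>) z) \<le> exp (real (D n) * (U s + e)))"
      proof (intro ballI impI allI)
        fix \<omega> and z :: complex assume x: "\<forall>k\<le>D n. norm (\<xi> (N n + k) \<omega>) \<le> exp (e / 3 * real (D n))" and z: "norm z \<le> s"
        have "norm (poly (P n \<omega>) z) \<le> (\<Sum>k\<le>D n. norm (of_real (real ((N n + k) choose k) * h n ^ k) * \<xi> (N n + k) \<omega> * z ^ k))"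
          unfolding poly_scaled_poly[OF N_le] by (rule norm_sum)
        also have "\<dots> \<le> (\<Sum>k\<le>D n. exp (real (D n) * (U s + e / 3)) * exp (e / 3 * real (D n)))"
        proof (rule sum_mono)
          fix k assume "k \<in> {..D n}"
          then have k: "k \<le> D n" by simp
          have "norm (of_real (real ((N n + k) choose k) * h n ^ k) * \<xi> (N n + k) \<omega> * z ^ k) =
             real ((N n + k) choose k) * (h n * norm z) ^ k * norm (\<xi> (N n + k) \<omega>)"
            using hp by (simp add: norm_mult norm_power power_mult_distrib abs_mult mult_ac)
          also have "\<dots> \<le> real ((N n + k) choose k) * (h n * s) ^ k * norm (\<xi> (N n + k) \<omega>)"
            using hp z by (intro mult_right_mono mult_left_mono power_mono) auto
          also have "\<dots> \<le> exp (real (D n) * (U s + e / 3)) * exp (e / 3 * real (D n))"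
            using t x k by (intro mult_mono) auto
          finally show "norm (of_real (real ((N n + k) choose k) * h n ^ k) * \<xi> (N n + k) \<omega> * z ^ k) \<le>
             exp (real (D n) * (U s + e / 3)) * exp (e / 3 * real (D n))" .
        qed
        also have "\<dots> = (real (D n) + 1) * (exp (real (D n) * (U s + e / 3)) * exp (e / 3 * real (D n)))" by simp
        also have "\<dots> \<le> exp (e / 3 * real (D n)) * (exp (real (D n) * (U s + e / 3)) * exp (e / 3 * real (D n)))"
          using pe by (intro mult_right_mono) auto
        also have "\<dots> = exp (real (D n) * (U s + e))"
          by (simp add: exp_add[symmetric] algebra_simps)
        finally show "norm (poly (P n \<omega>) z) \<le> exp (real (D n) * (U s + e))" .
      qed
    qed
  qed
qed

text \<open>The radii 0 and \<open>sc\<close> are reached by enlarging the disc slightly to a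
  generic radius \<open>t\<close>, at a cost controlled by the continuity of
  \<open>U\<close>.\<close>

lemma upper:
  assumes "s \<ge> 0" "e > 0"
  shows "whp M (\<lambda>n \<omega>. \<forall>z. norm z \<le> s \<longrightarrow> norm (poly (P n \<omega>) z) \<le> exp (real (D n) * (U s + e)))"
proof -
  have "continuous (at s within {0..}) U"
    using U_cont assms unfolding U_def by (simp add: continuous_on_eq_continuous_within)
  then obtain d where d: "d > 0" "\<And>x. x \<in> {0..} \<Longrightarrow> dist x s < d \<Longrightarrow> dist (U x) (U s) < e / 2"
    using assms(2) unfolding continuous_within_eps_delta by (metis half_gt_zero)
  obtain t where t: "s < t" "t < s + d" "t \<noteq> sc"
  proof (cases "s + d / 2 = sc")
    case True
    then show ?thesis using that[of "s + d / 3"] d(1) by auto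
  next
    case False
    then show ?thesis using that[of "s + d / 2"] d(1) by auto
  qed
  have "dist (U t) (U s) < e / 2" using t assms by (intro d(2)) (auto simp: dist_real_def)
  then have "U t \<le> U s + e / 2" unfolding dist_real_def by linarith
  then have le: "real (D n) * (U t + e / 2) \<le> real (D n) * (U s + e)" for n by (intro mult_left_mono) auto
  have "whp M (\<lambda>n \<omega>. \<forall>z. norm z \<le> t \<longrightarrow> norm (poly (P n \<omega>) z) \<le> exp (real (D n) * (U t + e / 2)))"
    using t assms by (intro upper_generic) auto
  then show ?thesis
  proof (rule whp_mono)
    show "\<forall>\<^sub>F n in sequentially. \<forall>\<omega>\<in>space M. (\<forall>z. norm z \<le> t \<longrightarrow> norm (poly (P n \<omega>) z) \<le> exp (real (D n) * (U t + e / 2))) \<longrightarrow>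
       (\<forall>z. norm z \<le> s \<longrightarrow> norm (poly (P n \<omega>) z) \<le> exp (real (D n) * (U s + e)))"
    proof (intro always_eventually allI ballI impI)
      fix n \<omega> and z :: complex assume H: "\<forall>z. norm z \<le> t \<longrightarrow> norm (poly (P n \<omega>) z) \<le> exp (real (D n) * (U t + e / 2))" "norm z \<le> s"
      then have "norm (poly (P n \<omega>) z) \<le> exp (real (D n) * (U t + e / 2))" using t by auto
      also have "\<dots> \<le> exp (real (D n) * (U s + e))" using le by simp
      finally show "norm (poly (P n \<omega>) z) \<le> exp (real (D n) * (U s + e))" .
    qed
  qed
qed

text \<open>Beyond the critical radius the leading term alone has the order of the limiting
  potential. Its lower bound also shows that \<open>\<xi> n \<omega>\<close> is nonzero and that the
  degree is exactly \<open>D n\<close>, so these facts are recorded on the same event.\<close>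

lemma lead_lower:
  assumes "s > sc" "e > 0"
  shows "whp M (\<lambda>n \<omega>. D n > 0 \<and> \<xi> n \<omega> \<noteq> 0 \<and> degree (P n \<omega>) = D n \<and>
     norm (lead_coeff (P n \<omega>)) * s ^ D n \<ge> exp (real (D n) * (U s - e)))"
proof -
  \<comment> \<open>The quarters pay for the ratio of \<open>h n * s\<close> to the critical radius,
    the limit \<open>g sc\<close>, the factor \<open>2 * D n + 3\<close> and the coefficient
    \<open>\<xi> n\<close>.\<close>
  have e4: "e / 4 > 0" using assms by simp
  show ?thesis
  proof (rule whp_mono[OF whp_coeff_ge[OF D_inf e4, of "\<lambda>n. n"]])
    show "\<forall>\<^sub>F n in sequentially. \<forall>\<omega>\<in>space M. exp (- (e / 4 * real (D n))) \<le> norm (\<xi> n \<omega>) \<longrightarrow>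
       D n > 0 \<and> \<xi> n \<omega> \<noteq> 0 \<and> degree (P n \<omega>) = D n \<and>
       norm (lead_coeff (P n \<omega>)) * s ^ D n \<ge> exp (real (D n) * (U s - e))"
      using ev_above[OF assms(1) e4] ev_g_sc[OF e4] ev_poly_le_exp[OF e4] D_pos
    proof eventually_elim
      fix n
      let ?\<rho> = "real (D n) / real n"
      assume a: "h n * s > ?\<rho> \<and> \<bar>ln (h n * s / ?\<rho>) - ln (s / sc)\<bar> \<le> e / 4"
        and gg: "\<bar>- (real (N n) * ln (1 - ?\<rho>)) - real (D n) * g sc\<bar> \<le> real (D n) * (e / 4)"
        and pe: "2 * real (D n) + 3 \<le> exp (e / 4 * real (D n))" and D: "D n > 0"
      have rho: "?\<rho> > 0" using D N_le[of n] by auto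
      have hp: "h n > 0" using h_pos[OF D] .
      have q1: "h n * s / ?\<rho> > 1" using a rho by (simp only: pos_less_divide_eq mult_1)
      show "\<forall>\<omega>\<in>space M. exp (- (e / 4 * real (D n))) \<le> norm (\<xi> n \<omega>) \<longrightarrow>
       D n > 0 \<and> \<xi> n \<omega> \<noteq> 0 \<and> degree (P n \<omega>) = D n \<and>
       norm (lead_coeff (P n \<omega>)) * s ^ D n \<ge> exp (real (D n) * (U s - e))"
      proof (intro ballI impI conjI D)
        fix \<omega> assume x: "exp (- (e / 4 * real (D n))) \<le> norm (\<xi> n \<omega>)"
        have "norm (\<xi> n \<omega>) > 0" using x exp_gt_zero less_le_trans by blast
        then show nz: "\<xi> n \<omega> \<noteq> 0" by simp
        note L = scaled_poly_lead[of "N n" n "h n" \<xi> \<omega>, OF N_le _ nz]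
        show "degree (P n \<omega>) = D n" using L(1) hp by simp
        have "exp (real (D n) * (U s - e)) \<le>
            exp (- (real (N n) * ln (1 - ?\<rho>)) + real (D n) * ln (h n * s / ?\<rho>) + (- (e / 4 * real (D n))) + (- (e / 4 * real (D n))))"
        proof -
          have "real (D n) * (ln (s / sc) - e / 4) \<le> real (D n) * ln (h n * s / ?\<rho>)"
            by (rule mult_left_mono) (use a in linarith)+
          moreover have "real (D n) * (U s - e) = real (D n) * g sc + real (D n) * (ln (s / sc) - e / 4) - 3 * (real (D n) * (e / 4))"
            using assms by (simp add: U_def algebra_simps)
          moreover have c: "e / 4 * real (D n) = real (D n) * (e / 4)" by simp
          ultimately show ?thesis using gg unfolding c exp_le_cancel_iff by linarith
        qed
        also have "\<dots> = exp (- (real (N n) * ln (1 - ?\<rho>))) * (h n * s / ?\<rho>) ^ D n * exp (- (e / 4 * real (D n))) * exp (- (e / 4 * real (D n)))"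
        proof -
          have pw: "(h n * s / ?\<rho>) ^ D n = exp (real (D n) * ln (h n * s / ?\<rho>))"
            using q1 by (simp add: exp_of_nat_mult)
          show ?thesis by (simp only: exp_add pw)
        qed
        also have "\<dots> \<le> (real (n choose D n) * ?\<rho> ^ D n * (2 * real (D n) + 3)) * (h n * s / ?\<rho>) ^ D n * exp (- (e / 4 * real (D n))) * norm (\<xi> n \<omega>)"
          using binomial_critical_lower[OF n_eq D] x q1 by (intro mult_mono) auto
        also have "\<dots> \<le> (real (n choose D n) * ?\<rho> ^ D n * exp (e / 4 * real (D n))) * (h n * s / ?\<rho>) ^ D n * exp (- (e / 4 * real (D n))) * norm (\<xi> n \<omega>)"
          using pe q1 rho by (intro mult_right_mono mult_left_mono) auto
        also have "\<dots> = real (n choose D n) * (?\<rho> ^ D n * (h n * s / ?\<rho>) ^ D n) * (exp (e / 4 * real (D n)) * exp (- (e / 4 * real (D n)))) * norm (\<xi> n \<omega>)"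
          by (simp only: mult_ac)
        also have "exp (e / 4 * real (D n)) * exp (- (e / 4 * real (D n))) = 1"
          by (simp add: exp_minus)
        also have "?\<rho> ^ D n * (h n * s / ?\<rho>) ^ D n = (h n * s) ^ D n"
          by (rule power_eq_scaled[symmetric]) (use rho in linarith)
        also have "real (n choose D n) * (h n * s) ^ D n * 1 * norm (\<xi> n \<omega>) = norm (lead_coeff (P n \<omega>)) * s ^ D n"
          using L(2) hp by (simp add: norm_mult norm_power power_mult_distrib abs_mult)
        finally show "norm (lead_coeff (P n \<omega>)) * s ^ D n \<ge> exp (real (D n) * (U s - e))" .
      qed
    qed
  qed
qed

end

section \<open>Lower bounds in every disc\<close>

lemma arc_in_ball:
  fixes a :: complex
  assumes "of_real s * cis \<alpha> \<in> ball a \<tau>"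
  shows "\<exists>m>0. \<forall>\<theta>. \<bar>\<theta> - \<alpha>\<bar> \<le> pi / real m \<longrightarrow> of_real s * cis \<theta> \<in> ball a \<tau>"
proof -
  have "open ((\<lambda>\<theta>. of_real s * cis \<theta>) -` ball a \<tau>)"
    by (intro open_vimage continuous_intros) auto
  then obtain d where d: "d > 0" "\<And>\<theta>. dist \<theta> \<alpha> < d \<Longrightarrow> of_real s * cis \<theta> \<in> ball a \<tau>"
    using assms unfolding open_dist by (metis vimageE vimageI2 vimage_eq)
  obtain m :: nat where m: "real m > pi / d" using reals_Archimedean2 by blast
  have m0: "m > 0" using m d(1) pi_gt_zero by (metis divide_pos_pos gr0I less_trans of_nat_0 less_irrefl)
  have "pi / real m < d" using m m0 d(1) by (simp add: field_simps)
  then show ?thesis using d(2) m0 by (intro exI[of _ m]) (auto simp: dist_real_def)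
qed

text \<open>Cancelling \<open>m - 1\<close> upper bounds against \<open>m\<close> lower bounds
  accumulates \<open>2 * m - 1\<close> errors, which is why each is taken as
  \<open>e / (2 * m)\<close>. This is affordable because \<open>m\<close> depends only on the disc
  and not on the degree.\<close>

lemma exp_power_quotient:
  assumes le: "exp (d * (u - e / (2 * real m))) ^ m \<le> y * exp (d * (u + e / (2 * real m))) ^ (m - 1)"
    and m: "m > 0" and "d \<ge> 0" "e > 0"
  shows "exp (d * (u - e)) \<le> y"
proof -
  define e' where "e' = e / (2 * real m)"
  have "exp (real m * (d * (u - e'))) \<le> y * exp ((real m - 1) * (d * (u + e')))"
    using le m by (simp add: e'_def exp_of_nat_mult[symmetric] of_nat_diff)
  then have "exp (real m * (d * (u - e')) - (real m - 1) * (d * (u + e'))) \<le> y"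
    by (simp add: exp_diff divide_le_eq)
  moreover have "real m * (d * (u - e')) - (real m - 1) * (d * (u + e')) = d * (u - (2 * real m - 1) * e')"
    by (simp add: algebra_simps)
  moreover have "d * (u - e) \<le> d * (u - (2 * real m - 1) * e')"
  proof (intro mult_left_mono)
    have "(2 * real m - 1) * e' \<le> 2 * real m * e'" using assms by (intro mult_right_mono) (auto simp: e'_def)
    also have "\<dots> = e" using m by (simp add: e'_def)
    finally show "u - e \<le> u - (2 * real m - 1) * e'" by simp
  qed fact
  ultimately show ?thesis using exp_le_cancel_iff order_trans by metis
qed

context kac_scaling
begin

lemma lower_outer:
  assumes s: "s > sc" and b: "of_real s * cis \<alpha> \<in> ball a \<tau>" and e: "e > 0"
  shows "whp M (\<lambda>n \<omega>. \<exists>z\<in>ball a \<tau>. norm (poly (P n \<omega>) z) \<ge> exp (real (D n) * (U (norm z) - e)))"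
proof -
  have s0: "s > 0" using s sc_pos by simp
  obtain m where m: "m > 0" "\<And>\<theta>. \<bar>\<theta> - \<alpha>\<bar> \<le> pi / real m \<Longrightarrow> of_real s * cis \<theta> \<in> ball a \<tau>"
    using arc_in_ball[OF b] by blast
  define e' where "e' = e / (2 * real m)"
  have e': "e' > 0" using e m by (simp add: e'_def)
  have up: "whp M (\<lambda>n \<omega>. \<forall>z. norm z \<le> s \<longrightarrow> norm (poly (P n \<omega>) z) \<le> exp (real (D n) * (U s + e')))"
    using s0 e' by (intro upper) auto
  show ?thesis
  proof (rule whp_mono[OF whp_conj[OF up lead_lower[OF s e']]], intro always_eventually allI ballI impI)
    fix n \<omega>
    assume "(\<forall>z. norm z \<le> s \<longrightarrow> norm (poly (P n \<omega>) z) \<le> exp (real (D n) * (U s + e'))) \<and>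
      0 < D n \<and> \<xi> n \<omega> \<noteq> 0 \<and> degree (P n \<omega>) = D n \<and> norm (lead_coeff (P n \<omega>)) * s ^ D n \<ge> exp (real (D n) * (U s - e'))"
    then have B: "\<And>z. norm z = s \<Longrightarrow> norm (poly (P n \<omega>) z) \<le> exp (real (D n) * (U s + e'))"
      and deg: "degree (P n \<omega>) = D n" and l: "exp (real (D n) * (U s - e')) \<le> norm (lead_coeff (P n \<omega>)) * s ^ D n" by auto
    from arc_point_outer[OF s0 m(1) B, of \<alpha>] obtain \<theta> where \<theta>: "\<bar>\<theta> - \<alpha>\<bar> \<le> pi / real m"
      "(norm (lead_coeff (P n \<omega>)) * s ^ D n) ^ m \<le>
        norm (poly (P n \<omega>) (of_real s * cis \<theta>)) * exp (real (D n) * (U s + e')) ^ (m - 1)"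
      unfolding deg by blast
    let ?z = "of_real s * cis \<theta>"
    have nz: "norm ?z = s" using s0 by (simp add: norm_mult)
    have "exp (real (D n) * (U s - e')) ^ m \<le> (norm (lead_coeff (P n \<omega>)) * s ^ D n) ^ m"
      using l by (intro power_mono) auto
    from order_trans[OF this \<theta>(2)] have "exp (real (D n) * (U (norm ?z) - e)) \<le> norm (poly (P n \<omega>) ?z)"
      unfolding nz e'_def using m(1) e by (intro exp_power_quotient) auto
    then show "\<exists>z\<in>ball a \<tau>. norm (poly (P n \<omega>) z) \<ge> exp (real (D n) * (U (norm z) - e))"
      using m(2)[OF \<theta>(1)] by blast
  qed
qed

lemma lower_inner_zero:
  assumes s: "0 < s" "s < sc" "g s = 0" and b: "of_real s * cis \<alpha> \<in> ball a \<tau>" and e: "e > 0"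
  shows "whp M (\<lambda>n \<omega>. \<exists>z\<in>ball a \<tau>. norm (poly (P n \<omega>) z) \<ge> exp (real (D n) * (U (norm z) - e)))"
proof -
  have Us: "U s = 0" using s by (simp add: U_def)
  obtain m where m: "m > 0" "\<And>\<theta>. \<bar>\<theta> - \<alpha>\<bar> \<le> pi / real m \<Longrightarrow> of_real s * cis \<theta> \<in> ball a \<tau>"
    using arc_in_ball[OF b] by blast
  define e' where "e' = e / (2 * real m)"
  have e': "e' > 0" using e m by (simp add: e'_def)
  have up: "whp M (\<lambda>n \<omega>. \<forall>z. norm z \<le> s \<longrightarrow> norm (poly (P n \<omega>) z) \<le> exp (real (D n) * (U s + e')))"
    using s e' by (intro upper) auto
  show ?thesis
  proof (rule whp_mono[OF whp_conj[OF up whp_coeff_ge[OF D_inf e', of N]]], intro always_eventually allI ballI impI)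
    fix n \<omega>
    assume "(\<forall>z. norm z \<le> s \<longrightarrow> norm (poly (P n \<omega>) z) \<le> exp (real (D n) * (U s + e'))) \<and>
      exp (- (e' * real (D n))) \<le> norm (\<xi> (N n) \<omega>)"
    then have B: "\<And>z. norm z = s \<Longrightarrow> norm (poly (P n \<omega>) z) \<le> exp (real (D n) * e')"
      and l: "exp (- (e' * real (D n))) \<le> norm (\<xi> (N n) \<omega>)" using Us by auto
    have p0: "poly (P n \<omega>) 0 = \<xi> (N n) \<omega>"
      using N_le[of n] by (simp add: poly_0_coeff_0 coeff_scaled_poly)
    from arc_point_inner[OF s(1) m(1) B, of \<alpha>] obtain \<theta> where \<theta>: "\<bar>\<theta> - \<alpha>\<bar> \<le> pi / real m"
      "norm (\<xi> (N n) \<omega>) ^ m \<le> norm (poly (P n \<omega>) (of_real s * cis \<theta>)) * exp (real (D n) * e') ^ (m - 1)"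
      unfolding p0 by blast
    let ?z = "of_real s * cis \<theta>"
    have nz: "norm ?z = s" using s by (simp add: norm_mult)
    have "exp (- (e' * real (D n))) ^ m \<le> norm (\<xi> (N n) \<omega>) ^ m"
      using l by (intro power_mono) auto
    from order_trans[OF this \<theta>(2)] have "exp (real (D n) * (U (norm ?z) - e)) \<le> norm (poly (P n \<omega>) ?z)"
      unfolding nz e'_def Us using m(1) e by (intro exp_power_quotient) (auto simp: mult.commute)
    then show "\<exists>z\<in>ball a \<tau>. norm (poly (P n \<omega>) z) \<ge> exp (real (D n) * (U (norm z) - e))"
      using m(2)[OF \<theta>(1)] by blast
  qed
qed

text \<open>At a point whose argument is a rational multiple of \<open>\<pi>\<close>, the terms of maximal modulus whose
  indices differ by multiples of the denominator have the same phase, so a growing number of the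
  coefficients enters the value with nearly equal weights.\<close>

lemma lower_inner_mode:
  assumes s: "0 < s" "s < sc" and lim: "filterlim (\<lambda>n. nb_mode (N n) (h n * s)) at_top sequentially"
    and b: "of_real s * cis \<alpha> \<in> ball a \<tau>" and e: "e > 0"
  shows "whp M (\<lambda>n \<omega>. \<exists>z\<in>ball a \<tau>. norm (poly (P n \<omega>) z) \<ge> exp (real (D n) * (U (norm z) - e)))"
proof -
  obtain m where m: "m > 0" "\<And>\<theta>. \<bar>\<theta> - \<alpha>\<bar> \<le> pi / real m \<Longrightarrow> of_real s * cis \<theta> \<in> ball a \<tau>"
    using arc_in_ball[OF b] by blast
  \<comment> \<open>The same \<open>m\<close> serves twice: multiples of \<open>2 * pi / m\<close>
    are dense enough to meet the arc of half-width \<open>pi / m\<close> about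
    \<open>\<alpha>\<close>, and such an argument makes the phase \<open>\<eta>\<close> an
    \<open>m\<close>-th root of unity.\<close>
  obtain p :: int where p: "\<bar>0 + 2 * pi * of_int p / real m - \<alpha>\<bar> \<le> pi / real m"
    using rotation_near[OF m(1)] by blast
  define \<theta> where "\<theta> = 2 * pi * of_int p / real m"
  have "\<bar>\<theta> - \<alpha>\<bar> \<le> pi / real m" using p by (simp add: \<theta>_def)
  define \<eta> where "\<eta> = cis \<theta>"
  define z0 where "z0 = of_real s * \<eta>"
  have z0: "z0 \<in> ball a \<tau>" "norm z0 = s"
    using m(2)[OF \<open>\<bar>\<theta> - \<alpha>\<bar> \<le> pi / real m\<close>] s by (auto simp: z0_def \<eta>_def norm_mult)
  have \<eta>: "\<eta> ^ m = 1" "\<eta> \<noteq> 0" "norm \<eta> = 1"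
  proof -
    have "\<eta> ^ m = cis (real m * \<theta>)" by (simp only: \<eta>_def Complex.DeMoivre)
    moreover have "real m * \<theta> = 2 * pi * of_int p" using m(1) by (simp add: \<theta>_def)
    ultimately show "\<eta> ^ m = 1" by (simp add: cis_multiple_2pi)
  qed (auto simp: \<eta>_def)
  define x where "x n = h n * s" for n
  define k0 where "k0 n = nat \<lfloor>nb_mode (N n) (x n)\<rfloor>" for n
  define w where "w n k = nbw (N n) (x n) k" for n k
  \<comment> \<open>These are the coefficients of the value at \<open>z0\<close> after division by
    the modal weight and the phase at the mode. At the indices \<open>k0 n + m * j\<close> the
    phases cancel because \<open>\<eta> ^ m = 1\<close>, leaving positive weights that tend to
    1.\<close>
  define c where "c n k = of_real (w n k / w n (k0 n)) * \<eta> ^ k / \<eta> ^ k0 n" for n k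
  have below: "\<forall>\<^sub>F n in sequentially. 0 < x n \<and> x n < real (D n) / real n \<and> x n < 1"
    unfolding x_def by (rule ev_below[OF s])
  have mode_le: "\<forall>\<^sub>F n in sequentially. nb_mode (N n) (x n) \<le> real n * x n"
    using below D_pos by eventually_elim (rule nb_mode_le[OF n_eq], auto)
  have fit: "\<forall>\<^sub>F n in sequentially. k0 n + m * L \<le> D n" for L
  proof -
    \<comment> \<open>Strictly inside the critical radius the mode stays below
      \<open>t * D n\<close> for a fixed \<open>t < 1\<close>, so about \<open>(1 - t) * D n\<close>
      indices remain above it, eventually more than \<open>m * L\<close>.\<close>
    define t where "t = (1 + s / sc) / 2"
    have t: "s / sc < t" "t < 1" using s sc_pos by (auto simp: t_def field_simps)
    have 1: "\<forall>\<^sub>F n in sequentially. x n / (real (D n) / real n) < t"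
      using ratio_lim[OF s(1)] t(1) unfolding x_def by (intro order_tendstoD) auto
    have 2: "\<forall>\<^sub>F n in sequentially. real (D n) \<ge> real (m * L) / (1 - t)"
      using D_real_inf by (simp add: filterlim_at_top)
    from 1 2 mode_le below D_pos show ?thesis
    proof eventually_elim
      fix n
      assume r: "x n / (real (D n) / real n) < t" and dl: "real (D n) \<ge> real (m * L) / (1 - t)"
        and ml: "nb_mode (N n) (x n) \<le> real n * x n"
        and bl: "0 < x n \<and> x n < real (D n) / real n \<and> x n < 1" and D: "D n > 0"
      have "real n * x n = real (D n) * (x n / (real (D n) / real n))" using D by simp
      also have "\<dots> \<le> real (D n) * t" using r by (intro mult_left_mono) auto
      finally have "nb_mode (N n) (x n) \<le> real (D n) * t" using ml by simp
      moreover have "real (m * L) \<le> real (D n) * (1 - t)" using dl t by (simp add: field_simps)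
      moreover have "real (k0 n) \<le> nb_mode (N n) (x n)"
        using nb_mode_nonneg[of "x n" "N n"] bl unfolding k0_def by simp
      ultimately have "real (k0 n) + real (m * L) \<le> real (D n) * t + real (D n) * (1 - t)" by linarith
      also have "\<dots> = real (D n)" by (simp add: algebra_simps)
      finally show "k0 n + m * L \<le> D n" by linarith
    qed
  qed
  have blim: "(\<lambda>n. w n (k0 n + m * j) / w n (k0 n)) \<longlonglongrightarrow> 1" for j
    unfolding w_def k0_def
  proof (rule nbw_near_mode)
    show "\<forall>\<^sub>F n in sequentially. 0 < x n \<and> x n < 1" using below by eventually_elim auto
    show "filterlim (\<lambda>n. nb_mode (N n) (x n)) at_top sequentially" unfolding x_def by (rule lim)
  qed
  have ceq: "c n (k0 n + m * j) = complex_of_real (w n (k0 n + m * j) / w n (k0 n))" for n j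
    using \<eta> by (simp add: c_def power_add power_mult)
  have ac: "whp M (\<lambda>n \<omega>. norm (\<Sum>k\<le>D n. c n k * \<xi> (N n + k) \<omega>) \<ge> 1)"
    by (rule anticoncentration[where b="\<lambda>n j. w n (k0 n + m * j) / w n (k0 n)" and q=m and ?k0.0=k0, OF fit m(1)])
       (rule blim ceq)+
  have e2: "e / 2 > 0" using e by simp
  show ?thesis
  proof (rule whp_mono[OF ac])
    show "\<forall>\<^sub>F n in sequentially. \<forall>\<omega>\<in>space M. 1 \<le> norm (\<Sum>k\<le>D n. c n k * \<xi> (N n + k) \<omega>) \<longrightarrow>
       (\<exists>z\<in>ball a \<tau>. norm (poly (P n \<omega>) z) \<ge> exp (real (D n) * (U (norm z) - e)))"
      using below mode_le ev_g[OF s e2] ev_poly_le_exp[OF e2] D_pos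
    proof eventually_elim
      fix n
      assume bl: "0 < x n \<and> x n < real (D n) / real n \<and> x n < 1" and ml: "nb_mode (N n) (x n) \<le> real n * x n"
        and gg: "\<bar>- (real (N n) * ln (1 - h n * s)) - real (D n) * g s\<bar> \<le> real (D n) * (e / 2)"
        and pe: "2 * real (D n) + 3 \<le> exp (e / 2 * real (D n))" and D: "D n > 0"
      have w0: "w n (k0 n) > 0" unfolding w_def using bl by (intro nbw_pos) auto
      have "real n * x n \<le> real (D n)" using bl D by (simp add: field_simps)
      then have "nb_mode (N n) (x n) \<le> real (D n)" using ml by simp
      then have "w n (k0 n) * (2 * nb_mode (N n) (x n) + 3) \<le> w n (k0 n) * (2 * real (D n) + 3)"
        using w0 by (intro mult_left_mono) auto
      moreover have "1 \<le> w n (k0 n) * (2 * nb_mode (N n) (x n) + 3)"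
        unfolding w_def k0_def using bl by (intro nbw_mode_lower) auto
      moreover have "w n (k0 n) * (2 * real (D n) + 3) \<le> w n (k0 n) * exp (e / 2 * real (D n))"
        using pe w0 by (intro mult_left_mono) auto
      ultimately have "1 \<le> w n (k0 n) * exp (e / 2 * real (D n))" by linarith
      then have wl: "exp (- (e / 2 * real (D n))) \<le> w n (k0 n)" by (simp add: exp_minus field_simps)
      have eN: "exp (- (real (N n) * ln (1 - x n))) * (1 - x n) ^ N n = 1"
        using bl by (simp add: exp_minus exp_of_nat_mult)
      show "\<forall>\<omega>\<in>space M. 1 \<le> norm (\<Sum>k\<le>D n. c n k * \<xi> (N n + k) \<omega>) \<longrightarrow>
         (\<exists>z\<in>ball a \<tau>. norm (poly (P n \<omega>) z) \<ge> exp (real (D n) * (U (norm z) - e)))"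
      proof (intro ballI impI)
        fix \<omega> assume H: "1 \<le> norm (\<Sum>k\<le>D n. c n k * \<xi> (N n + k) \<omega>)"
        have "c n k * \<xi> (N n + k) \<omega> =
           (of_real (real ((N n + k) choose k) * h n ^ k) * \<xi> (N n + k) \<omega> * z0 ^ k) * of_real ((1 - x n) ^ N n) / (of_real (w n (k0 n)) * \<eta> ^ k0 n)" for k
          unfolding c_def w_def nbw_def[of _ _ k] x_def z0_def by (simp add: power_mult_distrib mult_ac)
        then have eq: "(\<Sum>k\<le>D n. c n k * \<xi> (N n + k) \<omega>) =
           poly (P n \<omega>) z0 * of_real ((1 - x n) ^ N n) / (of_real (w n (k0 n)) * \<eta> ^ k0 n)"
          unfolding poly_scaled_poly[OF N_le] by (simp only: sum_distrib_right sum_divide_distrib)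
        have "norm (\<Sum>k\<le>D n. c n k * \<xi> (N n + k) \<omega>) = norm (poly (P n \<omega>) z0) * (1 - x n) ^ N n / w n (k0 n)"
        proof -
          have "norm (complex_of_real ((1 - x n) ^ N n)) = (1 - x n) ^ N n"
            using bl by (simp only: norm_of_real) simp
          then show ?thesis using eq w0 \<eta>(3)
            by (simp add: norm_mult norm_divide norm_power del: of_real_power of_real_diff)
        qed
        then have Pl: "w n (k0 n) \<le> norm (poly (P n \<omega>) z0) * (1 - x n) ^ N n"
          using H w0 by (simp only: pos_le_divide_eq mult_1)
        have "exp (real (D n) * (U s - e)) \<le> exp (- (real (N n) * ln (1 - x n)) + (- (e / 2 * real (D n))))"
        proof -
          have "real (D n) * (U s - e) = real (D n) * g s - 2 * (real (D n) * (e / 2))"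
            using s by (simp add: U_def algebra_simps)
          moreover have ce: "e / 2 * real (D n) = real (D n) * (e / 2)" by simp
          ultimately show ?thesis using gg unfolding ce exp_le_cancel_iff x_def by linarith
        qed
        also have "\<dots> = exp (- (real (N n) * ln (1 - x n))) * exp (- (e / 2 * real (D n)))" by (rule exp_add)
        also have "\<dots> \<le> exp (- (real (N n) * ln (1 - x n))) * (norm (poly (P n \<omega>) z0) * (1 - x n) ^ N n)"
          using wl Pl by (intro mult_left_mono) auto
        also have "\<dots> = norm (poly (P n \<omega>) z0) * (exp (- (real (N n) * ln (1 - x n))) * (1 - x n) ^ N n)"
          by (simp only: mult_ac)
        also have "\<dots> = norm (poly (P n \<omega>) z0)" unfolding eN by simp
        finally show "\<exists>z\<in>ball a \<tau>. norm (poly (P n \<omega>) z) \<ge> exp (real (D n) * (U (norm z) - e))"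
          using z0 by (intro bexI[of _ z0]) auto
      qed
    qed
  qed
qed

text \<open>The estimates need a point off the critical circle, so that its side is decided, and off
  the origin, where there is no circle to move along. Every disc contains such a point, and small
  changes within the disc are harmless because any of its points may serve.\<close>

lemma lower:
  assumes \<tau>: "\<tau> > 0" and e: "e > 0"
  shows "whp M (\<lambda>n \<omega>. \<exists>z\<in>ball a \<tau>. norm (poly (P n \<omega>) z) \<ge> exp (real (D n) * (U (norm z) - e)))"
proof -
  obtain z1 where z1: "z1 \<in> ball a \<tau>" "norm z1 \<noteq> sc" using exists_in_ball_norm_neq[OF \<tau>] by blast
  obtain d where d: "d > 0" "ball z1 d \<subseteq> ball a \<tau>" using z1(1) open_ball openE by blast
  define d' where "d' = min d \<bar>norm z1 - sc\<bar>"
  have d': "d' > 0" using d z1 by (auto simp: d'_def)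
  obtain z where z: "z \<in> ball z1 d'" "norm z \<noteq> 0" using exists_in_ball_norm_neq[OF d'] by blast
  have "\<bar>norm z - norm z1\<bar> \<le> dist z1 z" using norm_triangle_ineq3[of z z1] by (simp add: dist_norm norm_minus_commute)
  then have "norm z \<noteq> sc" using z(1) by (auto simp: d'_def)
  moreover have zb: "z \<in> ball a \<tau>" using z d by (auto simp: d'_def)
  moreover define s where "s = norm z"
  moreover define \<alpha> where "\<alpha> = Arg z"
  ultimately have s: "s > 0" "s \<noteq> sc" and b: "of_real s * cis \<alpha> \<in> ball a \<tau>"
    using z(2) rcis_cmod_Arg[of z] by (auto simp: rcis_def)
  show ?thesis
  proof (cases "s > sc")
    case True
    then show ?thesis using lower_outer[OF _ b e] by simp
  next
    case False
    then have s': "s < sc" using s by simp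
    show ?thesis using inner
    proof
      assume "\<forall>s. 0 < s \<and> s < sc \<longrightarrow> g s = 0"
      then show ?thesis using lower_inner_zero[OF s(1) s' _ b e] s s' by blast
    next
      assume "\<forall>s. 0 < s \<and> s < sc \<longrightarrow> filterlim (\<lambda>n. nb_mode (N n) (h n * s)) at_top sequentially"
      then show ?thesis using lower_inner_mode[OF s(1) s' _ b e] s s' by blast
    qed
  qed
qed

section \<open>Convergence of the zero counting measures\<close>

theorem main_convergence:
  assumes "C2_compact f fx fy fxx fyy R"
  shows "conv_in_prob M (\<lambda>n \<omega>. zero_integral ((pderiv ^^ N n) (kac_poly \<xi> n \<omega>)) (\<lambda>z. f (z / of_real (h n))) / real (D n))
     ((\<integral>z. U (norm z) * C2_compact.lap fxx fyy z \<partial>lborel) / (2 * pi))"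
proof (rule conv_in_probI)
  interpret C2_compact f fx fy fxx fyy R by fact
  fix \<epsilon> :: real assume "\<epsilon> > 0"
  have Uc: "continuous_on {0..} U" using U_cont unfolding U_def .
  from potential_control[OF Uc \<open>\<epsilon> > 0\<close>] obtain e \<tau> A where eA: "e > 0" "\<tau> > 0" "finite A"
    and ctrl: "\<And>p. degree p > 0 \<Longrightarrow>
      (\<And>a z. a \<in> A \<Longrightarrow> norm z \<le> norm a + 4 * \<tau> \<Longrightarrow>
          norm (poly p z) \<le> exp (degree p * (U (norm a + 4 * \<tau>) + e))) \<Longrightarrow>
      (\<And>a. a \<in> A \<Longrightarrow> \<exists>z\<in>ball a \<tau>. norm (poly p z) \<ge> exp (degree p * (U (norm z) - e))) \<Longrightarrow>
      \<bar>zero_integral p f / degree p - (\<integral>z. U (norm z) * lap z \<partial>lborel) / (2 * pi)\<bar> \<le> \<epsilon>"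
    by blast
  have up: "whp M (\<lambda>n \<omega>. \<forall>a\<in>A. \<forall>z. norm z \<le> norm a + 4 * \<tau> \<longrightarrow>
      norm (poly (P n \<omega>) z) \<le> exp (real (D n) * (U (norm a + 4 * \<tau>) + e)))"
    using eA by (intro whp_ball_finite upper) auto
  have low: "whp M (\<lambda>n \<omega>. \<forall>a\<in>A. \<exists>z\<in>ball a \<tau>. norm (poly (P n \<omega>) z) \<ge> exp (real (D n) * (U (norm z) - e)))"
    using eA by (intro whp_ball_finite lower) auto
  \<comment> \<open>An arbitrary radius beyond the critical one; it supplies the exact degree and
    the nonvanishing of the top coefficient.\<close>
  have "sc + 1 > sc" by simp
  note deg = lead_lower[OF this eA(1)]
  show "whp M (\<lambda>n \<omega>. \<bar>zero_integral ((pderiv ^^ N n) (kac_poly \<xi> n \<omega>)) (\<lambda>z. f (z / of_real (h n))) / real (D n) -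
       (\<integral>z. U (norm z) * lap z \<partial>lborel) / (2 * pi)\<bar> \<le> \<epsilon>)"
  proof (rule whp_mono[OF whp_conj[OF deg whp_conj[OF up low]]], intro always_eventually allI ballI impI)
    fix n \<omega>
    assume H: "(0 < D n \<and> \<xi> n \<omega> \<noteq> 0 \<and> degree (P n \<omega>) = D n \<and>
        exp (real (D n) * (U (sc + 1) - e)) \<le> norm (lead_coeff (P n \<omega>)) * (sc + 1) ^ D n) \<and>
      (\<forall>a\<in>A. \<forall>z. norm z \<le> norm a + 4 * \<tau> \<longrightarrow> norm (poly (P n \<omega>) z) \<le> exp (real (D n) * (U (norm a + 4 * \<tau>) + e))) \<and>
      (\<forall>a\<in>A. \<exists>z\<in>ball a \<tau>. exp (real (D n) * (U (norm z) - e)) \<le> norm (poly (P n \<omega>) z))"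
    then have "\<bar>zero_integral (P n \<omega>) f / degree (P n \<omega>) - (\<integral>z. U (norm z) * lap z \<partial>lborel) / (2 * pi)\<bar> \<le> \<epsilon>"
      by (intro ctrl) auto
    moreover have "h n \<noteq> 0" using h_pos[of n] H by auto
    ultimately show "\<bar>zero_integral ((pderiv ^^ N n) (kac_poly \<xi> n \<omega>)) (\<lambda>z. f (z / of_real (h n))) / real (D n) -
       (\<integral>z. U (norm z) * lap z \<partial>lborel) / (2 * pi)\<bar> \<le> \<epsilon>"
      using H zero_integral_scaled_poly[of "N n" n "h n" \<xi> \<omega> f, OF N_le] by simp
  qed
qed

text \<open>In the rescaled variable the upper bound and the leading term agree on the circle of
  radius \<open>s > sc\<close> up to \<open>exp (2 * e * D)\<close>, so all but a small fraction of
  the zeros lie within \<open>2 * s\<close>. In the original variable these are within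
  \<open>h n * (2 * s)\<close>, which tends to 0, and the boundedness of \<open>f\<close> takes care
  of the rest.\<close>

lemma collapse_to_zero:
  fixes f :: "complex \<Rightarrow> real"
  assumes h0: "h \<longlonglongrightarrow> 0" and c: "continuous_on UNIV f" and C: "\<And>z. \<bar>f z\<bar> \<le> C"
  shows "conv_in_prob M (\<lambda>n \<omega>. zero_integral ((pderiv ^^ N n) (kac_poly \<xi> n \<omega>)) f / real (D n)) (f 0)"
proof (rule conv_in_probI)
  fix \<epsilon> :: real assume eps: "\<epsilon> > 0"
  have C0: "C \<ge> 0" using C[of 0] by (auto intro: order_trans[OF abs_ge_zero])
  define s where "s = sc + 1"
  have s: "s > sc" "s > 0" using sc_pos by (auto simp: s_def)
  \<comment> \<open>At most \<open>2 * e * D / ln 2\<close> zeros escape, each changing the sum by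
    at most \<open>2 * C\<close>; with this \<open>e\<close> their contribution is at most
    \<open>\<epsilon> / 2 * D\<close>. Using \<open>C + 1\<close> avoids division by 0.\<close>
  define e where "e = \<epsilon> * ln 2 / (8 * (C + 1))"
  have e: "e > 0" using eps C0 by (simp add: e_def)
  have "isCont f 0" using c by (simp add: continuous_on_eq_continuous_at)
  then obtain d where d: "d > 0" "\<And>z. norm z < d \<Longrightarrow> \<bar>f z - f 0\<bar> < \<epsilon> / 2"
    using eps unfolding continuous_at_eps_delta dist_real_def by (metis dist_0_norm dist_commute half_gt_zero)
  have "(\<lambda>n. h n * (2 * s)) \<longlonglongrightarrow> 0 * (2 * s)" by (intro tendsto_mult h0 tendsto_const)
  then have hs: "\<forall>\<^sub>F n in sequentially. h n * (2 * s) < d" using d(1) by (intro order_tendstoD) auto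
  have up: "whp M (\<lambda>n \<omega>. \<forall>z. norm z \<le> s \<longrightarrow> norm (poly (P n \<omega>) z) \<le> exp (real (D n) * (U s + e)))"
    using s e by (intro upper) auto
  show "whp M (\<lambda>n \<omega>. \<bar>zero_integral ((pderiv ^^ N n) (kac_poly \<xi> n \<omega>)) f / real (D n) - f 0\<bar> \<le> \<epsilon>)"
  proof (rule whp_mono[OF whp_conj[OF lead_lower[OF s(1) e] up]])
    show "\<forall>\<^sub>F n in sequentially. \<forall>\<omega>\<in>space M.
       (0 < D n \<and> \<xi> n \<omega> \<noteq> 0 \<and> degree (P n \<omega>) = D n \<and> exp (real (D n) * (U s - e)) \<le> norm (lead_coeff (P n \<omega>)) * s ^ D n) \<and>
       (\<forall>z. norm z \<le> s \<longrightarrow> norm (poly (P n \<omega>) z) \<le> exp (real (D n) * (U s + e))) \<longrightarrow>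
       \<bar>zero_integral ((pderiv ^^ N n) (kac_poly \<xi> n \<omega>)) f / real (D n) - f 0\<bar> \<le> \<epsilon>"
      using hs
    proof (eventually_elim, intro ballI impI)
      fix n \<omega>
      assume hsn: "h n * (2 * s) < d" and
        H: "(0 < D n \<and> \<xi> n \<omega> \<noteq> 0 \<and> degree (P n \<omega>) = D n \<and> exp (real (D n) * (U s - e)) \<le> norm (lead_coeff (P n \<omega>)) * s ^ D n) \<and>
          (\<forall>z. norm z \<le> s \<longrightarrow> norm (poly (P n \<omega>) z) \<le> exp (real (D n) * (U s + e)))"
      let ?p = "P n \<omega>"
      have deg: "degree ?p = D n" and D: "D n > 0" and nz: "\<xi> n \<omega> \<noteq> 0" using H by auto
      have p0: "?p \<noteq> 0" using deg D by auto
      have hp: "h n > 0" using h_pos[OF D] .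
      let ?T = "{w. poly ?p w = 0 \<and> norm w > 2 * s}" and ?Z = "{w. poly ?p w = 0}"
      have fin: "finite ?Z" using p0 by (rule poly_roots_finite)
      define K where "K = (\<Sum>w\<in>?T. order w ?p)"
      have "real K * ln 2 \<le> ln (exp (real (D n) * (U s + e))) - ln (norm (lead_coeff ?p) * s ^ degree ?p)"
        unfolding K_def using H by (intro zeros_outside_le[OF p0 s(2)]) auto
      also have "\<dots> \<le> real (D n) * (U s + e) - real (D n) * (U s - e)"
      proof -
        have "ln (exp (real (D n) * (U s - e))) \<le> ln (norm (lead_coeff ?p) * s ^ degree ?p)"
          using H by (intro ln_mono) auto
        then show ?thesis by simp
      qed
      also have "\<dots> = 2 * e * real (D n)" by (simp add: algebra_simps)
      finally have K: "real K * ln 2 \<le> 2 * e * real (D n)" .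
      have "2 * C * real K \<le> 2 * (C + 1) * real K" by (intro mult_right_mono) auto
      also have "\<dots> = 2 * (C + 1) / ln 2 * (real K * ln 2)" by simp
      also have "\<dots> \<le> 2 * (C + 1) / ln 2 * (2 * e * real (D n))"
        using C0 K by (intro mult_left_mono) auto
      also have "\<dots> = e * (8 * (C + 1)) / ln 2 * (real (D n) / 2)" by (simp add: algebra_simps add_divide_distrib)
      also have "e * (8 * (C + 1)) = \<epsilon> * ln 2" using C0 by (simp add: e_def)
      also have "\<epsilon> * ln 2 / ln 2 * (real (D n) / 2) = \<epsilon> / 2 * real (D n)" by simp
      finally have CK: "2 * C * real K \<le> \<epsilon> / 2 * real (D n)" .
      have "zero_integral ?p (\<lambda>w. f (of_real (h n) * w)) = zero_integral ((pderiv ^^ N n) (kac_poly \<xi> n \<omega>)) f"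
        using zero_integral_scaled_poly[of "N n" n "h n" \<xi> \<omega> "\<lambda>w. f (of_real (h n) * w)", OF N_le _ nz] hp by simp
      then have zi: "zero_integral ((pderiv ^^ N n) (kac_poly \<xi> n \<omega>)) f = (\<Sum>w\<in>?Z. real (order w ?p) * f (of_real (h n) * w))"
        by (simp add: zero_integral_def)
      have Dsum: "real (D n) = (\<Sum>w\<in>?Z. real (order w ?p))"
        using sum_order_eq_degree[OF p0] deg by (metis of_nat_sum)
      have diff: "zero_integral ((pderiv ^^ N n) (kac_poly \<xi> n \<omega>)) f - real (D n) * f 0 =
          (\<Sum>w\<in>?Z. real (order w ?p) * (f (of_real (h n) * w) - f 0))"
        unfolding zi Dsum by (simp add: right_diff_distrib sum_subtractf sum_distrib_right)
      have "\<bar>\<Sum>w\<in>?Z. real (order w ?p) * (f (of_real (h n) * w) - f 0)\<bar> \<le>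
          (\<Sum>w\<in>?Z. real (order w ?p) * (\<epsilon> / 2 + (if w \<in> ?T then 2 * C else 0)))"
      proof (rule order_trans[OF sum_abs], rule sum_mono)
        fix w assume w: "w \<in> ?Z"
        have "\<bar>f (of_real (h n) * w) - f 0\<bar> \<le> \<epsilon> / 2 + (if w \<in> ?T then 2 * C else 0)"
        proof (cases "w \<in> ?T")
          case True
          then show ?thesis using C[of "of_real (h n) * w"] C[of 0] eps by (simp only: if_True)
        next
          case False
          then have "norm w \<le> 2 * s" using w by auto
          then have "norm (of_real (h n) * w) \<le> h n * (2 * s)" using hp by (simp add: norm_mult)
          then have "\<bar>f (of_real (h n) * w) - f 0\<bar> < \<epsilon> / 2" using hsn by (intro d(2)) linarith
          then show ?thesis using False by (simp only: if_False)
        qed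
        then show "\<bar>real (order w ?p) * (f (of_real (h n) * w) - f 0)\<bar> \<le> real (order w ?p) * (\<epsilon> / 2 + (if w \<in> ?T then 2 * C else 0))"
          unfolding abs_mult by (intro mult_mono) auto
      qed
      also have "\<dots> = \<epsilon> / 2 * real (D n) + 2 * C * real K"
      proof -
        have "(\<Sum>w\<in>?Z. real (order w ?p) * (if w \<in> ?T then 2 * C else 0)) = (\<Sum>w\<in>?T. real (order w ?p) * (2 * C))"
          using fin by (intro sum.mono_neutral_cong_right) auto
        then show ?thesis
          unfolding Dsum K_def by (simp add: distrib_left sum.distrib sum_distrib_left sum_distrib_right mult_ac)
      qed
      also have "\<dots> \<le> \<epsilon> * real (D n)" using CK by simp
      finally have "\<bar>zero_integral ((pderiv ^^ N n) (kac_poly \<xi> n \<omega>)) f - real (D n) * f 0\<bar> / real (D n) \<le> \<epsilon>"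
        unfolding diff using D by (simp add: divide_le_eq)
      moreover have "zero_integral ((pderiv ^^ N n) (kac_poly \<xi> n \<omega>)) f / real (D n) - f 0 =
         (zero_integral ((pderiv ^^ N n) (kac_poly \<xi> n \<omega>)) f - real (D n) * f 0) / real (D n)"
        using D by (simp add: diff_divide_distrib)
      ultimately show "\<bar>zero_integral ((pderiv ^^ N n) (kac_poly \<xi> n \<omega>)) f / real (D n) - f 0\<bar> \<le> \<epsilon>"
        using D by (simp add: abs_divide)
    qed
  qed
qed

end

section \<open>Test functions as functions of compact support to which Green's formula
  applies\<close>

lemma dir_deriv_has_derivative:
  assumes "(\<lambda>t::real. f (z + of_real t * v)) differentiable (at 0)"
  shows "((\<lambda>t::real. f (z + of_real t * v)) has_real_derivative dir_deriv v f z) (at 0)"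
proof -
  obtain d where d: "((\<lambda>t::real. f (z + of_real t * v)) has_real_derivative d) (at 0)"
    using assms real_differentiable_def by blast
  moreover have "dir_deriv v f z = d"
    unfolding dir_deriv_def using d DERIV_unique by (intro the_equality) auto
  ultimately show ?thesis by simp
qed

lemma test_fun_C2_compact:
  assumes "test_fun \<phi>"
  shows "\<exists>R. C2_compact \<phi> (dir_deriv 1 \<phi>) (dir_deriv \<i> \<phi>)
    (dir_deriv 1 (dir_deriv 1 \<phi>)) (dir_deriv \<i> (dir_deriv \<i> \<phi>)) R"
proof -
  have sm: "continuous_on UNIV (iter_partial vs \<phi>)"
    "v \<in> {1, \<i>} \<Longrightarrow> (\<lambda>t::real. iter_partial vs \<phi> (z + of_real t * v)) differentiable (at 0)"
    if "set vs \<subseteq> {1, \<i>}" for vs v z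
    using assms that unfolding test_fun_def smooth_fun_def by blast+
  have "bounded (closure {z. \<phi> z \<noteq> 0})" using assms compact_imp_bounded unfolding test_fun_def by blast
  then obtain R where R: "R > 0" "\<And>z. z \<in> closure {z. \<phi> z \<noteq> 0} \<Longrightarrow> norm z \<le> R" using bounded_pos by metis
  note c = sm(1)[of "[]", simplified] sm(1)[of "[1]", simplified] sm(1)[of "[\<i>]", simplified]
    sm(1)[of "[1, 1]", simplified] sm(1)[of "[\<i>, \<i>]", simplified]
  have "C2_compact \<phi> (dir_deriv 1 \<phi>) (dir_deriv \<i> \<phi>)
    (dir_deriv 1 (dir_deriv 1 \<phi>)) (dir_deriv \<i> (dir_deriv \<i> \<phi>)) R"
  proof
    fix z
    show "((\<lambda>t. \<phi> (z + of_real t)) has_real_derivative dir_deriv 1 \<phi> z) (at 0)"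
      using dir_deriv_has_derivative[OF sm(2)[of "[]" 1 z, unfolded iter_partial.simps]] by simp
    show "((\<lambda>t. \<phi> (z + of_real t * \<i>)) has_real_derivative dir_deriv \<i> \<phi> z) (at 0)"
      using dir_deriv_has_derivative[OF sm(2)[of "[]" \<i> z, unfolded iter_partial.simps]] by simp
    show "((\<lambda>t. dir_deriv 1 \<phi> (z + of_real t)) has_real_derivative dir_deriv 1 (dir_deriv 1 \<phi>) z) (at 0)"
      using dir_deriv_has_derivative[OF sm(2)[of "[1]" 1 z, unfolded iter_partial.simps]] by simp
    show "((\<lambda>t. dir_deriv \<i> \<phi> (z + of_real t * \<i>)) has_real_derivative dir_deriv \<i> (dir_deriv \<i> \<phi>) z) (at 0)"
      using dir_deriv_has_derivative[OF sm(2)[of "[\<i>]" \<i> z, unfolded iter_partial.simps]] by simp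
  next
    fix z :: complex assume z: "norm z > R"
    show "\<phi> z = 0"
    proof (rule ccontr)
      assume "\<phi> z \<noteq> 0"
      then have "z \<in> closure {z. \<phi> z \<noteq> 0}" by (intro closure_subset[THEN subsetD]) simp
      then show False using R(2)[of z] z by simp
    qed
  qed (rule c R(1))+
  then show ?thesis by blast
qed

text \<open>From \<open>- ln y = 2 * ln (1 / sqrt y) \<le> 2 / sqrt y\<close>. The bound holds at
  \<open>y = 0\<close> too, so a limit along a sequence that may hit 0 needs no case
  distinction.\<close>

lemma abs_mult_ln_le:
  assumes "0 \<le> y" "y \<le> (1::real)"
  shows "\<bar>y * ln y\<bar> \<le> 2 * sqrt y"
proof (cases "y = 0")
  case False
  then have y: "y > 0" using assms by simp
  have "- ln y = 2 * ln (1 / sqrt y)" using y by (simp add: ln_div ln_sqrt)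
  also have "\<dots> \<le> 2 * (1 / sqrt y)" using y ln_bound[of "1 / sqrt y"] by simp
  finally have "y * (- ln y) \<le> y * (2 * (1 / sqrt y))" using y by (intro mult_left_mono) auto
  also have "\<dots> = 2 * (y / sqrt y)" by simp
  also have "y / sqrt y = sqrt y" using y by (simp add: real_div_sqrt)
  finally have "y * (- ln y) \<le> 2 * sqrt y" .
  moreover have "ln y \<le> 0" using y assms by simp
  then have "y * ln y \<le> 0" using y by (simp add: mult_nonneg_nonpos)
  ultimately show ?thesis by simp
qed simp

section \<open>The three regimes of differentiation\<close>

context iid_coeffs
begin

context
  fixes N :: "nat \<Rightarrow> nat"
  assumes N_le: "\<And>n. N n \<le> n" and D_inf: "filterlim (\<lambda>n. n - N n) at_top sequentially"
begin

lemma ev_D_pos: "\<forall>\<^sub>F n in sequentially. n - N n > 0"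
proof -
  have "\<forall>\<^sub>F n in sequentially. n - N n \<ge> 1" using D_inf by (simp add: filterlim_at_top)
  then show ?thesis by eventually_elim simp
qed

lemma D_over_n: "n - N n > 0 \<Longrightarrow> real (n - N n) / real n = 1 - real (N n) / real n"
  using N_le[of n] by (simp add: of_nat_diff diff_divide_distrib)

lemma D_over_n_lim:
  assumes "(\<lambda>n. real (N n) / real n) \<longlonglongrightarrow> a"
  shows "(\<lambda>n. real (n - N n) / real n) \<longlonglongrightarrow> 1 - a"
proof (rule Lim_transform_eventually)
  show "(\<lambda>n. 1 - real (N n) / real n) \<longlonglongrightarrow> 1 - a" by (intro tendsto_intros assms)
  show "\<forall>\<^sub>F n in sequentially. 1 - real (N n) / real n = real (n - N n) / real n"
    using ev_D_pos by eventually_elim (rule D_over_n[symmetric])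
qed

lemma N_over_D_lim:
  assumes "(\<lambda>n. real (N n) / real n) \<longlonglongrightarrow> a" "a < 1"
  shows "(\<lambda>n. real (N n) / real (n - N n)) \<longlonglongrightarrow> a / (1 - a)"
proof (rule Lim_transform_eventually)
  show "(\<lambda>n. (real (N n) / real n) / (real (n - N n) / real n)) \<longlonglongrightarrow> a / (1 - a)"
    using assms by (intro tendsto_divide D_over_n_lim) auto
  show "\<forall>\<^sub>F n in sequentially. (real (N n) / real n) / (real (n - N n) / real n) = real (N n) / real (n - N n)"
    using ev_D_pos by eventually_elim auto
qed

lemma kac_scaling_circle:
  assumes lim: "(\<lambda>n. real (N n) / real n) \<longlonglongrightarrow> 0"
  shows "kac_scaling M \<xi> N (\<lambda>_. 1) (\<lambda>_. 0) 1"
proof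
  note ND = N_over_D_lim[OF lim, simplified]
  show "(\<lambda>n. - (real (N n) * ln (1 - 1 * s)) / real (n - N n)) \<longlonglongrightarrow> 0" for s
    using tendsto_mult[OF ND tendsto_const[of "- ln (1 - s)"]] by simp
  show "(\<lambda>n. real (n - N n) / real n / 1) \<longlonglongrightarrow> 1" using D_over_n_lim[OF lim] by simp
  \<comment> \<open>With \<open>y = N n / n\<close> the quotient is
    \<open>- (y * ln y) / (1 - y)\<close>, so it vanishes in the limit although the logarithm itself
    is unbounded when \<open>y\<close> tends to 0 through positive values.\<close>
  show "(\<lambda>n. - (real (N n) * ln (1 - real (n - N n) / real n)) / real (n - N n)) \<longlonglongrightarrow> 0"
  proof (rule Lim_transform_eventually)
    let ?y = "\<lambda>n. real (N n) / real n"
    have "(\<lambda>n. ?y n * ln (?y n)) \<longlonglongrightarrow> 0"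
    proof (rule Lim_null_comparison)
      show "\<forall>\<^sub>F n in sequentially. norm (?y n * ln (?y n)) \<le> 2 * sqrt (?y n)"
        using ev_D_pos
      proof eventually_elim
        fix n assume n: "n - N n > 0"
        have "0 \<le> ?y n" "?y n \<le> 1" using N_le[of n] n by (auto simp: divide_le_eq_1)
        then show "norm (?y n * ln (?y n)) \<le> 2 * sqrt (?y n)" unfolding real_norm_def by (rule abs_mult_ln_le)
      qed
      show "(\<lambda>n. 2 * sqrt (?y n)) \<longlonglongrightarrow> 0" using tendsto_mult[OF tendsto_const[of 2] tendsto_real_sqrt[OF lim]] by simp
    qed
    from tendsto_divide[OF tendsto_minus[OF this] D_over_n_lim[OF lim]]
    show "(\<lambda>n. - (?y n * ln (?y n)) / (real (n - N n) / real n)) \<longlonglongrightarrow> 0" by simp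
    show "\<forall>\<^sub>F n in sequentially. - (?y n * ln (?y n)) / (real (n - N n) / real n) =
      - (real (N n) * ln (1 - real (n - N n) / real n)) / real (n - N n)"
      using ev_D_pos by eventually_elim (auto simp: D_over_n[symmetric] D_over_n field_simps)
  qed
  have "(\<lambda>s::real. if s \<le> 1 then 0 else 0 + ln (s / 1)) = (\<lambda>s. ln (max s 1))"
    by (auto simp: fun_eq_iff max_def)
  moreover have "continuous_on {0..} (\<lambda>s::real. ln (max s 1))" by (intro continuous_intros) auto
  ultimately show "continuous_on {0..} (\<lambda>s::real. if s \<le> 1 then 0 else 0 + ln (s / 1))" by (simp only:)
qed (use N_le D_inf in auto)

text \<open>The factor \<open>a / (1 - a)\<close> is the limit of \<open>N n / (n - N n)\<close>. As
  \<open>a > 0\<close>, also \<open>N n\<close> tends to infinity and with it the mode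
  \<open>s / (1 - s) * N n\<close>, so the anticoncentration regime applies inside the critical
  radius.\<close>

lemma kac_scaling_bulk:
  assumes lim: "(\<lambda>n. real (N n) / real n) \<longlonglongrightarrow> a" and a: "0 < a" "a < 1"
  shows "kac_scaling M \<xi> N (\<lambda>_. 1) (\<lambda>s. - (a / (1 - a) * ln (1 - s))) (1 - a)"
proof
  note ND = N_over_D_lim[OF lim a(2)]
  show "(\<lambda>n. - (real (N n) * ln (1 - 1 * s)) / real (n - N n)) \<longlonglongrightarrow> - (a / (1 - a) * ln (1 - s))" for s
    using tendsto_mult[OF ND tendsto_const[of "- ln (1 - s)"]] by simp
  show "(\<lambda>n. real (n - N n) / real n / 1) \<longlonglongrightarrow> 1 - a" using D_over_n_lim[OF lim] by simp
  have "(\<lambda>n. ln (1 - real (n - N n) / real n)) \<longlonglongrightarrow> ln (1 - (1 - a))"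
    using a by (intro tendsto_ln tendsto_diff tendsto_const D_over_n_lim lim) auto
  from tendsto_minus[OF tendsto_mult[OF ND this]]
  show "(\<lambda>n. - (real (N n) * ln (1 - real (n - N n) / real n)) / real (n - N n)) \<longlonglongrightarrow> - (a / (1 - a) * ln (1 - (1 - a)))"
    by simp
  show "continuous_on {0..} (\<lambda>s. if s \<le> 1 - a then - (a / (1 - a) * ln (1 - s)) else - (a / (1 - a) * ln (1 - (1 - a))) + ln (s / (1 - a)))"
  proof -
    have "continuous_on ({0..1 - a} \<union> {1 - a..}) (\<lambda>s. if s \<le> 1 - a then - (a / (1 - a) * ln (1 - s)) else - (a / (1 - a) * ln (1 - (1 - a))) + ln (s / (1 - a)))"
      by (rule continuous_on_If) (use a in \<open>auto intro!: continuous_intros\<close>)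
    also have "{0..1 - a} \<union> {1 - a..} = {0..}" using a by auto
    finally show ?thesis .
  qed
  have Ninf: "filterlim (\<lambda>n. real (N n)) at_top sequentially"
  proof -
    have F: "filterlim (\<lambda>n. real (N n) / real n * real n) at_top sequentially"
      by (rule filterlim_tendsto_pos_mult_at_top[OF lim a(1) filterlim_real_sequentially])
    have ev: "\<forall>\<^sub>F n in sequentially. real (N n) / real n * real n = real (N n)"
      using eventually_gt_at_top[of 0] by eventually_elim simp
    show ?thesis by (rule filterlim_cong[OF refl refl ev, THEN iffD1, OF F])
  qed
  have "filterlim (\<lambda>n. nb_mode (N n) (1 * s)) at_top sequentially" if "0 < s" "s < 1 - a" for s
  proof -
    have "filterlim (\<lambda>n. s / (1 - s) * real (N n)) at_top sequentially"
      by (rule filterlim_tendsto_pos_mult_at_top[OF tendsto_const _ Ninf]) (use that a in auto)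
    then show ?thesis by (simp add: nb_mode_def)
  qed
  then show "(\<forall>s. 0 < s \<and> s < 1 - a \<longrightarrow> - (a / (1 - a) * ln (1 - s)) = 0) \<or>
      (\<forall>s. 0 < s \<and> s < 1 - a \<longrightarrow> filterlim (\<lambda>n. nb_mode (N n) (1 * s)) at_top sequentially)" by blast
qed (use N_le D_inf a in auto)

text \<open>Taking the critical radius itself as unit of length makes \<open>sc = 1\<close>. The
  mode is at least \<open>s * (N n / n) * (n - N n)\<close> and so tends to infinity although the
  actual radius tends to 0.\<close>

lemma kac_scaling_edge:
  assumes lim: "(\<lambda>n. real (N n) / real n) \<longlonglongrightarrow> 1"
  shows "kac_scaling M \<xi> N (\<lambda>n. real (n - N n) / real n) (\<lambda>s. s) 1"
proof
  let ?x = "\<lambda>n. real (n - N n) / real n"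
  have x0: "?x \<longlonglongrightarrow> 0" using D_over_n_lim[OF lim] by simp
  have xr: "filterlim ?x (at_right 0) sequentially"
    unfolding filterlim_at
  proof (intro conjI x0)
    show "\<forall>\<^sub>F n in sequentially. ?x n \<in> {0<..} \<and> ?x n \<noteq> 0"
      using ev_D_pos by eventually_elim auto
  qed
  have gl: "(\<lambda>n. - (real (N n) * ln (1 - ?x n * s)) / real (n - N n)) \<longlonglongrightarrow> s" if "s > 0" for s
  proof (rule Lim_transform_eventually)
    \<comment> \<open>With \<open>x = (n - N n) / n\<close> one has
      \<open>N n / (n - N n) = (1 - x) / x\<close>, so the limit is that of a function of one
      variable at 0 from the right.\<close>
    have "((\<lambda>x. - ((1 - x) * ln (1 - x * s)) / x) \<longlongrightarrow> s) (at_right 0)" using that by real_asymp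
    then show "(\<lambda>n. - ((1 - ?x n) * ln (1 - ?x n * s)) / ?x n) \<longlonglongrightarrow> s" by (rule filterlim_compose[OF _ xr])
    show "\<forall>\<^sub>F n in sequentially. - ((1 - ?x n) * ln (1 - ?x n * s)) / ?x n = - (real (N n) * ln (1 - ?x n * s)) / real (n - N n)"
      using ev_D_pos
    proof eventually_elim
      fix n assume n: "n - N n > 0"
      then have "1 - ?x n = real (N n) / real n" using D_over_n[OF n] by simp
      then show "- ((1 - ?x n) * ln (1 - ?x n * s)) / ?x n = - (real (N n) * ln (1 - ?x n * s)) / real (n - N n)"
        using n by (simp only:) auto
    qed
  qed
  show "0 < s \<Longrightarrow> s < 1 \<Longrightarrow> (\<lambda>n. - (real (N n) * ln (1 - ?x n * s)) / real (n - N n)) \<longlonglongrightarrow> s" for s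
    by (rule gl)
  show "(\<lambda>n. - (real (N n) * ln (1 - ?x n)) / real (n - N n)) \<longlonglongrightarrow> 1" using gl[of 1] by simp
  show "(\<lambda>n. ?x n / ?x n) \<longlonglongrightarrow> 1"
    using ev_D_pos by (intro tendsto_eventually) (auto elim!: eventually_mono)
  show "continuous_on {0..} (\<lambda>s::real. if s \<le> 1 then s else 1 + ln (s / 1))"
  proof -
    have "continuous_on ({0..1} \<union> {1..}) (\<lambda>s::real. if s \<le> 1 then s else 1 + ln (s / 1))"
      by (rule continuous_on_If) (auto intro!: continuous_intros)
    also have "{0..1} \<union> {1..} = {0::real..}" by auto
    finally show ?thesis .
  qed
  have "filterlim (\<lambda>n. nb_mode (N n) (?x n * s)) at_top sequentially" if s: "0 < s" "s < 1" for s
  proof (rule filterlim_at_top_mono)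
    have "(\<lambda>n. s * (real (N n) / real n)) \<longlonglongrightarrow> s * 1" by (intro tendsto_mult tendsto_const lim)
    then show "filterlim (\<lambda>n. s * (real (N n) / real n) * real (n - N n)) at_top sequentially"
      by (rule filterlim_tendsto_pos_mult_at_top) (use s filterlim_compose[OF filterlim_real_sequentially D_inf] in auto)
    show "\<forall>\<^sub>F n in sequentially. s * (real (N n) / real n) * real (n - N n) \<le> nb_mode (N n) (?x n * s)"
      using ev_D_pos
    proof eventually_elim
      fix n assume n: "n - N n > 0"
      have x: "0 < ?x n" "?x n \<le> 1" using n by (auto simp: divide_le_eq_1)
      have xs: "?x n * s < 1" using x s mult_le_one[of "?x n" s] mult_right_mono[of "?x n" 1 s] by linarith
      have "?x n * s * real (N n) * 1 \<le> ?x n * s * real (N n) * (1 / (1 - ?x n * s))"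
      proof (rule mult_left_mono)
        show "0 \<le> ?x n * s * real (N n)" by (intro mult_nonneg_nonneg) (use x s in auto)
        have "0 < 1 - ?x n * s" "1 - ?x n * s \<le> 1" using xs mult_pos_pos[OF x(1) s(1)] by linarith+
        then show "1 \<le> 1 / (1 - ?x n * s)" by (simp only: pos_le_divide_eq mult_1)
      qed
      then show "s * (real (N n) / real n) * real (n - N n) \<le> nb_mode (N n) (?x n * s)"
        by (simp add: nb_mode_def mult_ac)
    qed
  qed
  then show "(\<forall>s. 0 < s \<and> s < 1 \<longrightarrow> s = 0) \<or>
      (\<forall>s. 0 < s \<and> s < 1 \<longrightarrow> filterlim (\<lambda>n. nb_mode (N n) (?x n * s)) at_top sequentially)" by blast
qed (use N_le D_inf in auto)

lemma kac_circle:
  assumes "(\<lambda>n. real (N n) / real n) \<longlonglongrightarrow> 0"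
  shows "measures_conv_in_prob M
    (\<lambda>n \<omega> \<phi>. zero_integral ((pderiv ^^ N n) (kac_poly \<xi> n \<omega>)) \<phi> / real (n - N n)) unif_circle"
  unfolding measures_conv_in_prob_def
proof (intro allI impI)
  fix \<phi> :: "complex \<Rightarrow> real" assume "test_fun \<phi>"
  then obtain R where C2: "C2_compact \<phi> (dir_deriv 1 \<phi>) (dir_deriv \<i> \<phi>)
    (dir_deriv 1 (dir_deriv 1 \<phi>)) (dir_deriv \<i> (dir_deriv \<i> \<phi>)) R"
    using test_fun_C2_compact by blast
  interpret K: kac_scaling M \<xi> N "\<lambda>_. 1" "\<lambda>_. 0" 1 by (rule kac_scaling_circle[OF assms])
  show "conv_in_prob M (\<lambda>n \<omega>. zero_integral ((pderiv ^^ N n) (kac_poly \<xi> n \<omega>)) \<phi> / real (n - N n)) (integral\<^sup>L unif_circle \<phi>)"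
    using K.main_convergence[OF C2] C2_compact.integral_unif_circle[OF C2] by (simp add: K.U_def)
qed

lemma kac_bulk:
  assumes lim: "(\<lambda>n. real (N n) / real n) \<longlonglongrightarrow> a" and a: "0 < a" "a < 1" and rot: "rot_invariant \<nu>"
    and F: "\<And>r. 0 < r \<Longrightarrow> r < 1 - a \<Longrightarrow> emeasure \<nu> (ball 0 r) = ennreal (a * r / ((1 - a) * (1 - r)))"
    and F1: "\<And>r. r \<ge> 1 - a \<Longrightarrow> emeasure \<nu> (ball 0 r) = 1"
  shows "measures_conv_in_prob M
    (\<lambda>n \<omega> \<phi>. zero_integral ((pderiv ^^ N n) (kac_poly \<xi> n \<omega>)) \<phi> / real (n - N n)) \<nu>"
  unfolding measures_conv_in_prob_def
proof (intro allI impI)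
  fix \<phi> :: "complex \<Rightarrow> real" assume "test_fun \<phi>"
  then obtain R where C2: "C2_compact \<phi> (dir_deriv 1 \<phi>) (dir_deriv \<i> \<phi>)
    (dir_deriv 1 (dir_deriv 1 \<phi>)) (dir_deriv \<i> (dir_deriv \<i> \<phi>)) R"
    using test_fun_C2_compact by blast
  let ?g = "\<lambda>s. - (a / (1 - a) * ln (1 - s))"
  interpret K: kac_scaling M \<xi> N "\<lambda>_. 1" ?g "1 - a" by (rule kac_scaling_bulk[OF lim a])
  have "integral\<^sup>L \<nu> \<phi> = (\<integral>z. K.U (norm z) * C2_compact.lap (dir_deriv 1 (dir_deriv 1 \<phi>)) (dir_deriv \<i> (dir_deriv \<i> \<phi>)) z \<partial>lborel) / (2 * pi)"
    unfolding K.U_def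
  \<comment> \<open>\<open>g'\<close> is the prescribed mass of the disc of radius \<open>t\<close>,
    divided by \<open>t\<close>. That its antiderivative is the limiting potential of the
    polynomials is what identifies the limit as \<open>\<nu>\<close>.\<close>
  proof (rule C2_compact.integral_rot_invariant_potential[OF C2 rot, where g' = "\<lambda>t. a / (1 - a) / (1 - t)"])
    show "(?g has_real_derivative a / (1 - a) / (1 - t)) (at t)" if "0 < t" "t \<le> 1 - a" for t
      using that a by (auto intro!: derivative_eq_intros simp: divide_simps)
    show "emeasure \<nu> (ball 0 t) = ennreal (t * (a / (1 - a) / (1 - t)))" if "0 < t" "t < 1 - a" for t
      using F[OF that] by (simp add: mult.commute)
    show "continuous_on {0..} (\<lambda>s. if s \<le> 1 - a then ?g s else ?g (1 - a) + ln (s / (1 - a)))"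
      by (rule K.U_cont)
  qed (use a F1 in auto)
  then show "conv_in_prob M (\<lambda>n \<omega>. zero_integral ((pderiv ^^ N n) (kac_poly \<xi> n \<omega>)) \<phi> / real (n - N n)) (integral\<^sup>L \<nu> \<phi>)"
    using K.main_convergence[OF C2] by simp
qed

text \<open>The scaling of the edge regime is reused with the test function left unscaled: the unit
  of length \<open>(n - N n) / n\<close> tends to 0 and carries almost all zeros with it.\<close>

lemma kac_dirac:
  assumes lim: "(\<lambda>n. real (N n) / real n) \<longlonglongrightarrow> 1"
  shows "measures_conv_in_prob M
    (\<lambda>n \<omega> \<phi>. zero_integral ((pderiv ^^ N n) (kac_poly \<xi> n \<omega>)) \<phi> / real (n - N n)) (return borel 0)"
  unfolding measures_conv_in_prob_def
proof (intro allI impI)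
  fix \<phi> :: "complex \<Rightarrow> real" assume "test_fun \<phi>"
  then obtain R where C2: "C2_compact \<phi> (dir_deriv 1 \<phi>) (dir_deriv \<i> \<phi>)
    (dir_deriv 1 (dir_deriv 1 \<phi>)) (dir_deriv \<i> (dir_deriv \<i> \<phi>)) R"
    using test_fun_C2_compact by blast
  interpret C2_compact \<phi> "dir_deriv 1 \<phi>" "dir_deriv \<i> \<phi>"
    "dir_deriv 1 (dir_deriv 1 \<phi>)" "dir_deriv \<i> (dir_deriv \<i> \<phi>)" R by (rule C2)
  interpret K: kac_scaling M \<xi> N "\<lambda>n. real (n - N n) / real n" "\<lambda>s. s" 1 by (rule kac_scaling_edge[OF lim])
  obtain C where C: "\<And>z. \<bar>\<phi> z\<bar> \<le> C" using bounded_of_cont_supp[OF R_pos cont_f supp] by blast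
  have "(\<lambda>n. real (n - N n) / real n) \<longlonglongrightarrow> 0" using D_over_n_lim[OF lim] by simp
  from K.collapse_to_zero[OF this cont_f C]
  show "conv_in_prob M (\<lambda>n \<omega>. zero_integral ((pderiv ^^ N n) (kac_poly \<xi> n \<omega>)) \<phi> / real (n - N n)) (integral\<^sup>L (return borel 0) \<phi>)"
    by (simp add: integral_return)
qed

lemma kac_edge:
  assumes lim: "(\<lambda>n. real (N n) / real n) \<longlonglongrightarrow> 1" and rot: "rot_invariant \<nu>"
    and F: "\<And>r. 0 < r \<Longrightarrow> r < 1 \<Longrightarrow> emeasure \<nu> (ball 0 r) = ennreal r"
    and F1: "\<And>r. r \<ge> 1 \<Longrightarrow> emeasure \<nu> (ball 0 r) = 1"
  shows "measures_conv_in_prob M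
    (\<lambda>n \<omega> \<phi>. zero_integral ((pderiv ^^ N n) (kac_poly \<xi> n \<omega>))
       (\<lambda>z. \<phi> (of_real (real n / real (n - N n)) * z)) / real (n - N n)) \<nu>"
  unfolding measures_conv_in_prob_def
proof (intro allI impI)
  fix \<phi> :: "complex \<Rightarrow> real" assume "test_fun \<phi>"
  then obtain R where C2: "C2_compact \<phi> (dir_deriv 1 \<phi>) (dir_deriv \<i> \<phi>)
    (dir_deriv 1 (dir_deriv 1 \<phi>)) (dir_deriv \<i> (dir_deriv \<i> \<phi>)) R"
    using test_fun_C2_compact by blast
  interpret K: kac_scaling M \<xi> N "\<lambda>n. real (n - N n) / real n" "\<lambda>s. s" 1 by (rule kac_scaling_edge[OF lim])
  have "integral\<^sup>L \<nu> \<phi> = (\<integral>z. K.U (norm z) * C2_compact.lap (dir_deriv 1 (dir_deriv 1 \<phi>)) (dir_deriv \<i> (dir_deriv \<i> \<phi>)) z \<partial>lborel) / (2 * pi)"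
    unfolding K.U_def
    by (rule C2_compact.integral_rot_invariant_potential[OF C2 rot, where g' = "\<lambda>_. 1"])
       (use F F1 K.U_cont in auto)
  moreover have "(\<lambda>z. \<phi> (z / of_real (real (n - N n) / real n))) = (\<lambda>z. \<phi> (of_real (real n / real (n - N n)) * z))" for n
    by (simp add: fun_eq_iff mult.commute)
  ultimately show "conv_in_prob M (\<lambda>n \<omega>. zero_integral ((pderiv ^^ N n) (kac_poly \<xi> n \<omega>))
       (\<lambda>z. \<phi> (of_real (real n / real (n - N n)) * z)) / real (n - N n)) (integral\<^sup>L \<nu> \<phi>)"
    using K.main_convergence[OF C2] by simp
qed

end

end

theorem theorem3:
  fixes M :: "'a measure" and \<xi> :: "nat \<Rightarrow> 'a \<Rightarrow> complex" and N :: "nat \<Rightarrow> nat"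
  assumes "prob_space M"
    and rv: "\<And>k. \<xi> k \<in> borel_measurable M"
    and indep: "prob_space.indep_vars M (\<lambda>_. borel) \<xi> UNIV"
    and ident: "\<And>k. distr M borel (\<xi> k) = distr M borel (\<xi> 0)"
    and nondeg: "\<not> (\<exists>c. measure M {\<omega>\<in>space M. \<xi> 0 \<omega> = c} = 1)"
    and nozero: "measure M {\<omega>\<in>space M. \<xi> 0 \<omega> = 0} = 0"
    and logmom: "integrable M (\<lambda>\<omega>. ln (1 + cmod (\<xi> 0 \<omega>)))"
    and N_le: "\<And>n. N n \<le> n"
    and D_inf: "filterlim (\<lambda>n. n - N n) at_top sequentially"
  shows
    "((\<lambda>n. real (N n) / real n) \<longlonglongrightarrow> 0 \<longrightarrow>
        measures_conv_in_prob M
          (\<lambda>n \<omega> \<phi>. zero_integral ((pderiv ^^ N n) (kac_poly \<xi> n \<omega>)) \<phi> / real (n - N n))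
          unif_circle)
   \<and> (\<forall>a::real. 0 < a \<and> a < 1 \<and> (\<lambda>n. real (N n) / real n) \<longlonglongrightarrow> a \<longrightarrow>
        (\<forall>\<nu>. rot_invariant \<nu> \<and>
             (\<forall>r. 0 < r \<and> r < 1 - a \<longrightarrow> emeasure \<nu> (ball 0 r) = ennreal (a * r / ((1 - a) * (1 - r)))) \<and>
             (\<forall>r. r \<ge> 1 - a \<longrightarrow> emeasure \<nu> (ball 0 r) = 1) \<longrightarrow>
           measures_conv_in_prob M
             (\<lambda>n \<omega> \<phi>. zero_integral ((pderiv ^^ N n) (kac_poly \<xi> n \<omega>)) \<phi> / real (n - N n))
             \<nu>))
   \<and> ((\<lambda>n. real (N n) / real n) \<longlonglongrightarrow> 1 \<longrightarrow>
        measures_conv_in_prob M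
          (\<lambda>n \<omega> \<phi>. zero_integral ((pderiv ^^ N n) (kac_poly \<xi> n \<omega>)) \<phi> / real (n - N n))
          (return borel 0)
      \<and> (\<forall>\<nu>. rot_invariant \<nu> \<and>
             (\<forall>r. 0 < r \<and> r < 1 \<longrightarrow> emeasure \<nu> (ball 0 r) = ennreal r) \<and>
             (\<forall>r. r \<ge> 1 \<longrightarrow> emeasure \<nu> (ball 0 r) = 1) \<longrightarrow>
           measures_conv_in_prob M
             (\<lambda>n \<omega> \<phi>. zero_integral ((pderiv ^^ N n) (kac_poly \<xi> n \<omega>))
                          (\<lambda>z. \<phi> (of_real (real n / real (n - N n)) * z)) / real (n - N n))
             \<nu>))"
proof -
  interpret iid_coeffs M \<xi>
    by (intro iid_coeffs.intro iid_coeffs_axioms.intro assms(1) rv indep ident nondeg nozero logmom)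
  show ?thesis
    using kac_circle[OF N_le D_inf] kac_bulk[OF N_le D_inf] kac_dirac[OF N_le D_inf] kac_edge[OF N_le D_inf]
    by blast
qed

end
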